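(* Let $\eta$ be a stationary Poisson hyperplane process in $\mathbb{R}^d$ with intensity parameter $\gamma>0$ and directional distribution $\mathbb{Q}$ (an even probability measure on $\mathbb{S}^{d-1}$ not concentrated on a great subsphere), and let $\Phi$ be the intersection point process associated with $\eta$. Let $K\subset\mathbb{R}^d$ be convex and compact. Then there exists a $\Phi$-stopping set $Z$ with $Z\subset K^c$ and such that $\eta\cap[K]$ is almost surely determined by $\Phi\cap Z$. Moreover, there exist constants $c_1,c_2>0$ such that $$\mathbb{P}(R(Z)>s)\le c_1e^{-c_2 s},\qquad s\ge 1.$$
   Context: All random objects are defined on a fixed probability space $(\Omega,\mathcal{F},\mathbb{P})$, and $\mathbb{R}^d$ is the $d$-dimensional Euclidean space. Hyperplanes: $\mathbb{H}^{d-1}$ is the space of all (affine) hyperplanes in $\mathbb{R}^d$; each is of the form $H_{u,s}=\{y\in\mathbb{R}^d:\langle y,u\rangle=s\}$ with $u\in\mathbb{S}^{d-1}$ (unit sphere), $s\in\mathbb{R}$. For compact $K\subset\mathbb{R}^d$ put $[K]:=\{H\in\mathbb{H}^{d-1}:H\cap K\neq\emptyset\}$; $\mathbb{H}^{d-1}$ carries the smallest $\sigma$-field containing all sets $[K]$, $K$ compact. Poisson hyperplane process: $\eta$ is a Poisson process on $\mathbb{H}^{d-1}$ with intensity measure $\lambda=\gamma\int_{\mathbb{S}^{d-1}}\int_{\mathbb{R}}\mathbf{1}\{H_{u,s}\in\cdot\}\,ds\,\mathbb{Q}(du)$, where $\gamma>0$ and $\mathbb{Q}$ is an even probability measure on $\mathbb{S}^{d-1}$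 not concentrated on a great subsphere (the intersection of $\mathbb{S}^{d-1}$ with a $(d-1)$-dimensional linear subspace). $\eta$ is regarded as a random discrete subset of $\mathbb{H}^{d-1}$, and it is assumed without loss of generality that $|\eta(\omega)\cap[K]|<\infty$ for all $\omega\in\Omega$ and all compact $K$. Intersection point process: $\Phi$ is the (almost surely locally finite) set of all points $x\in\mathbb{R}^d$ with $\{x\}=H_1\cap\cdots\cap H_d$ for some $H_1,\ldots,H_d\in\eta$; it is also regarded as a random counting measure. Stopping sets: for a random measure $\Psi$ on $\mathbb{R}^d$ and a Borel set $B$, $\Psi_B:=\Psi(\cdot\cap B)$ is the restriction of $\Psi$ to $B$. A mapping $Z$ from $\Omega$ into the space of non-empty closed subsets of $\mathbb{R}^d$ is a $\Psi$-stopping set if for each closed $F\subset\mathbb{R}^d$ the event $\{Z\subset F\}:=\{\omega:Z(\omega)\subset F\}$ belongs to the $\sigma$-field $\sigma(\Psi_F)$ generated by $\Psi_F$. $\Psi_Z$ is the random measure $\omega\mapsto\Psi(\omega)_{Z(\omega)}$; for $\Psi=\Phi$ it is identified with $\Phi\cap Z$. For a $\Psi$-stopping set $Z$, $\eta\cap[K]$ is almost surely determined by $\Psi_Z$ if there is a measurable mapping $f$ (with suitable domain) such that $\eta\cap[K]=f(\Psi_Z)$ almost surely. Size: for closed $F\subset\mathbb{R}^d$, $R(F)$ is the radius of the smallest ball centred at the origin containing $F$, with $R(F):=\infty$ if $F$ is unbounded. $K^c$ denotes the complement $\mathbb{R}^d\setminus K$.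
   Formalization: The dimension is assumed to satisfy d ≥ 2; for d = 1 hyperplanes are points and Φ = η, so by complete independence of the Poisson process η∩[K] (e.g. K = [0,1]) cannot be determined by Φ on a set Z ⊂ K^c, and the claim fails. *)

theory Defs
  imports "HOL-Probability.Probability"
begin

section \<open>Hyperplanes\<close>

definition hyperplane :: "'a::euclidean_space \<Rightarrow> real \<Rightarrow> 'a set" where
  "hyperplane u s = {y. y \<bullet> u = s}"

definition hyperplanes :: "'a::euclidean_space set set" where
  "hyperplanes = {hyperplane u s | u s. u \<in> sphere 0 1}"

definition hitting :: "'a::euclidean_space set \<Rightarrow> 'a set set" where
  "hitting K = {H \<in> hyperplanes. H \<inter> K \<noteq> {}}"

definition hyperplane_space :: "'a::euclidean_space set measure" where
  "hyperplane_space = sigma hyperplanes {hitting K | K. compact K}"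

definition directional_distribution :: "'a::euclidean_space measure \<Rightarrow> bool" where
  "directional_distribution Q \<longleftrightarrow>
     prob_space Q \<and>
     sets Q = sets (restrict_space borel (sphere 0 1)) \<and>
     (\<forall>A\<in>sets Q. emeasure Q (uminus ` A) = emeasure Q A) \<and>
     (\<forall>L. subspace L \<and> dim L = DIM('a) - 1 \<longrightarrow> emeasure Q (sphere 0 1 \<inter> L) \<noteq> 1)"

text \<open>The explicit double integral is given in \<open>emeasure_hyperplane_intensity\<close> below.\<close>

definition hyperplane_intensity :: "real \<Rightarrow> 'a::euclidean_space measure \<Rightarrow> 'a set measure" where
  "hyperplane_intensity \<gamma> Q =
     scale_measure (ennreal \<gamma>)
       (distr (Q \<Otimes>\<^sub>M lborel) hyperplane_space (\<lambda>(u, s). hyperplane u s))"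


section \<open>Random measures and point processes\<close>

text \<open>
  The measures on the measurable space \<open>N\<close>, with the smallest \<open>\<sigma>\<close>-field making all
  evaluations \<open>\<mu> \<mapsto> \<mu>(A)\<close> measurable (compare \<^const>\<open>subprob_algebra\<close>).
\<close>

definition measure_algebra :: "'b measure \<Rightarrow> 'b measure measure" where
  "measure_algebra N =
     (SUP A\<in>sets N. vimage_algebra {\<mu>. sets \<mu> = sets N} (\<lambda>\<mu>. emeasure \<mu> A) borel)"

text \<open>A discrete set as a counting measure: \<open>A \<mapsto> |S \<inter> A|\<close>.\<close>

definition counting_measure :: "'b measure \<Rightarrow> 'b set \<Rightarrow> 'b measure" where
  "counting_measure N S = distr (count_space S) N (\<lambda>x. x)"

text \<open>For measurable \<open>B\<close> this is \<open>A \<mapsto> \<mu>(A \<inter> B)\<close>, on the same space as \<open>\<mu>\<close>.\<close>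

definition measure_restriction :: "'b measure \<Rightarrow> 'b set \<Rightarrow> 'b measure" where
  "measure_restriction \<mu> B = density \<mu> (indicator B)"

definition poisson_process :: "'w measure \<Rightarrow> 'b measure \<Rightarrow> ('w \<Rightarrow> 'b measure) \<Rightarrow> bool" where
  "poisson_process M \<Lambda> \<xi> \<longleftrightarrow>
     \<xi> \<in> M \<rightarrow>\<^sub>M measure_algebra \<Lambda> \<and>
     (\<forall>B\<in>sets \<Lambda>. emeasure \<Lambda> B < \<infinity> \<longrightarrow>
        (\<forall>k::nat. measure M {\<omega>\<in>space M. emeasure (\<xi> \<omega>) B = of_nat k} =
           measure \<Lambda> B ^ k / fact k * exp (- measure \<Lambda> B))) \<and>
     (\<forall>B\<in>sets \<Lambda>. emeasure \<Lambda> B = \<infinity> \<longrightarrow> (AE \<omega> in M. emeasure (\<xi> \<omega>) B = \<infinity>)) \<and>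
     (\<forall>(n::nat) B. (\<forall>i<n. B i \<in> sets \<Lambda>) \<and> disjoint_family_on B {..<n} \<longrightarrow>
        prob_space.indep_vars M (\<lambda>_. borel) (\<lambda>i \<omega>. emeasure (\<xi> \<omega>) (B i)) {..<n})"

text \<open>Hyperplane configurations with only finitely many hyperplanes hitting any compact set;
  their \<open>\<sigma>\<close>-field is the one generated by the counts \<open>S \<mapsto> |S \<inter> A|\<close>.\<close>

definition hyperplane_configurations :: "'a::euclidean_space set set set" where
  "hyperplane_configurations =
     {S. S \<subseteq> hyperplanes \<and> (\<forall>K. compact K \<longrightarrow> finite (S \<inter> hitting K))}"

definition configuration_algebra :: "'a::euclidean_space set set measure" where
  "configuration_algebra =
     vimage_algebra hyperplane_configurations (counting_measure hyperplane_space)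
       (measure_algebra hyperplane_space)"

definition poisson_hyperplane_process ::
    "'w measure \<Rightarrow> real \<Rightarrow> 'a::euclidean_space measure \<Rightarrow> ('w \<Rightarrow> 'a set set) \<Rightarrow> bool" where
  "poisson_hyperplane_process M \<gamma> Q \<eta> \<longleftrightarrow>
     (\<forall>\<omega>\<in>space M. \<eta> \<omega> \<in> hyperplane_configurations) \<and>
     poisson_process M (hyperplane_intensity \<gamma> Q)
       (\<lambda>\<omega>. counting_measure hyperplane_space (\<eta> \<omega>))"

definition intersection_points :: "'a::euclidean_space set set \<Rightarrow> 'a set" where
  "intersection_points S =
     {x. \<exists>H. (\<forall>i<DIM('a). H i \<in> S) \<and> {x} = (\<Inter>i<DIM('a). H i)}"

definition intersection_process ::
    "('w \<Rightarrow> 'a::euclidean_space set set) \<Rightarrow> 'w \<Rightarrow> 'a measure" where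
  "intersection_process \<eta> \<omega> = counting_measure borel (intersection_points (\<eta> \<omega>))"


section \<open>Stopping sets\<close>

definition random_measure :: "'w measure \<Rightarrow> ('w \<Rightarrow> 'a::euclidean_space measure) \<Rightarrow> bool" where
  "random_measure M \<Psi> \<longleftrightarrow>
     \<Psi> \<in> M \<rightarrow>\<^sub>M measure_algebra borel \<and>
     (\<forall>\<omega>\<in>space M. \<forall>C. compact C \<longrightarrow> emeasure (\<Psi> \<omega>) C < \<infinity>)"

text \<open>
  Being a random measure is part of the notion: it makes \<open>\<sigma>(\<Psi>\<^sub>F)\<close> a sub-\<open>\<sigma>\<close>-field of \<open>M\<close>,
  so that the sets \<open>{Z \<subseteq> F}\<close> are events.
\<close>

definition stopping_set ::
    "'w measure \<Rightarrow> ('w \<Rightarrow> 'a::euclidean_space measure) \<Rightarrow> ('w \<Rightarrow> 'a set) \<Rightarrow> bool" where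
  "stopping_set M \<Psi> Z \<longleftrightarrow>
     random_measure M \<Psi> \<and>
     (\<forall>\<omega>\<in>space M. closed (Z \<omega>) \<and> Z \<omega> \<noteq> {}) \<and>
     (\<forall>F. closed F \<longrightarrow>
        {\<omega>\<in>space M. Z \<omega> \<subseteq> F} \<in>
          sets (vimage_algebra (space M) (\<lambda>\<omega>. measure_restriction (\<Psi> \<omega>) F)
                 (measure_algebra borel)))"

definition almost_surely_determined ::
    "'w measure \<Rightarrow> ('w \<Rightarrow> 'a::euclidean_space set set) \<Rightarrow> 'a set \<Rightarrow>
     ('w \<Rightarrow> 'a measure) \<Rightarrow> ('w \<Rightarrow> 'a set) \<Rightarrow> bool" where
  "almost_surely_determined M \<eta> K \<Psi> Z \<longleftrightarrow>
     (\<exists>f. f \<in> measure_algebra borel \<rightarrow>\<^sub>M configuration_algebra \<and>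
        (AE \<omega> in M. \<eta> \<omega> \<inter> hitting K = f (measure_restriction (\<Psi> \<omega>) (Z \<omega>))))"

definition origin_radius :: "'a::euclidean_space set \<Rightarrow> ereal" where
  "origin_radius F =
     (if bounded F then ereal (Inf {r. 0 \<le> r \<and> F \<subseteq> cball 0 r}) else \<infinity>)"


section \<open>Basic facts\<close>

lemma space_hyperplane_space: "space hyperplane_space = hyperplanes"
  unfolding hyperplane_space_def by (rule space_measure_of) (auto simp: hitting_def)

lemma sets_hyperplane_space:
  "sets hyperplane_space = sigma_sets hyperplanes {hitting K | K. compact K}"
  unfolding hyperplane_space_def by (rule sets_measure_of) (auto simp: hitting_def)

lemma space_measure_algebra: "space (measure_algebra N) = {\<mu>. sets \<mu> = sets N}"
  by (auto simp: measure_algebra_def space_Sup_eq_UN)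

lemma emeasure_counting_measure:
  assumes "S \<subseteq> space N" "A \<in> sets N"
  shows "emeasure (counting_measure N S) A = emeasure (count_space UNIV) (S \<inter> A)"
proof -
  have "(\<lambda>x. x) \<in> count_space S \<rightarrow>\<^sub>M N"
    using assms(1) by auto
  then have "emeasure (counting_measure N S) A = emeasure (count_space S) (S \<inter> A)"
    unfolding counting_measure_def using assms(2)
    by (subst emeasure_distr) (auto simp: vimage_def Int_commute)
  then show ?thesis
    by (simp add: emeasure_count_space)
qed

lemma emeasure_measure_restriction:
  assumes "A \<in> sets \<mu>" "B \<in> sets \<mu>"
  shows "emeasure (measure_restriction \<mu> B) A = emeasure \<mu> (A \<inter> B)"
  unfolding measure_restriction_def using assms
  by (subst emeasure_density) (auto simp: indicator_inter_arith[symmetric] Int_commute)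

lemma measurable_hyperplane:
  fixes Q :: "'a::euclidean_space measure"
  assumes Q: "sets Q = sets (restrict_space borel (sphere 0 1))"
  shows "(\<lambda>(u, s). hyperplane u s) \<in> Q \<Otimes>\<^sub>M lborel \<rightarrow>\<^sub>M hyperplane_space"
  unfolding hyperplane_space_def
proof (rule measurable_measure_of)
  have sp: "space Q = sphere 0 1"
    using sets_eq_imp_space_eq[OF Q] by (simp add: space_restrict_space)
  show "{hitting K |K. compact K} \<subseteq> Pow (hyperplanes :: 'a set set)"
    by (auto simp: hitting_def)
  show "(\<lambda>(u, s). hyperplane u s) \<in> space (Q \<Otimes>\<^sub>M lborel) \<rightarrow> (hyperplanes :: 'a set set)"
    by (force simp: space_pair_measure sp hyperplanes_def)
  fix Y :: "'a set set" assume "Y \<in> {hitting K |K. compact K}"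
  then obtain K where K: "compact K" "Y = hitting K" by auto
  define C where "C = (\<lambda>(u, y). (u, y \<bullet> u)) ` (sphere 0 1 \<times> K)"
  have "compact C"
    unfolding C_def
    by (intro compact_continuous_image compact_Times K compact_sphere)
       (auto intro!: continuous_intros simp: case_prod_beta)
  then have C: "C \<in> sets (borel \<Otimes>\<^sub>M borel)"
    unfolding borel_prod by (simp add: compact_imp_closed borel_closed)
  have id: "(\<lambda>x. x) \<in> Q \<rightarrow>\<^sub>M borel"
    using measurable_restrict_space1[OF measurable_ident, of borel "sphere 0 1"]
    by (simp add: measurable_cong_sets[OF Q refl] id_def)
  have "(\<lambda>(u, s). (u, s)) \<in> Q \<Otimes>\<^sub>M lborel \<rightarrow>\<^sub>M borel \<Otimes>\<^sub>M borel"
    using id by measurable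
  from measurable_sets[OF this C]
  have "C \<inter> space (Q \<Otimes>\<^sub>M lborel) \<in> sets (Q \<Otimes>\<^sub>M lborel)"
    by (simp add: vimage_def)
  also have "C \<inter> space (Q \<Otimes>\<^sub>M lborel) =
      (\<lambda>(u, s). hyperplane u s) -` Y \<inter> space (Q \<Otimes>\<^sub>M lborel)"
    unfolding K C_def hitting_def hyperplanes_def space_pair_measure sp
    by (force simp: hyperplane_def)
  finally show "(\<lambda>(u, s). hyperplane u s) -` Y \<inter> space (Q \<Otimes>\<^sub>M lborel) \<in> sets (Q \<Otimes>\<^sub>M lborel)" .
qed

lemma emeasure_hyperplane_intensity:
  assumes Q: "directional_distribution Q" and A: "A \<in> sets hyperplane_space"
  shows "emeasure (hyperplane_intensity \<gamma> Q) A =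
    ennreal \<gamma> * (\<integral>\<^sup>+u. \<integral>\<^sup>+s. indicator A (hyperplane u s) \<partial>lborel \<partial>Q)"
proof -
  let ?h = "\<lambda>(u, s). hyperplane u s"
  have h: "?h \<in> Q \<Otimes>\<^sub>M lborel \<rightarrow>\<^sub>M hyperplane_space"
    using Q by (intro measurable_hyperplane) (simp add: directional_distribution_def)
  have [measurable]: "(\<lambda>x. indicator A (?h x) :: ennreal) \<in> borel_measurable (Q \<Otimes>\<^sub>M lborel)"
    using h A by measurable
  have "emeasure (distr (Q \<Otimes>\<^sub>M lborel) hyperplane_space ?h) A =
      (\<integral>\<^sup>+x. indicator A (?h x) \<partial>(Q \<Otimes>\<^sub>M lborel))"
    using A by (subst nn_integral_distr[OF h, symmetric]) auto
  also have "\<dots> = (\<integral>\<^sup>+u. \<integral>\<^sup>+s. indicator A (hyperplane u s) \<partial>lborel \<partial>Q)"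
    by (subst lborel.nn_integral_fst[symmetric]) auto
  finally show ?thesis
    by (simp add: hyperplane_intensity_def)
qed

end

theory Submission
  imports Defs
begin

text \<open>
  Almost surely, a point computed measurably from some hyperplanes of \<open>\<eta>\<close> lies on no other
  hyperplane of \<open>\<eta>\<close>. Hence a hyperplane outside \<open>\<eta>\<close> cannot contain many points of \<open>\<Phi>\<close> in a robust
  sense: once \<open>d\<close> of them span it, all others lie on the at most \<open>d\<^sup>2\<close> hyperplanes of \<open>\<eta>\<close> through
  these. So a hyperplane containing \<open>k\<close> points of \<open>\<Phi>\<close> that cannot be covered by \<open>d\<^sup>2\<close> other
  hyperplanes is certified to belong to \<open>\<eta>\<close>, and this is visible from \<open>\<Phi>\<close> alone. Conversely, take
  a basis of \<open>\<real>\<^sup>d\<close> in the support of the directional distribution. If \<open>\<eta>\<close> contains sufficiently many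
  hyperplanes at distance about \<open>n\<close> with normals near each basis vector, they cut every hyperplane
  of \<open>\<eta>\<close> that is not too far away in grids of points of \<open>\<Phi>\<close>, and these grids certify it; the grid
  hyperplanes certify each other in the same way. The stopping set is the first annulus, of outer
  radius proportional to \<open>n\<close>, in which \<open>\<Phi>\<close> certifies sufficiently many such hyperplanes; that
  \<open>\<eta>\<close> has too few of them is an event of exponentially small probability.
\<close>

section \<open>The space of measures\<close>

text \<open>The obstacle is that \<eta> itself is never observed: stopping rule and reconstruction
  may use only points of \<Phi> in an annulus, and false certificates must be excluded for all
  hyperplanes at once. A false candidate is spanned by d points of \<Phi>, so it is a measurable
  function of at most d^2 hyperplanes of \<eta>. Exchanging it for one hyperplane through a further
  point expresses that point without this hyperplane, against general position. This is why general
  position is proved for arbitrary measurable functions of tuples. N hyperplanes in each of d - 1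
  directions give a grid of N^(d-1) points, of which another hyperplane holds at most (d-1) N^(d-2);
  so N > d^2 (d-1) defeats d^2 coverings. Grid points stay away from K because each lies on a
  hyperplane far from the origin, which uses d \<ge> 2. The annuli increase with n, so a closed set
  containing one contains all earlier ones, and the first success is decided inside that set.
  Measurability rests on hits of compact sets, the generators of the \<sigma>-field of hyperplanes,
  and on the passage from hits to counts.\<close>

lemma measurable_emeasure_measure_algebra:
  assumes "A \<in> sets N"
  shows "(\<lambda>\<mu>. emeasure \<mu> A) \<in> borel_measurable (measure_algebra N)"
  unfolding measure_algebra_def
  by (rule measurable_Sup1[of "vimage_algebra {\<mu>. sets \<mu> = sets N} (\<lambda>\<mu>. emeasure \<mu> A) borel"])
     (use assms in \<open>auto intro: measurable_vimage_algebra1\<close>)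

lemma measurable_measure_algebraI:
  assumes "\<And>\<omega>. \<omega> \<in> space M \<Longrightarrow> sets (\<xi> \<omega>) = sets N"
    and "\<And>A. A \<in> sets N \<Longrightarrow> (\<lambda>\<omega>. emeasure (\<xi> \<omega>) A) \<in> borel_measurable M"
  shows "\<xi> \<in> M \<rightarrow>\<^sub>M measure_algebra N"
  unfolding measure_algebra_def
  using assms sets.top[of N] by (intro measurable_SUP2 measurable_vimage_algebra2) auto

lemma measurable_measure_restriction:
  assumes "B \<in> sets N"
  shows "(\<lambda>\<mu>. measure_restriction \<mu> B) \<in> measure_algebra N \<rightarrow>\<^sub>M measure_algebra N"
proof (rule measurable_measure_algebraI)
  fix A assume A: "A \<in> sets N"
  have "(\<lambda>\<mu>. emeasure \<mu> (A \<inter> B)) \<in> borel_measurable (measure_algebra N)"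
    using A assms by (intro measurable_emeasure_measure_algebra) auto
  then show "(\<lambda>\<mu>. emeasure (measure_restriction \<mu> B) A) \<in> borel_measurable (measure_algebra N)"
    by (rule measurable_cong[THEN iffD1, rotated])
       (use A assms in \<open>simp add: space_measure_algebra emeasure_measure_restriction\<close>)
qed (simp add: measure_restriction_def space_measure_algebra)

text \<open>Lets the restriction to an annulus inside a closed set \<open>F\<close> be computed from
  the restriction to \<open>F\<close>, as the stopping property demands.\<close>

lemma measure_restriction_restriction:
  assumes "A \<in> sets \<mu>" "B \<in> sets \<mu>" "A \<subseteq> B"
  shows "measure_restriction (measure_restriction \<mu> B) A = measure_restriction \<mu> A"
proof (rule measure_eqI)
  fix X assume "X \<in> sets (measure_restriction (measure_restriction \<mu> B) A)"
  then have X: "X \<in> sets \<mu>"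
    by (simp add: measure_restriction_def)
  have [simp]: "sets (measure_restriction \<mu> B) = sets \<mu>"
    by (simp add: measure_restriction_def)
  have "X \<inter> A \<inter> B = X \<inter> A" using assms by auto
  then show "emeasure (measure_restriction (measure_restriction \<mu> B) A) X =
      emeasure (measure_restriction \<mu> A) X"
    using X assms by (simp add: emeasure_measure_restriction)
qed (simp add: measure_restriction_def)

section \<open>Random finite sets\<close>

text \<open>A finite point process, encoded by its sets and natural-number counts instead of
  measures. The domain \<open>M\<close> need not carry a probability: it is also instantiated with a
  space of measures.\<close>

definition random_finite_set :: "'w measure \<Rightarrow> 'b measure \<Rightarrow> ('w \<Rightarrow> 'b set) \<Rightarrow> bool" where
  "random_finite_set M N S \<longleftrightarrow>
     (\<forall>\<omega>\<in>space M. finite (S \<omega>) \<and> S \<omega> \<subseteq> space N) \<and>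
     (\<forall>A\<in>sets N. (\<lambda>\<omega>. card (S \<omega> \<inter> A)) \<in> M \<rightarrow>\<^sub>M count_space UNIV)"

lemma random_finite_set_hits:
  assumes "random_finite_set M N S" "A \<in> sets N"
  shows "{\<omega>\<in>space M. S \<omega> \<inter> A \<noteq> {}} \<in> sets M"
proof -
  have "(\<lambda>\<omega>. card (S \<omega> \<inter> A)) -` {1..} \<inter> space M \<in> sets M"
    using assms by (intro measurable_sets[where A="count_space UNIV"]) (auto simp: random_finite_set_def)
  also have "(\<lambda>\<omega>. card (S \<omega> \<inter> A)) -` {1..} \<inter> space M = {\<omega>\<in>space M. S \<omega> \<inter> A \<noteq> {}}"
    using assms(1) by (auto simp: random_finite_set_def Suc_le_eq card_gt_0_iff)
  finally show ?thesis .
qed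

text \<open>A countable family of sets separating the points of \<open>N\<close> yields ever finer finite
  partitions; the cell of \<open>x\<close> at level \<open>m\<close> is coded by a number below \<open>2 ^ m\<close>.\<close>

definition separating :: "'b measure \<Rightarrow> (nat \<Rightarrow> 'b set) \<Rightarrow> bool" where
  "separating N E \<longleftrightarrow> range E \<subseteq> sets N \<and>
     (\<forall>x\<in>space N. \<forall>y\<in>space N. x \<noteq> y \<longrightarrow> (\<exists>i. (x \<in> E i) \<noteq> (y \<in> E i)))"

primrec cell_index :: "(nat \<Rightarrow> 'b set) \<Rightarrow> nat \<Rightarrow> 'b \<Rightarrow> nat" where
  "cell_index E 0 x = 0"
| "cell_index E (Suc m) x = 2 * cell_index E m x + of_bool (x \<in> E m)"

lemma cell_index_less: "cell_index E m x < 2 ^ m"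
  by (induction m) (auto simp: of_bool_def)

lemma cell_index_eq_iff:
  "cell_index E m x = cell_index E m y \<longleftrightarrow> (\<forall>i<m. x \<in> E i \<longleftrightarrow> y \<in> E i)"
proof (induction m)
  case (Suc m)
  have "2 * a + of_bool P = 2 * b + of_bool Q \<longleftrightarrow> a = b \<and> P = Q" for a b :: nat and P Q
    by (cases P; cases Q; simp) presburger+
  then show ?case
    using Suc by (auto simp: less_Suc_eq)
qed simp

lemma measurable_cell_index:
  assumes "separating N E"
  shows "cell_index E m \<in> N \<rightarrow>\<^sub>M count_space UNIV"
proof (induction m)
  case (Suc m)
  have [measurable]: "E m \<in> sets N" and [measurable]: "cell_index E m \<in> N \<rightarrow>\<^sub>M count_space UNIV"
    using assms Suc by (auto simp: separating_def)
  show ?case unfolding cell_index.simps by measurable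
qed simp

text \<open>Finitely many pairs of points need only finitely many separating sets; every level
  beyond the largest of their indices tells all points of \<open>T\<close> apart.\<close>

lemma cell_index_inj_on:
  assumes "separating N E" "finite T" "T \<subseteq> space N"
  shows "\<exists>m0. \<forall>m\<ge>m0. inj_on (cell_index E m) T"
proof -
  have "\<forall>p\<in>T\<times>T. \<exists>i. fst p \<noteq> snd p \<longrightarrow> (fst p \<in> E i) \<noteq> (snd p \<in> E i)"
  proof
    fix p assume "p \<in> T\<times>T"
    then have "fst p \<in> space N" "snd p \<in> space N" using assms(3) by auto
    then show "\<exists>i. fst p \<noteq> snd p \<longrightarrow> (fst p \<in> E i) \<noteq> (snd p \<in> E i)"
      using assms(1) unfolding separating_def by blast
  qed
  from bchoice[OF this] obtain i where *: "\<forall>p\<in>T\<times>T. fst p \<noteq> snd p \<longrightarrow> (fst p \<in> E (i p)) \<noteq> (snd p \<in> E (i p))"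
    ..
  have i: "(x \<in> E (i (x,y))) \<noteq> (y \<in> E (i (x,y)))" if "x \<in> T" "y \<in> T" "x \<noteq> y" for x y
    using that bspec[OF *, of "(x, y)"] by simp
  have "inj_on (cell_index E m) T" if m: "m \<ge> Suc (Max (i ` (T\<times>T)))" for m
  proof (rule inj_onI, rule ccontr)
    fix x y assume xy: "x \<in> T" "y \<in> T" "cell_index E m x = cell_index E m y" "x \<noteq> y"
    have "i (x,y) \<le> Max (i ` (T\<times>T))"
      using assms(2) xy by (intro Max_ge) auto
    then show False
      using i[OF xy(1,2,4)] xy(3) m by (auto simp: cell_index_eq_iff)
  qed
  then show ?thesis by blast
qed

text \<open>A level set of the limit consists of the \<omega> at which the sequence takes that value
  from some index on, a countable union of countable intersections.\<close>

lemma measurable_eventually_const: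
  fixes f :: "nat \<Rightarrow> 'w \<Rightarrow> nat"
  assumes [measurable]: "\<And>m. f m \<in> M \<rightarrow>\<^sub>M count_space UNIV"
    and ev: "\<And>\<omega>. \<omega> \<in> space M \<Longrightarrow> eventually (\<lambda>m. f m \<omega> = g \<omega>) sequentially"
  shows "g \<in> M \<rightarrow>\<^sub>M count_space UNIV"
proof (subst measurable_count_space_eq_countable)
  have "g \<omega> = k \<longleftrightarrow> (\<exists>m0. \<forall>m\<ge>m0. f m \<omega> = k)" if "\<omega> \<in> space M" for \<omega> k
    using ev[OF that] unfolding eventually_sequentially by (metis nle_le)
  then have "g -` {k} \<inter> space M = {\<omega>\<in>space M. \<exists>m0. \<forall>m\<ge>m0. f m \<omega> = k}" for k
    by auto
  moreover have "{\<omega>\<in>space M. \<exists>m0. \<forall>m\<ge>m0. f m \<omega> = k} \<in> sets M" for k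
    by measurable
  ultimately show "g \<in> space M \<rightarrow> UNIV \<and> (\<forall>a\<in>UNIV. g -` {a} \<inter> space M \<in> sets M)"
    by auto
qed auto

text \<open>For a finite set, the number of occupied cells is the number of points once the
  partition is fine enough. Hitting events, which are easier to verify, therefore determine the
  counts.\<close>

lemma random_finite_set_from_hits:
  assumes E: "separating N E"
    and fin: "\<And>\<omega>. \<omega> \<in> space M \<Longrightarrow> finite (S \<omega>) \<and> S \<omega> \<subseteq> space N"
    and hits: "\<And>A. A \<in> sets N \<Longrightarrow> {\<omega>\<in>space M. S \<omega> \<inter> A \<noteq> {}} \<in> sets M"
  shows "random_finite_set M N S"
  unfolding random_finite_set_def
proof (intro conjI ballI)
  fix A assume A: "A \<in> sets N"
  define C where "C m j = A \<inter> (cell_index E m -` {j} \<inter> space N)" for m j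
  have C: "C m j \<in> sets N" for m j
    unfolding C_def using measurable_sets[OF measurable_cell_index[OF E], of "{j}" m] A by auto
  \<comment> \<open>The number of cells of level \<open>m\<close> in which \<open>S \<omega>\<close>
    meets \<open>A\<close>; only hitting events enter.\<close>
  define c where "c m \<omega> = (\<Sum>j<2^m. of_bool (S \<omega> \<inter> C m j \<noteq> {}) :: nat)" for m \<omega>
  have [measurable]: "Measurable.pred M (\<lambda>\<omega>. S \<omega> \<inter> C m j \<noteq> {})" for m j
    using hits[OF C] by (simp add: pred_def)
  have c[measurable]: "c m \<in> M \<rightarrow>\<^sub>M count_space UNIV" for m
    unfolding c_def by measurable
  have ceq: "c m \<omega> = card (cell_index E m ` (S \<omega> \<inter> A))" if "\<omega> \<in> space M" for m \<omega>
  proof -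
    have "cell_index E m ` (S \<omega> \<inter> A) = {j. j < 2^m \<and> S \<omega> \<inter> C m j \<noteq> {}}"
      using fin[OF that] cell_index_less[of E m] by (auto simp: C_def)
    moreover have "c m \<omega> = card {j. j < 2^m \<and> S \<omega> \<inter> C m j \<noteq> {}}"
      unfolding c_def by (subst sum_of_bool_eq) (auto simp: Int_def)
    ultimately show ?thesis by simp
  qed
  show "(\<lambda>\<omega>. card (S \<omega> \<inter> A)) \<in> M \<rightarrow>\<^sub>M count_space UNIV"
  proof (rule measurable_eventually_const[OF c])
    fix \<omega> assume w: "\<omega> \<in> space M"
    obtain m1 where m1: "\<forall>m\<ge>m1. inj_on (cell_index E m) (S \<omega>)"
      using cell_index_inj_on[OF E] fin[OF w] by metis
    then have "c m \<omega> = card (S \<omega> \<inter> A)" if "m \<ge> m1" for m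
      using that by (subst ceq[OF w], subst card_image) (auto intro: inj_on_subset)
    then show "eventually (\<lambda>m. c m \<omega> = card (S \<omega> \<inter> A)) sequentially"
      by (auto simp: eventually_sequentially)
  qed
qed (use fin in auto)

text \<open>On boxes the count is a product of counts. The sets with measurable count are closed
  under complements, because the total is finite, and under disjoint unions, so they contain
  everything that the boxes generate.\<close>

lemma random_finite_set_PiE:
  assumes S: "random_finite_set M N S" and I: "finite I"
  shows "random_finite_set M (Pi\<^sub>M I (\<lambda>_. N)) (\<lambda>\<omega>. I \<rightarrow>\<^sub>E S \<omega>)"
  unfolding random_finite_set_def
proof (intro conjI ballI)
  have fin: "finite (I \<rightarrow>\<^sub>E S \<omega>)" if "\<omega> \<in> space M" for \<omega>
    using S that I by (intro finite_PiE) (auto simp: random_finite_set_def)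
  then show "finite (I \<rightarrow>\<^sub>E S \<omega>)" if "\<omega> \<in> space M" for \<omega> using that .
  show sub: "(I \<rightarrow>\<^sub>E S \<omega>) \<subseteq> space (Pi\<^sub>M I (\<lambda>_. N))" if "\<omega> \<in> space M" for \<omega>
    using S that unfolding space_PiM by (intro PiE_mono) (auto simp: random_finite_set_def)
  let ?X = "\<lambda>A \<omega>. card ((I \<rightarrow>\<^sub>E S \<omega>) \<inter> A)"
  have box: "?X (\<Pi>\<^sub>E i\<in>I. B i) \<in> M \<rightarrow>\<^sub>M count_space UNIV" if "\<And>i. i \<in> I \<Longrightarrow> B i \<in> sets N" for B
  proof -
    have "?X (\<Pi>\<^sub>E i\<in>I. B i) = (\<lambda>\<omega>. \<Prod>i\<in>I. card (S \<omega> \<inter> B i))"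
      by (rule ext, subst PiE_Int, subst card_PiE[OF I]) simp
    moreover have "(\<lambda>\<omega>. \<Prod>i\<in>J. card (S \<omega> \<inter> B i)) \<in> M \<rightarrow>\<^sub>M count_space UNIV" if "J \<subseteq> I" for J
      using finite_subset[OF that I] that
    proof (induction J rule: finite_induct)
      case (insert j J)
      then have [measurable]: "(\<lambda>\<omega>. \<Prod>i\<in>J. card (S \<omega> \<inter> B i)) \<in> M \<rightarrow>\<^sub>M count_space UNIV"
        and [measurable]: "(\<lambda>\<omega>. card (S \<omega> \<inter> B j)) \<in> M \<rightarrow>\<^sub>M count_space UNIV"
        using S that by (auto simp: random_finite_set_def \<open>\<And>i. i \<in> I \<Longrightarrow> B i \<in> sets N\<close>)
      show ?case
        using insert(1,2) by simp
    qed simp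
    ultimately show ?thesis by simp
  qed
  fix A assume "A \<in> sets (Pi\<^sub>M I (\<lambda>_. N))"
  then have "A \<in> sigma_sets (\<Pi>\<^sub>E i\<in>I. space N) (prod_algebra I (\<lambda>_. N))"
    by (simp add: sets_PiM)
  then show "?X A \<in> M \<rightarrow>\<^sub>M count_space UNIV"
  proof (induction rule: sigma_sets_induct_disjoint[OF Int_stable_prod_algebra prod_algebra_sets_into_space, consumes 1, case_names basic empty compl union])
    case (basic A)
    then show ?case
      using box by (auto simp: prod_algebra_eq_finite[OF I])
  next
    case empty
    then show ?case by simp
  next
    case (compl A)
    note [measurable] = compl(2)
    have [measurable]: "?X (\<Pi>\<^sub>E i\<in>I. space N) \<in> M \<rightarrow>\<^sub>M count_space UNIV"
      by (rule box) simp
    have "?X ((\<Pi>\<^sub>E i\<in>I. space N) - A) \<omega> = ?X (\<Pi>\<^sub>E i\<in>I. space N) \<omega> - ?X A \<omega>" if "\<omega> \<in> space M" for \<omega>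
    proof -
      have "A \<subseteq> (\<Pi>\<^sub>E i\<in>I. space N)"
        using sigma_sets_into_sp[OF prod_algebra_sets_into_space compl(1)] by simp
      then show ?thesis
        using fin[OF that] by (subst card_Diff_subset[symmetric]) (auto intro!: arg_cong[where f=card])
    qed
    then show ?case
      by (subst measurable_cong) auto
  next
    case (union A)
    note [measurable] = union(3)
    have lim: "eventually (\<lambda>n. (\<Sum>i<n. ?X (A i) \<omega>) = ?X (\<Union>i. A i) \<omega>) sequentially" if w: "\<omega> \<in> space M" for \<omega>
    proof -
      \<comment> \<open>Disjoint sets hit by a finite set are finite in number, so the partial sums
        become constant.\<close>
      define J where "J = {i. (I \<rightarrow>\<^sub>E S \<omega>) \<inter> A i \<noteq> {}}"
      have "finite J"
      proof (rule ccontr)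
        assume inf: "infinite J"
        have "\<forall>i\<in>J. \<exists>x. x \<in> (I \<rightarrow>\<^sub>E S \<omega>) \<inter> A i"
          unfolding J_def by blast
        from bchoice[OF this] obtain g where g: "\<forall>i\<in>J. g i \<in> (I \<rightarrow>\<^sub>E S \<omega>) \<inter> A i" ..
        have "inj_on g J"
        proof (rule inj_onI, rule ccontr)
          fix i j assume ij: "i \<in> J" "j \<in> J" "g i = g j" "i \<noteq> j"
          then have "g i \<in> A i \<inter> A j" using g by auto
          then show False using union(1) ij(4) by (auto simp: disjoint_family_on_def)
        qed
        moreover have "g ` J \<subseteq> (I \<rightarrow>\<^sub>E S \<omega>)" using g by auto
        ultimately show False using inf fin[OF w] by (meson finite_imageD finite_subset)
      qed
      then obtain n0 where n0: "\<forall>i\<in>J. i < n0" unfolding finite_nat_set_iff_bounded ..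
      have "(\<Sum>i<n. ?X (A i) \<omega>) = ?X (\<Union>i. A i) \<omega>" if "n \<ge> n0" for n
      proof -
        have "i < n" if "x \<in> (I \<rightarrow>\<^sub>E S \<omega>)" "x \<in> A i" for x i
          using n0 that \<open>n \<ge> n0\<close> unfolding J_def by (auto dest: less_le_trans)
        then have "(I \<rightarrow>\<^sub>E S \<omega>) \<inter> (\<Union>i. A i) = (\<Union>i<n. (I \<rightarrow>\<^sub>E S \<omega>) \<inter> A i)"
          by auto
        moreover have "card (\<Union>i<n. (I \<rightarrow>\<^sub>E S \<omega>) \<inter> A i) = (\<Sum>i<n. ?X (A i) \<omega>)"
        proof (rule card_UN_disjoint)
          show "\<forall>i\<in>{..<n}. finite ((I \<rightarrow>\<^sub>E S \<omega>) \<inter> A i)" using fin[OF w] by simp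
          show "\<forall>i\<in>{..<n}. \<forall>j\<in>{..<n}. i \<noteq> j \<longrightarrow> (I \<rightarrow>\<^sub>E S \<omega>) \<inter> A i \<inter> ((I \<rightarrow>\<^sub>E S \<omega>) \<inter> A j) = {}"
            using union(1) unfolding disjoint_family_on_def by blast
        qed simp
        ultimately show ?thesis by simp
      qed
      then show ?thesis by (auto simp: eventually_sequentially)
    qed
    show ?case
      by (rule measurable_eventually_const[where f="\<lambda>n \<omega>. \<Sum>i<n. ?X (A i) \<omega>"])
         (use lim in \<open>auto\<close>)
  qed
qed

section \<open>Atoms of a finite measure\<close>

lemma sets_singleton_separating:
  assumes E: "separating N E" and x: "x \<in> space N"
  shows "{x} \<in> sets N"
proof -
  have "{y\<in>space N. \<forall>i. y \<in> E i \<longleftrightarrow> x \<in> E i} \<in> sets N"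
  proof -
    have [measurable]: "E i \<in> sets N" for i
      using E by (auto simp: separating_def)
    show ?thesis by measurable
  qed
  also have "{y\<in>space N. \<forall>i. y \<in> E i \<longleftrightarrow> x \<in> E i} = {x}"
    using E x unfolding separating_def by blast
  finally show ?thesis .
qed

text \<open>If every level has a cell of mass at least 1, Koenig's lemma yields a decreasing sequence
  of such cells, and they shrink to a single point.\<close>

lemma atom_iff_cells:
  assumes E: "separating N E" and A: "A \<in> sets N" and sets[measurable_cong]: "sets \<mu> = sets N"
    and fin: "emeasure \<mu> (space N) < \<infinity>"
  shows "(\<exists>x\<in>A. emeasure \<mu> {x} \<ge> 1) \<longleftrightarrow>
    (\<forall>m. \<exists>j<2^m. emeasure \<mu> (A \<inter> (cell_index E m -` {j} \<inter> space N)) \<ge> 1)"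
proof
  note [measurable] = A measurable_cell_index[OF E]
  have sp: "space \<mu> = space N" using sets by (rule sets_eq_imp_space_eq)
  have AN: "A \<subseteq> space N" using A by (rule sets.sets_into_space)
  {
    assume "\<exists>x\<in>A. emeasure \<mu> {x} \<ge> 1"
    then obtain x where x: "x \<in> A" "emeasure \<mu> {x} \<ge> 1" by blast
    have "emeasure \<mu> {x} \<le> emeasure \<mu> (A \<inter> (cell_index E m -` {cell_index E m x} \<inter> space N))" for m
      using x AN by (intro emeasure_mono) (auto simp: sets)
    then show "\<forall>m. \<exists>j<2^m. emeasure \<mu> (A \<inter> (cell_index E m -` {j} \<inter> space N)) \<ge> 1"
      using order_trans[OF x(2)] cell_index_less[of E _ x] by blast
  next
    assume cells: "\<forall>m. \<exists>j<2^m. emeasure \<mu> (A \<inter> (cell_index E m -` {j} \<inter> space N)) \<ge> 1"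
    define C where "C m j m' j' = {x\<in>A. cell_index E m x = j \<and> cell_index E m' x = j'}" for m j m' j'
    have C[measurable]: "C m j m' j' \<in> sets \<mu>" for m j m' j'
    proof -
      have "C m j m' j' = A \<inter> (cell_index E m -` {j} \<inter> space N) \<inter> (cell_index E m' -` {j'} \<inter> space N)"
        using AN by (auto simp: C_def)
      also have "\<dots> \<in> sets \<mu>"
        using measurable_sets[OF measurable_cell_index[OF E], of "{j}" m]
          measurable_sets[OF measurable_cell_index[OF E], of "{j'}" m'] A
        unfolding sets by auto
      finally show ?thesis .
    qed
    \<comment> \<open>The Koenig invariant: inside cell \<open>j\<close> of level \<open>m\<close>
      there are cells of mass at least 1 at every finer level. Large mass of the cell alone would
      not pass to one of its halves.\<close>
    define P where "P m j \<longleftrightarrow> (\<forall>m'\<ge>m. \<exists>j'. emeasure \<mu> (C m j m' j') \<ge> 1)" for m j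
    have "P 0 0"
      unfolding P_def
    proof safe
      fix m'
      obtain j' where "emeasure \<mu> (A \<inter> (cell_index E m' -` {j'} \<inter> space N)) \<ge> 1"
        using cells by blast
      also have "A \<inter> (cell_index E m' -` {j'} \<inter> space N) = C 0 0 m' j'"
        using AN by (auto simp: C_def)
      finally show "\<exists>j'. emeasure \<mu> (C 0 0 m' j') \<ge> 1" by blast
    qed
    moreover have "\<exists>j'. P (Suc m) j' \<and> (j' = 2 * j \<or> j' = 2 * j + 1)" if Pm: "P m j" for m j
    proof (rule ccontr)
      assume "\<not> ?thesis"
      then have "\<not> P (Suc m) (2 * j)" "\<not> P (Suc m) (2 * j + 1)" by auto
      then obtain m1 m2 where m12: "m1 \<ge> Suc m" "m2 \<ge> Suc m"
        "\<And>j'. emeasure \<mu> (C (Suc m) (2*j) m1 j') < 1"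
        "\<And>j'. emeasure \<mu> (C (Suc m) (2*j+1) m2 j') < 1"
        unfolding P_def by (auto simp: not_le)
      \<comment> \<open>If both halves failed, at levels \<open>m1\<close> and \<open>m2\<close>,
        then a cell of mass at least 1 at this common finer level would lie in one half, and the
        coarser cell around it would contradict the failure there.\<close>
      define m' where "m' = max m1 m2"
      have m': "m' \<ge> m1" "m' \<ge> m2" "m' \<ge> Suc m" using m12 by (auto simp: m'_def)
      then obtain j' where j': "emeasure \<mu> (C m j m' j') \<ge> 1"
        using Pm unfolding P_def by (meson Suc_leD)
      then have "C m j m' j' \<noteq> {}" by (intro notI) auto
      then obtain x where x: "x \<in> C m j m' j'" by blast
      have coarse: "cell_index E n y = cell_index E n x" if "y \<in> C m j m' j'" "n \<le> m'" for y n
      proof -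
        have "cell_index E m' y = cell_index E m' x" using that x by (simp add: C_def)
        then show ?thesis using that(2) by (simp add: cell_index_eq_iff)
      qed
      have sm: "cell_index E (Suc m) x = 2*j \<or> cell_index E (Suc m) x = 2*j+1"
        using x by (auto simp: C_def of_bool_def)
      have "emeasure \<mu> (C m j m' j') \<le> emeasure \<mu> (C (Suc m) (cell_index E (Suc m) x) n (cell_index E n x))"
        if "n \<le> m'" for n
      proof (rule emeasure_mono)
        show "C m j m' j' \<subseteq> C (Suc m) (cell_index E (Suc m) x) n (cell_index E n x)"
          using coarse[OF _ that] coarse[OF _ m'(3)] by (auto simp: C_def simp del: cell_index.simps)
      qed simp
      then have ge: "emeasure \<mu> (C (Suc m) (cell_index E (Suc m) x) n (cell_index E n x)) \<ge> 1"
        if "n \<le> m'" for n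
        using order_trans[OF j'] that by simp
      show False
        using sm
      proof
        assume "cell_index E (Suc m) x = 2 * j"
        then show False
          using ge[OF m'(1)] m12(3)[of "cell_index E m1 x"] by (metis leD)
      next
        assume "cell_index E (Suc m) x = 2 * j + 1"
        then show False
          using ge[OF m'(2)] m12(4)[of "cell_index E m2 x"] by (metis leD)
      qed
    qed
    ultimately have "\<exists>j. \<forall>m. P m (j m) \<and> (j (Suc m) = 2 * j m \<or> j (Suc m) = 2 * j m + 1)"
      by (intro dependent_nat_choice) blast+
    then obtain j where j: "\<And>m. P m (j m)" "\<And>m. j (Suc m) = 2 * j m \<or> j (Suc m) = 2 * j m + 1"
      by blast
    define G where "G m = C m (j m) m (j m)" for m
    have G1: "emeasure \<mu> (G m) \<ge> 1" for m
    proof -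
      obtain j' where j': "emeasure \<mu> (C m (j m) m j') \<ge> 1"
        using j(1) unfolding P_def by blast
      moreover have "C m (j m) m j' \<subseteq> G m" by (auto simp: G_def C_def)
      then have "emeasure \<mu> (C m (j m) m j') \<le> emeasure \<mu> (G m)"
        by (rule emeasure_mono) (simp add: G_def)
      ultimately show ?thesis by (rule order_trans)
    qed
    have "G (Suc m) \<subseteq> G m" for m
    proof
      fix x assume "x \<in> G (Suc m)"
      then have xA: "x \<in> A" and eq: "2 * cell_index E m x + of_bool (x \<in> E m) = j (Suc m)"
        by (auto simp: G_def C_def)
      have "(2 * c + of_bool p) div 2 = c" for c :: nat and p
        by (cases p) simp_all
      then have "cell_index E m x = j (Suc m) div 2"
        unfolding eq[symmetric] by simp
      also have "\<dots> = j m"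
        using j(2)[of m] by auto
      finally show "x \<in> G m" using xA by (simp add: G_def C_def)
    qed
    then have dec: "decseq G" by (rule decseq_SucI)
    have "emeasure \<mu> (G m) \<noteq> \<infinity>" for m
    proof -
      have "emeasure \<mu> (G m) \<le> emeasure \<mu> (space N)"
        using emeasure_space[of \<mu> "G m"] sp by simp
      then show ?thesis using fin by (auto simp: top_unique)
    qed
    then have "emeasure \<mu> (\<Inter>m. G m) = (INF m. emeasure \<mu> (G m))"
      by (intro INF_emeasure_decseq[symmetric] dec) (auto simp: G_def)
    then have ge: "emeasure \<mu> (\<Inter>m. G m) \<ge> 1"
      using G1 by (simp add: le_INF_iff)
    then have "(\<Inter>m. G m) \<noteq> {}" by (intro notI) auto
    then obtain x where x: "x \<in> (\<Inter>m. G m)" by blast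
    have "y = x" if "y \<in> (\<Inter>m. G m)" for y
    proof (rule ccontr)
      assume "y \<noteq> x"
      moreover have "cell_index E m y = cell_index E m x" for m
        using x that by (auto simp: G_def C_def)
      then have "y \<in> E i \<longleftrightarrow> x \<in> E i" for i
        by (metis cell_index_eq_iff lessI)
      moreover have "x \<in> space N" "y \<in> space N"
        using x that AN by (auto simp: G_def C_def)
      ultimately show False using E unfolding separating_def by blast
    qed
    then have "(\<Inter>m. G m) = {x}" using x by blast
    then show "\<exists>x\<in>A. emeasure \<mu> {x} \<ge> 1"
      using ge x by (intro bexI[of _ x]) (auto simp: G_def C_def)
  }
qed

text \<open>Recovers the points of \<Phi> from its restriction as a measure. The threshold 1,
  instead of mere positivity, keeps the set finite for every finite measure on a separated
  space.\<close>

definition atoms :: "'b measure \<Rightarrow> 'b set" where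
  "atoms \<mu> = {x\<in>space \<mu>. emeasure \<mu> {x} \<ge> 1}"

lemma finite_atoms:
  assumes E: "separating N E" and sets: "sets \<mu> = sets N" and fin: "emeasure \<mu> (space N) < \<infinity>"
  shows "finite (atoms \<mu>)"
proof (rule ccontr)
  have sp: "space \<mu> = space N" using sets by (rule sets_eq_imp_space_eq)
  assume inf: "infinite (atoms \<mu>)"
  obtain n :: nat where n: "emeasure \<mu> (space N) < of_nat n"
    using fin ennreal_Ex_less_of_nat by auto
  obtain F where F: "F \<subseteq> atoms \<mu>" "finite F" "card F = n"
    using infinite_arbitrarily_large[OF inf] by metis
  have "of_nat n = (\<Sum>x\<in>F. 1 :: ennreal)" using F by simp
  also have "\<dots> \<le> (\<Sum>x\<in>F. emeasure \<mu> {x})"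
    using F by (intro sum_mono) (auto simp: atoms_def)
  also have "\<dots> = emeasure \<mu> F"
    using F by (subst emeasure_eq_sum_singleton)
      (auto simp: atoms_def sp sets intro!: sets_singleton_separating[OF E])
  also have "\<dots> \<le> emeasure \<mu> (space N)"
    using emeasure_space[of \<mu> F] sp by simp
  finally show False using n by simp
qed

text \<open>The reconstruction is a function of a measure, not of \<omega>, so measurability is
  needed on the space of measures itself. \<open>atom_iff_cells\<close> turns the event of having an
  atom in \<open>A\<close> into countably many conditions on masses.\<close>

lemma random_finite_set_atoms:
  assumes E: "separating N E"
  shows "random_finite_set (restrict_space (measure_algebra N) {\<mu>. emeasure \<mu> (space N) < \<infinity>}) N atoms"
proof (rule random_finite_set_from_hits[OF E])
  let ?M = "restrict_space (measure_algebra N) {\<mu>. emeasure \<mu> (space N) < \<infinity>}"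
  have sp: "sets \<mu> = sets N" "emeasure \<mu> (space N) < \<infinity>" "space \<mu> = space N" if "\<mu> \<in> space ?M" for \<mu>
    using that sets_eq_imp_space_eq[of \<mu> N] by (auto simp: space_restrict_space space_measure_algebra)
  show "finite (atoms \<mu>) \<and> atoms \<mu> \<subseteq> space N" if "\<mu> \<in> space ?M" for \<mu>
    using finite_atoms[OF E sp(1,2)[OF that]] sp(3)[OF that] by (auto simp: atoms_def)
  fix A assume A: "A \<in> sets N"
  have [measurable]: "(\<lambda>\<mu>. emeasure \<mu> (A \<inter> (cell_index E m -` {j} \<inter> space N))) \<in> borel_measurable ?M" for m j
    using A measurable_sets[OF measurable_cell_index[OF E], of "{j}" m]
    by (intro measurable_restrict_space1 measurable_emeasure_measure_algebra) auto
  have "atoms \<mu> \<inter> A \<noteq> {} \<longleftrightarrow>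
      (\<forall>m. \<exists>j<2^m. emeasure \<mu> (A \<inter> (cell_index E m -` {j} \<inter> space N)) \<ge> 1)"
    if "\<mu> \<in> space ?M" for \<mu>
    unfolding atom_iff_cells[OF E A sp(1,2)[OF that], symmetric]
    using sets.sets_into_space[OF A] sp(3)[OF that] by (auto simp: atoms_def)
  then have "{\<mu>\<in>space ?M. atoms \<mu> \<inter> A \<noteq> {}} =
      {\<mu>\<in>space ?M. \<forall>m. \<exists>j<2^m. emeasure \<mu> (A \<inter> (cell_index E m -` {j} \<inter> space N)) \<ge> 1}"
    by blast
  also have "\<dots> \<in> sets ?M" by measurable
  finally show "{\<mu>\<in>space ?M. atoms \<mu> \<inter> A \<noteq> {}} \<in> sets ?M" .
qed

section \<open>Measurability in the space of hyperplanes\<close>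

lemma dense_sequence:
  "\<exists>q :: nat \<Rightarrow> 'a::euclidean_space. \<forall>x. \<forall>e>0. \<exists>k. dist x (q k) < e"
proof -
  obtain D :: "'a set" where D: "countable D" "\<And>X. open X \<Longrightarrow> X \<noteq> {} \<Longrightarrow> \<exists>d\<in>D. d \<in> X"
    using countable_dense_exists by metis
  then have r: "range (from_nat_into D) = D"
    using D(2)[of UNIV] by (intro range_from_nat_into) auto
  have "\<exists>k. dist x (from_nat_into D k) < e" if "e > 0" for x e
  proof -
    obtain d where "d \<in> D" "dist x d < e"
      using D(2)[of "ball x e"] \<open>e > 0\<close> by auto
    moreover from this have "d \<in> range (from_nat_into D)" using r by simp
    ultimately show ?thesis by auto
  qed
  then show ?thesis by blast
qed

lemma separating_countable:
  assumes "countable \<E>" "\<E> \<subseteq> sets N"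
    and "\<And>x y. x \<in> space N \<Longrightarrow> y \<in> space N \<Longrightarrow> x \<noteq> y \<Longrightarrow> \<exists>A\<in>\<E>. (x \<in> A) \<noteq> (y \<in> A)"
  shows "\<exists>E. separating N E"
proof -
  have "countable (insert {} \<E>)" "insert {} \<E> \<noteq> {}" using assms(1) by auto
  then have r: "range (from_nat_into (insert {} \<E>)) = insert {} \<E>"
    by (intro range_from_nat_into) auto
  have "\<exists>i. (x \<in> from_nat_into (insert {} \<E>) i) \<noteq> (y \<in> from_nat_into (insert {} \<E>) i)"
    if xy: "x \<in> space N" "y \<in> space N" "x \<noteq> y" for x y
  proof -
    obtain A where A: "A \<in> insert {} \<E>" "(x \<in> A) \<noteq> (y \<in> A)" using assms(3)[OF xy] by blast
    from A(1) have "A \<in> range (from_nat_into (insert {} \<E>))" unfolding r .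
    then show ?thesis using A(2) by auto
  qed
  then have "separating N (from_nat_into (insert {} \<E>))"
    unfolding separating_def r using assms(2) by simp
  then show ?thesis by blast
qed

lemma separating_borel: "\<exists>E. separating (borel :: 'a::euclidean_space measure) E"
proof -
  obtain D :: "nat \<Rightarrow> 'a" where D: "\<And>x e. e > 0 \<Longrightarrow> \<exists>k. dist x (D k) < e"
    using dense_sequence by blast
  show ?thesis
  proof (rule separating_countable)
    show "countable (range (\<lambda>(k, n::nat). ball (D k) (1 / Suc n)))"
      by auto
    fix x y :: 'a assume "x \<noteq> y"
    then obtain n where n: "1 / Suc n < dist x y / 2"
      using reals_Archimedean[of "dist x y / 2"] by (auto simp: inverse_eq_divide)
    obtain q where q: "q \<in> range D" "dist x q < 1 / Suc n" using D[of "1 / Suc n" x] by auto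
    have "dist x y \<le> dist x q + dist q y" by (rule dist_triangle)
    then have "y \<notin> ball q (1 / Suc n)" using q n by auto
    moreover have "x \<in> ball q (1 / Suc n)" using q by (simp add: dist_commute)
    ultimately show "\<exists>A\<in>range (\<lambda>(k, n::nat). ball (D k) (1 / Suc n)). (x \<in> A) \<noteq> (y \<in> A)"
      using q(1) by (intro bexI[of _ "ball q (1 / Suc n)"]) auto
  qed auto
qed

lemma closed_in_hyperplanes: "H \<in> hyperplanes \<Longrightarrow> closed H"
  by (auto simp: hyperplanes_def hyperplane_def inner_commute closed_hyperplane)

lemma hitting_sets: "compact K \<Longrightarrow> hitting K \<in> sets hyperplane_space"
  unfolding sets_hyperplane_space by (rule sigma_sets.Basic) auto

text \<open>A point of one hyperplane off another has positive distance from the latter, which is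
  closed; a small ball from a countable family near this point is hit by the first one only.\<close>

lemma separating_hyperplane_space:
  "\<exists>E. separating (hyperplane_space :: 'a::euclidean_space set measure) E"
proof -
  obtain D :: "nat \<Rightarrow> 'a" where D: "\<And>x e. e > 0 \<Longrightarrow> \<exists>k. dist x (D k) < e"
    using dense_sequence by blast
  let ?\<E> = "range (\<lambda>(k, n::nat). hitting (cball (D k) (1 / Suc n)))"
  have one: "\<exists>A\<in>?\<E>. (H \<in> A) \<noteq> (H' \<in> A)"
    if H: "H \<in> hyperplanes" "H' \<in> hyperplanes" and p: "p \<in> H" "p \<notin> H'" for H H' p
  proof -
    obtain e where e: "e > 0" "\<And>y. y \<in> H' \<Longrightarrow> dist y p \<ge> e"
      using closed_approachable[OF closed_in_hyperplanes[OF H(2)], of p] p(2) by (metis not_le)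
    obtain n where n: "1 / Suc n < e / 2"
      using reals_Archimedean[of "e / 2"] e(1) by (auto simp: inverse_eq_divide)
    obtain q where q: "q \<in> range D" "dist p q < 1 / Suc n" using D[of "1 / Suc n" p] by auto
    have "dist y q > 1 / Suc n" if "y \<in> H'" for y
      using e(2)[OF that] q(2) n dist_triangle[of y p q] by (simp add: dist_commute)
    then have "H' \<notin> hitting (cball q (1 / Suc n))"
      by (force simp: hitting_def dist_commute)
    moreover have "H \<in> hitting (cball q (1 / Suc n))"
      using H(1) p(1) q(2) by (auto simp: hitting_def dist_commute intro!: less_imp_le)
    ultimately show ?thesis
      using q(1) by (intro bexI[of _ "hitting (cball q (1 / Suc n))"]) auto
  qed
  show ?thesis
  proof (rule separating_countable)
    show "countable ?\<E>" by auto
    show "?\<E> \<subseteq> sets hyperplane_space" by (auto intro!: hitting_sets)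
    fix H H' :: "'a set" assume "H \<in> space hyperplane_space" "H' \<in> space hyperplane_space" "H \<noteq> H'"
    then show "\<exists>A\<in>?\<E>. (H \<in> A) \<noteq> (H' \<in> A)"
      using one[of H H'] one[of H' H] by (auto simp: space_hyperplane_space)
  qed
qed

lemma measurable_hits:
  assumes "compact K" "f \<in> M \<rightarrow>\<^sub>M hyperplane_space"
  shows "Measurable.pred M (\<lambda>x. f x \<in> hitting K)"
  using measurable_sets_Collect[OF assms(2), of "\<lambda>H. H \<in> hitting K"] hitting_sets[OF assms(1)]
    sets.sets_into_space[OF hitting_sets[OF assms(1)]]
  by (auto simp: pred_def Int_def[symmetric] Int_absorb1 inf.absorb2)

text \<open>The \<sigma>-field only knows which compact sets a single hyperplane hits. A common
  point in \<open>C\<close> exists iff, at every scale, some small ball from a countable family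
  meets \<open>C\<close> and all the hyperplanes: by compactness such balls accumulate at a point of
  \<open>C\<close>, and closedness puts it on every hyperplane.\<close>

lemma measurable_Inter_hits:
  fixes C :: "'a::euclidean_space set"
  assumes "finite I" "compact C" and f: "\<And>i. i \<in> I \<Longrightarrow> f i \<in> M \<rightarrow>\<^sub>M hyperplane_space"
  shows "Measurable.pred M (\<lambda>x. (\<Inter>i\<in>I. f i x) \<inter> C \<noteq> {})"
proof -
  obtain D :: "nat \<Rightarrow> 'a" where D: "\<And>x e. e > 0 \<Longrightarrow> \<exists>k. dist x (D k) < e"
    using dense_sequence by blast
  have "(\<Inter>i\<in>I. f i x) \<inter> C \<noteq> {} \<longleftrightarrow> (\<forall>n::nat. \<exists>q\<in>range D. cball q (1 / Suc n) \<inter> C \<noteq> {} \<and>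
      (\<forall>i\<in>I. f i x \<in> hitting (cball q (1 / Suc n))))" (is "?L \<longleftrightarrow> ?R") if x: "x \<in> space M" for x
  proof
    have hyp: "f i x \<in> hyperplanes" if "i \<in> I" for i
      using measurable_space[OF f[OF that] x] by (simp add: space_hyperplane_space)
    {
      assume ?L
      then obtain y where y: "y \<in> C" "\<And>i. i \<in> I \<Longrightarrow> y \<in> f i x" by blast
      show ?R
      proof
        fix n :: nat
        obtain q where q: "q \<in> range D" "dist y q < 1 / Suc n" using D[of "1 / Suc n" y] by auto
        then have "y \<in> cball q (1 / Suc n)" by (simp add: dist_commute)
        then show "\<exists>q\<in>range D. cball q (1 / Suc n) \<inter> C \<noteq> {} \<and> (\<forall>i\<in>I. f i x \<in> hitting (cball q (1 / Suc n)))"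
          using y q(1) hyp unfolding hitting_def by blast
      qed
    next
      assume ?R
      then obtain q where q: "\<And>n. cball (q n) (1 / Suc n) \<inter> C \<noteq> {}"
          "\<And>n i. i \<in> I \<Longrightarrow> f i x \<in> hitting (cball (q n) (1 / Suc n))"
        by metis
      have "\<forall>n. \<exists>y. y \<in> C \<and> dist (q n) y \<le> 1 / Suc n"
        using q(1) by (metis IntE ex_in_conv mem_cball)
      then obtain y where y: "\<And>n. y n \<in> C" "\<And>n. dist (q n) (y n) \<le> 1 / Suc n" by metis
      obtain l r where l: "l \<in> C" "strict_mono (r :: nat \<Rightarrow> nat)" "(y \<circ> r) \<longlonglongrightarrow> l"
        using assms(2) y(1) unfolding compact_def by metis
      have "l \<in> f i x" if i: "i \<in> I" for i
      proof -
        have "\<exists>p\<in>f i x. dist p l < e" if e: "e > 0" for e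
        proof -
          have ev1: "eventually (\<lambda>n. dist ((y \<circ> r) n) l < e / 2) sequentially"
            using tendstoD[OF l(3), of "e/2"] e by simp
          obtain m where m: "1 / Suc m < e / 4"
            using reals_Archimedean[of "e / 4"] e by (auto simp: inverse_eq_divide)
          have ev2: "eventually (\<lambda>n. n \<ge> m) sequentially" by (rule eventually_ge_at_top)
          obtain n where n: "dist (y (r n)) l < e / 2" "n \<ge> m"
            using eventually_happens[OF eventually_conj[OF ev1 ev2]] by auto
          have "1 / Suc (r n) \<le> 1 / Suc m"
            using n(2) seq_suble[OF l(2), of n] by (intro divide_left_mono) auto
          then have small: "1 / Suc (r n) < e / 4" using m by linarith
          obtain p where p: "p \<in> f i x" "dist (q (r n)) p \<le> 1 / Suc (r n)"
            using q(2)[OF i, of "r n"] by (auto simp: hitting_def)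
          have "dist p l \<le> dist p (q (r n)) + dist (q (r n)) (y (r n)) + dist (y (r n)) l"
            using dist_triangle[of p l "q (r n)"] dist_triangle[of "q (r n)" l "y (r n)"] by linarith
          also have "\<dots> < e"
            using p(2) y(2)[of "r n"] small n(1) unfolding dist_commute[of p] by linarith
          finally show ?thesis using p(1) by blast
        qed
        then show ?thesis
          using closed_approachable[OF closed_in_hyperplanes[OF hyp[OF i]]] by blast
      qed
      then show ?L using l(1) by blast
    }
  qed
  moreover have "Measurable.pred M (\<lambda>x. \<forall>n::nat. \<exists>q\<in>range D. cball q (1 / Suc n) \<inter> C \<noteq> {} \<and>
      (\<forall>i\<in>I. f i x \<in> hitting (cball q (1 / Suc n))))"
  proof -
    have [measurable]: "Measurable.pred M (\<lambda>x. \<forall>i\<in>I. f i x \<in> hitting (cball q (1 / Suc n)))" for q n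
      using assms(1) f by (intro pred_intros_finite measurable_hits) auto
    show ?thesis
      unfolding bex_simps by measurable
  qed
  ultimately show ?thesis by (subst measurable_cong) auto
qed

section \<open>Points determined by hyperplanes\<close>

definition meets_in_point :: "'i set \<Rightarrow> ('i \<Rightarrow> 'a::euclidean_space set) \<Rightarrow> bool" where
  "meets_in_point I h \<longleftrightarrow> (\<exists>x. (\<Inter>i\<in>I. h i) = {x})"

text \<open>The default value 0, like that of \<open>spanned_hyperplane\<close> below, is harmless: general position will be
  shown for all measurable functions of hyperplanes, degenerate or not.\<close>

definition meeting_point :: "'i set \<Rightarrow> ('i \<Rightarrow> 'a::euclidean_space set) \<Rightarrow> 'a" where
  "meeting_point I h = (if meets_in_point I h then THE x. (\<Inter>i\<in>I. h i) = {x} else 0)"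

lemma meeting_point_eq: "(\<Inter>i\<in>I. h i) = {x} \<Longrightarrow> meets_in_point I h \<and> meeting_point I h = x"
  by (auto simp: meeting_point_def meets_in_point_def)

lemma meets_in_pointD: "meets_in_point I h \<Longrightarrow> (\<Inter>i\<in>I. h i) = {meeting_point I h}"
  using meeting_point_eq[of h I] unfolding meets_in_point_def by blast

lemma meeting_point_cong: "(\<And>i. i \<in> I \<Longrightarrow> h i = h' i) \<Longrightarrow> meeting_point I h = meeting_point I h'"
  by (simp add: meeting_point_def meets_in_point_def)

text \<open>A nonempty set is a singleton unless it hits two disjoint balls of a countable family.
  Both conditions concern hits of compact sets by an intersection.\<close>

lemma measurable_meets_in_point:
  fixes f :: "'i \<Rightarrow> 'x \<Rightarrow> 'a::euclidean_space set"
  assumes I: "finite I" and f: "\<And>i. i \<in> I \<Longrightarrow> f i \<in> M \<rightarrow>\<^sub>M hyperplane_space"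
  shows "Measurable.pred M (\<lambda>x. meets_in_point I (\<lambda>i. f i x))"
proof -
  obtain D :: "nat \<Rightarrow> 'a" where D: "\<And>x e. e > 0 \<Longrightarrow> \<exists>k. dist x (D k) < e"
    using dense_sequence by blast
  have two: "(\<exists>p\<in>range D. \<exists>q\<in>range D. \<exists>n::nat. cball p (1 / Suc n) \<inter> cball q (1 / Suc n) = {} \<and>
        T \<inter> cball p (1 / Suc n) \<noteq> {} \<and> T \<inter> cball q (1 / Suc n) \<noteq> {}) \<longleftrightarrow>
      (\<exists>a\<in>T. \<exists>b\<in>T. a \<noteq> b)" (is "?L \<longleftrightarrow> ?R") for T :: "'a set"
  proof
    assume ?R
    then obtain a b where ab: "a \<in> T" "b \<in> T" "a \<noteq> b" by blast
    obtain n where n: "1 / Suc n < dist a b / 4"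
      using reals_Archimedean[of "dist a b / 4"] ab(3) by (auto simp: inverse_eq_divide)
    obtain p where p: "p \<in> range D" "dist a p < 1 / Suc n" using D[of "1 / Suc n" a] by auto
    obtain q where q: "q \<in> range D" "dist b q < 1 / Suc n" using D[of "1 / Suc n" b] by auto
    have "dist a b \<le> dist a p + dist p y + dist y q + dist q b" for y
      by (meson add_mono dist_triangle order_refl order_trans)
    note tri = this
    have "cball p (1 / Suc n) \<inter> cball q (1 / Suc n) = {}"
    proof (rule ccontr)
      assume "cball p (1 / Suc n) \<inter> cball q (1 / Suc n) \<noteq> {}"
      then obtain y where "dist p y \<le> 1 / Suc n" "dist y q \<le> 1 / Suc n"
        by (auto simp: dist_commute)
      then show False using tri[of y] p(2) q(2) n by (simp add: dist_commute)
    qed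
    moreover have "a \<in> cball p (1 / Suc n)" "b \<in> cball q (1 / Suc n)"
      using p q by (auto simp: dist_commute)
    ultimately have "cball p (1 / Suc n) \<inter> cball q (1 / Suc n) = {} \<and>
        T \<inter> cball p (1 / Suc n) \<noteq> {} \<and> T \<inter> cball q (1 / Suc n) \<noteq> {}"
      using ab by auto
    then show ?L by (intro bexI[OF _ p(1)] bexI[OF _ q(1)] exI[of _ n])
  next
    assume ?L
    then obtain p q n where pq: "cball p (1 / Suc n) \<inter> cball q (1 / Suc n) = {}"
      "T \<inter> cball p (1 / Suc n) \<noteq> {}" "T \<inter> cball q (1 / Suc n) \<noteq> {}" by blast
    then obtain a b where "a \<in> T" "a \<in> cball p (1 / Suc n)" "b \<in> T" "b \<in> cball q (1 / Suc n)"
      by blast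
    then show ?R using pq(1) by (metis disjoint_iff)
  qed
  have T0: "T \<noteq> {} \<longleftrightarrow> (\<exists>n::nat. T \<inter> cball 0 (real n) \<noteq> {})" for T :: "'a set"
  proof
    assume "T \<noteq> {}"
    then obtain a where "a \<in> T" by blast
    moreover obtain n where "norm a \<le> real n" using real_arch_simple by blast
    ultimately show "\<exists>n::nat. T \<inter> cball 0 (real n) \<noteq> {}" by (intro exI[of _ n]) auto
  qed blast
  have sing: "(\<exists>x. T = {x}) \<longleftrightarrow> (\<exists>n::nat. T \<inter> cball 0 (real n) \<noteq> {}) \<and>
    \<not> (\<exists>p\<in>range D. \<exists>q\<in>range D. \<exists>n::nat. cball p (1 / Suc n) \<inter> cball q (1 / Suc n) = {} \<and>
        T \<inter> cball p (1 / Suc n) \<noteq> {} \<and> T \<inter> cball q (1 / Suc n) \<noteq> {})" for T :: "'a set"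
    unfolding two T0[symmetric] by blast
  show ?thesis
  proof -
    have [measurable]: "Measurable.pred M (\<lambda>x. (\<Inter>i\<in>I. f i x) \<inter> cball p r \<noteq> {})" for p r
      by (rule measurable_Inter_hits[OF I _ f]) auto
    show ?thesis
      unfolding meets_in_point_def sing bex_simps by measurable
  qed
qed

text \<open>When the hyperplanes meet in one point, it lies in a closed set iff their intersection
  hits one of the compact pieces of that set.\<close>

lemma measurable_meeting_point:
  fixes f :: "'i \<Rightarrow> 'x \<Rightarrow> 'a::euclidean_space set"
  assumes I: "finite I" and f: "\<And>i. i \<in> I \<Longrightarrow> f i \<in> M \<rightarrow>\<^sub>M hyperplane_space"
  shows "(\<lambda>x. meeting_point I (\<lambda>i. f i x)) \<in> borel_measurable M"
proof -
  note [measurable] = measurable_meets_in_point[OF I f]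
  have "(\<lambda>x. meeting_point I (\<lambda>i. f i x)) \<in> M \<rightarrow>\<^sub>M sigma UNIV (Collect closed)"
  proof (rule measurable_measure_of)
    fix C :: "'a set" assume "C \<in> Collect closed"
    then have C: "compact (C \<inter> cball 0 (real n))" for n by (auto intro: closed_Int_compact)
    have [measurable]: "Measurable.pred M (\<lambda>x. (\<Inter>i\<in>I. f i x) \<inter> (C \<inter> cball 0 (real n)) \<noteq> {})" for n
      by (rule measurable_Inter_hits[OF I C f])
    have "meeting_point I (\<lambda>i. f i x) \<in> C \<longleftrightarrow> (if meets_in_point I (\<lambda>i. f i x)
        then \<exists>n::nat. (\<Inter>i\<in>I. f i x) \<inter> (C \<inter> cball 0 (real n)) \<noteq> {} else 0 \<in> C)" for x
    proof (cases "meets_in_point I (\<lambda>i. f i x)")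
      case True
      obtain n where "norm (meeting_point I (\<lambda>i. f i x)) \<le> real n" using real_arch_simple by blast
      then show ?thesis using True unfolding meets_in_pointD[OF True] by auto
    qed (simp add: meeting_point_def)
    moreover have "{x\<in>space M. if meets_in_point I (\<lambda>i. f i x)
        then \<exists>n::nat. (\<Inter>i\<in>I. f i x) \<inter> (C \<inter> cball 0 (real n)) \<noteq> {} else 0 \<in> C} \<in> sets M"
      by measurable
    ultimately show "(\<lambda>x. meeting_point I (\<lambda>i. f i x)) -` C \<inter> space M \<in> sets M"
      by (simp add: vimage_def Int_def conj_commute)
  qed auto
  then show ?thesis by (simp add: borel_eq_closed)
qed


section \<open>Hyperplanes determined by points\<close>

text \<open>An uncountable search for parameters is replaced by approximate incidence along a
  countable dense subset of \<open>T\<close>; compactness turns ever better approximations into an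
  exact solution.\<close>

lemma measurable_incident_compact:
  fixes T :: "('a::euclidean_space \<times> real) set"
  assumes T: "compact T" and J: "finite J"
    and x: "\<And>j. j \<in> J \<Longrightarrow> x j \<in> borel_measurable M"
  shows "Measurable.pred M (\<lambda>\<omega>. \<exists>(u, s)\<in>T. \<forall>j\<in>J. x j \<omega> \<in> hyperplane u s)"
proof -
  obtain T0 where T0: "countable T0" "T0 \<subseteq> T" "T \<subseteq> closure T0"
    using separable by blast
  show ?thesis
  proof (cases "T0 = {}")
    case True
    then have "T = {}" using T0 by auto
    then show ?thesis by simp
  next
    case False
    define f where "f = from_nat_into T0"
    have f: "range f = T0" unfolding f_def using T0 False by (intro range_from_nat_into) auto
    have "(\<exists>(u, s)\<in>T. \<forall>j\<in>J. x j \<omega> \<in> hyperplane u s) \<longleftrightarrow>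
        (\<forall>n::nat. \<exists>k::nat. \<forall>j\<in>J. \<bar>x j \<omega> \<bullet> fst (f k) - snd (f k)\<bar> < 1 / Suc n)" (is "?L \<longleftrightarrow> ?R") for \<omega>
    proof
      assume ?L
      then obtain p where p: "p \<in> T" "\<And>j. j \<in> J \<Longrightarrow> x j \<omega> \<bullet> fst p - snd p = 0"
        by (auto simp: hyperplane_def)
      show ?R
      proof
        fix n :: nat
        define U where "U = (\<Inter>j\<in>J. {p. \<bar>x j \<omega> \<bullet> fst p - snd p\<bar> < 1 / Suc n})"
        have "open U" unfolding U_def
          by (intro open_INT J ballI open_Collect_less continuous_intros)
        moreover have "p \<in> U" using p(2) by (simp add: U_def)
        moreover have "p \<in> closure T0" using p(1) T0(3) by auto
        ultimately have "T0 \<inter> U \<noteq> {}"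
          by (metis disjoint_iff open_Int_closure_eq_empty inf_commute)
        then obtain k where "f k \<in> U" using f by blast
        then show "\<exists>k. \<forall>j\<in>J. \<bar>x j \<omega> \<bullet> fst (f k) - snd (f k)\<bar> < 1 / Suc n"
          by (auto simp: U_def)
      qed
    next
      assume ?R
      then obtain k where k: "\<And>n j. j \<in> J \<Longrightarrow> \<bar>x j \<omega> \<bullet> fst (f (k n)) - snd (f (k n))\<bar> < 1 / Suc n"
        by metis
      define g where "g = (\<lambda>n. f (k n))"
      have "g n \<in> T" for n using f T0 by (auto simp: g_def)
      then obtain l r where l: "l \<in> T" "strict_mono (r :: nat \<Rightarrow> nat)" "(g \<circ> r) \<longlonglongrightarrow> l"
        using T unfolding compact_def by metis
      have "x j \<omega> \<bullet> fst l - snd l = 0" if j: "j \<in> J" for j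
      proof -
        have "(\<lambda>n. \<bar>x j \<omega> \<bullet> fst ((g \<circ> r) n) - snd ((g \<circ> r) n)\<bar>)
            \<longlonglongrightarrow> \<bar>x j \<omega> \<bullet> fst l - snd l\<bar>"
          by (intro tendsto_intros l(3))
        moreover have "(\<lambda>n. 1 / Suc n) \<longlonglongrightarrow> (0::real)"
          by (rule lim_inverse_n'[THEN LIMSEQ_Suc])
        moreover have "\<bar>x j \<omega> \<bullet> fst ((g \<circ> r) n) - snd ((g \<circ> r) n)\<bar> \<le> 1 / Suc n" for n
        proof -
          have "1 / real (Suc (r n)) \<le> 1 / Suc n"
            using seq_suble[OF l(2), of n] by (intro divide_left_mono) auto
          then show ?thesis using k[OF j, of "r n"] by (simp add: g_def)
        qed
        ultimately have "\<bar>x j \<omega> \<bullet> fst l - snd l\<bar> \<le> 0"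
          by (intro LIMSEQ_le) auto
        then show ?thesis by simp
      qed
      then show ?L using l(1) by (auto simp: hyperplane_def intro!: bexI[of _ l])
    qed
    moreover have "Measurable.pred M (\<lambda>\<omega>. \<forall>n::nat. \<exists>k::nat. \<forall>j\<in>J. \<bar>x j \<omega> \<bullet> fst (f k) - snd (f k)\<bar> < 1 / Suc n)"
    proof -
      have [measurable]: "Measurable.pred M (\<lambda>\<omega>. \<bar>x j \<omega> \<bullet> u - s\<bar> < c)" if "j \<in> J" for j u s c
        using x[OF that] by measurable
      have [measurable]: "Measurable.pred M (\<lambda>\<omega>. \<forall>j\<in>J. \<bar>x j \<omega> \<bullet> u - s\<bar> < c)" for u s c
        by (intro pred_intros_finite J) measurable
      show ?thesis by measurable
    qed
    ultimately show ?thesis by simp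
  qed
qed

definition incident :: "'j set \<Rightarrow> ('j \<Rightarrow> 'a::euclidean_space) \<Rightarrow> 'a set \<Rightarrow> bool" where
  "incident J x H \<longleftrightarrow> H \<in> hyperplanes \<and> (\<forall>j\<in>J. x j \<in> H)"

text \<open>The points affinely span a hyperplane. Phrased as unique incidence, this reduces
  measurability to the existence of incident hyperplanes.\<close>

definition spans_hyperplane :: "'j set \<Rightarrow> ('j \<Rightarrow> 'a::euclidean_space) \<Rightarrow> bool" where
  "spans_hyperplane J x \<longleftrightarrow> (\<exists>!H. incident J x H)"

definition spanned_hyperplane :: "'j set \<Rightarrow> ('j \<Rightarrow> 'a::euclidean_space) \<Rightarrow> 'a set" where
  "spanned_hyperplane J x =
     (if spans_hyperplane J x then THE H. incident J x H else hyperplane (SOME u. u \<in> sphere 0 1) 0)"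

lemma spanned_hyperplane_incident: "spans_hyperplane J x \<Longrightarrow> incident J x (spanned_hyperplane J x)"
  unfolding spans_hyperplane_def spanned_hyperplane_def by (simp add: theI')

lemma spanned_hyperplane_eq: "spans_hyperplane J x \<Longrightarrow> incident J x H \<Longrightarrow> spanned_hyperplane J x = H"
  using spanned_hyperplane_incident unfolding spans_hyperplane_def by blast

lemma spanned_hyperplane_in: "spanned_hyperplane J (x :: 'j \<Rightarrow> 'a::euclidean_space) \<in> hyperplanes"
proof (cases "spans_hyperplane J x")
  case True
  then show ?thesis using spanned_hyperplane_incident by (auto simp: incident_def)
next
  case False
  have "\<exists>u::'a. u \<in> sphere 0 1"
    using norm_Basis SOME_Basis by (intro exI[of _ "SOME i. i \<in> Basis"]) simp
  then have "(SOME u::'a. u \<in> sphere 0 1) \<in> sphere 0 1" by (rule someI_ex)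
  then show ?thesis using False unfolding spanned_hyperplane_def hyperplanes_def by auto
qed

lemma measurable_incident_hitting:
  fixes K :: "'a::euclidean_space set"
  assumes "compact K" and J: "finite J" "\<And>j. j \<in> J \<Longrightarrow> x j \<in> borel_measurable M"
  shows "Measurable.pred M (\<lambda>\<omega>. \<exists>H\<in>hitting K. incident J (\<lambda>j. x j \<omega>) H)"
proof -
  \<comment> \<open>The parameters of the hyperplanes hitting \<open>K\<close>: a compact set, as a
    continuous image of sphere times \<open>K\<close>.\<close>
  define T where "T = (\<lambda>(u, y). (u, y \<bullet> u)) ` (sphere 0 1 \<times> K)"
  have "compact T"
    unfolding T_def
    by (intro compact_continuous_image compact_Times assms compact_sphere)
       (auto intro!: continuous_intros simp: case_prod_beta)
  from measurable_incident_compact[OF this J]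
  have "Measurable.pred M (\<lambda>\<omega>. \<exists>(u, s)\<in>T. \<forall>j\<in>J. x j \<omega> \<in> hyperplane u s)" .
  also have "(\<lambda>\<omega>. \<exists>(u, s)\<in>T. \<forall>j\<in>J. x j \<omega> \<in> hyperplane u s) =
      (\<lambda>\<omega>. \<exists>H\<in>hitting K. incident J (\<lambda>j. x j \<omega>) H)" (is "?l = ?r")
  proof (intro ext iffI)
    fix \<omega> assume "?l \<omega>"
    then obtain u y where "u \<in> sphere 0 1" "y \<in> K" "\<forall>j\<in>J. x j \<omega> \<in> hyperplane u (y \<bullet> u)"
      by (auto simp: T_def)
    then show "?r \<omega>"
      by (intro bexI[of _ "hyperplane u (y \<bullet> u)"])
        (auto simp: incident_def hitting_def hyperplanes_def hyperplane_def)
  next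
    fix \<omega> assume "?r \<omega>"
    then obtain u s y where "u \<in> sphere 0 1" "y \<in> K" "y \<in> hyperplane u s" "\<forall>j\<in>J. x j \<omega> \<in> hyperplane u s"
      by (auto simp: incident_def hitting_def hyperplanes_def)
    then show "?l \<omega>"
      by (intro bexI[of _ "(u, s)"]) (auto simp: T_def hyperplane_def image_iff)
  qed
  finally show ?thesis .
qed

text \<open>Two different hyperplanes are told apart by a ball that one of them comes much closer to;
  this turns uniqueness into countably many conditions on compact sets of parameters.\<close>

lemma measurable_spans_hyperplane:
  fixes x :: "'j \<Rightarrow> 'w \<Rightarrow> 'a::euclidean_space"
  assumes J: "finite J" "\<And>j. j \<in> J \<Longrightarrow> x j \<in> borel_measurable M"
  shows "Measurable.pred M (\<lambda>\<omega>. spans_hyperplane J (\<lambda>j. x j \<omega>))"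
proof -
  obtain D :: "nat \<Rightarrow> 'a" where D: "\<And>x e. e > 0 \<Longrightarrow> \<exists>k. dist x (D k) < e"
    using dense_sequence by blast
  define T1 where "T1 k n R = {(u::'a, s::real). norm u = 1 \<and> \<bar>s\<bar> \<le> real R \<and> \<bar>D k \<bullet> u - s\<bar> \<le> 1 / Suc n}" for k n R :: nat
  define T2 where "T2 k n R = {(u::'a, s::real). norm u = 1 \<and> \<bar>s\<bar> \<le> real R \<and> 2 / Suc n \<le> \<bar>D k \<bullet> u - s\<bar>}" for k n R :: nat
  have "compact ((sphere 0 1 \<times> cball 0 (real R)) \<inter> {p. \<bar>D k \<bullet> fst p - snd p\<bar> \<le> 1 / Suc n})" for k n R
    by (intro compact_Int_closed compact_Times compact_sphere compact_cball closed_Collect_le continuous_intros)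
  also have "(sphere 0 1 \<times> cball 0 (real R)) \<inter> {p. \<bar>D k \<bullet> fst p - snd p\<bar> \<le> 1 / Suc n} = T1 k n R" for k n R
    by (auto simp: T1_def)
  finally have T1: "compact (T1 k n R)" for k n R .
  have "compact ((sphere 0 1 \<times> cball 0 (real R)) \<inter> {p. 2 / Suc n \<le> \<bar>D k \<bullet> fst p - snd p\<bar>})" for k n R
    by (intro compact_Int_closed compact_Times compact_sphere compact_cball closed_Collect_le continuous_intros)
  also have "(sphere 0 1 \<times> cball 0 (real R)) \<inter> {p. 2 / Suc n \<le> \<bar>D k \<bullet> fst p - snd p\<bar>} = T2 k n R" for k n R
    by (auto simp: T2_def)
  finally have T2: "compact (T2 k n R)" for k n R .
  define I where "I T \<omega> \<longleftrightarrow> (\<exists>(u, s)\<in>T. \<forall>j\<in>J. x j \<omega> \<in> hyperplane u s)" for T \<omega>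
  have ne: "(\<exists>H H'. incident J (\<lambda>j. x j \<omega>) H \<and> incident J (\<lambda>j. x j \<omega>) H' \<and> H \<noteq> H') \<longleftrightarrow>
      (\<exists>k n R. I (T1 k n R) \<omega> \<and> I (T2 k n R) \<omega>)" (is "?L \<longleftrightarrow> ?R") for \<omega>
  proof
    have *: ?R if H: "incident J (\<lambda>j. x j \<omega>) H" "incident J (\<lambda>j. x j \<omega>) H'" and p: "p \<in> H" "p \<notin> H'" for H H' p
    proof -
      obtain u s u' s' where us: "norm u = 1" "norm u' = 1" "H = hyperplane u s" "H' = hyperplane u' s'"
        using H by (auto simp: incident_def hyperplanes_def)
      have "\<bar>p \<bullet> u' - s'\<bar> > 0" using p(2) us by (auto simp: hyperplane_def)
      then obtain n :: nat where n: "1 / Suc n < \<bar>p \<bullet> u' - s'\<bar> / 3"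
        using reals_Archimedean[of "\<bar>p \<bullet> u' - s'\<bar> / 3"] by (auto simp: inverse_eq_divide)
      obtain k where k: "dist p (D k) < 1 / Suc n" using D[of "1 / Suc n" p] by auto
      obtain R :: nat where R: "max \<bar>s\<bar> \<bar>s'\<bar> \<le> real R" using real_arch_simple by blast
      have near: "\<bar>D k \<bullet> v - p \<bullet> v\<bar> < 1 / Suc n" if "norm v = 1" for v
      proof -
        have "\<bar>(D k - p) \<bullet> v\<bar> \<le> norm (D k - p) * norm v" by (rule Cauchy_Schwarz_ineq2)
        then show ?thesis using k that by (simp add: inner_diff_left dist_norm norm_minus_commute)
      qed
      have "(u, s) \<in> T1 k n R"
        using us(1,3) p(1) near[OF us(1)] R by (auto simp: T1_def hyperplane_def)
      moreover have "(u', s') \<in> T2 k n R"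
        using us(2) near[OF us(2)] n R by (auto simp: T2_def)
      ultimately show ?thesis
        using H us unfolding I_def incident_def by blast
    qed
    assume ?L
    then obtain H H' where H: "incident J (\<lambda>j. x j \<omega>) H" "incident J (\<lambda>j. x j \<omega>) H'" "H \<noteq> H'" by blast
    then obtain p where "p \<in> H \<and> p \<notin> H' \<or> p \<in> H' \<and> p \<notin> H" by blast
    then show ?R using *[OF H(1,2)] *[OF H(2,1)] by blast
  next
    assume ?R
    then obtain k n R u s u' s' where us: "(u, s) \<in> T1 k n R" "(u', s') \<in> T2 k n R"
      "\<forall>j\<in>J. x j \<omega> \<in> hyperplane u s" "\<forall>j\<in>J. x j \<omega> \<in> hyperplane u' s'"
      unfolding I_def by blast
    have "hyperplane u s \<noteq> hyperplane u' s'"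
    proof
      assume eq: "hyperplane u s = hyperplane u' s'"
      \<comment> \<open>The foot of the perpendicular from \<open>D k\<close>. It is at most
        \<open>1 / Suc n\<close> away from \<open>D k\<close>, whereas the other description of the
        same hyperplane asks for distance at least \<open>2 / Suc n\<close>.\<close>
      define y where "y = D k + (s - D k \<bullet> u) *\<^sub>R u"
      have nu: "norm u = 1" "norm u' = 1" using us by (auto simp: T1_def T2_def)
      then have "y \<in> hyperplane u s"
        by (simp add: y_def hyperplane_def inner_add_left dot_square_norm)
      then have "y \<in> hyperplane u' s'" using eq by simp
      then have y: "y \<bullet> u' = s'" by (simp add: hyperplane_def)
      have "\<bar>(D k - y) \<bullet> u'\<bar> \<le> norm (D k - y) * norm u'" by (rule Cauchy_Schwarz_ineq2)
      also have "\<dots> = \<bar>D k \<bullet> u - s\<bar>" using nu by (simp add: y_def abs_minus_commute)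
      also have "\<dots> \<le> 1 / Suc n" using us(1) by (simp add: T1_def)
      finally have "\<bar>D k \<bullet> u' - s'\<bar> \<le> 1 / Suc n" by (simp add: inner_diff_left y)
      moreover have "2 / Suc n \<le> \<bar>D k \<bullet> u' - s'\<bar>" using us(2) by (simp add: T2_def)
      moreover have "1 / real (Suc n) < 2 / Suc n" by (simp add: divide_strict_right_mono)
      ultimately show False by linarith
    qed
    moreover have "incident J (\<lambda>j. x j \<omega>) (hyperplane u s)" "incident J (\<lambda>j. x j \<omega>) (hyperplane u' s')"
      using us by (auto simp: incident_def hyperplanes_def T1_def T2_def)
    ultimately show ?L by blast
  qed
  have ex: "(\<exists>H. incident J (\<lambda>j. x j \<omega>) H) \<longleftrightarrow> (\<exists>n::nat. \<exists>H\<in>hitting (cball 0 (real n)). incident J (\<lambda>j. x j \<omega>) H)" for \<omega>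
  proof
    assume "\<exists>H. incident J (\<lambda>j. x j \<omega>) H"
    then obtain H where H: "incident J (\<lambda>j. x j \<omega>) H" by blast
    then obtain u s where us: "norm u = 1" "H = hyperplane u s" by (auto simp: incident_def hyperplanes_def)
    then have "s *\<^sub>R u \<in> H" by (simp add: hyperplane_def dot_square_norm)
    moreover obtain n where "norm (s *\<^sub>R u) \<le> real n" using real_arch_simple by blast
    ultimately have "H \<in> hitting (cball 0 (real n))"
      using H by (auto simp: hitting_def incident_def)
    then show "\<exists>n::nat. \<exists>H\<in>hitting (cball 0 (real n)). incident J (\<lambda>j. x j \<omega>) H" using H by blast
  qed blast
  have [measurable]: "Measurable.pred M (I (T1 k n R))" "Measurable.pred M (I (T2 k n R))" for k n R
    unfolding I_def using measurable_incident_compact[OF T1 J] measurable_incident_compact[OF T2 J] by auto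
  have [measurable]: "Measurable.pred M (\<lambda>\<omega>. \<exists>H\<in>hitting (cball 0 (real n)). incident J (\<lambda>j. x j \<omega>) H)" for n
    by (rule measurable_incident_hitting[OF _ J]) simp
  have "spans_hyperplane J (\<lambda>j. x j \<omega>) \<longleftrightarrow> (\<exists>n::nat. \<exists>H\<in>hitting (cball 0 (real n)). incident J (\<lambda>j. x j \<omega>) H) \<and>
      \<not> (\<exists>k n R. I (T1 k n R) \<omega> \<and> I (T2 k n R) \<omega>)" for \<omega>
    unfolding spans_hyperplane_def ex[symmetric] ne[symmetric] by blast
  then show ?thesis by simp
qed

text \<open>By uniqueness, the spanned hyperplane hits \<open>K\<close> iff some incident hyperplane
  does, and that event is already known to be measurable.\<close>

lemma measurable_spanned_hyperplane:
  fixes x :: "'j \<Rightarrow> 'w \<Rightarrow> 'a::euclidean_space"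
  assumes J: "finite J" "\<And>j. j \<in> J \<Longrightarrow> x j \<in> borel_measurable M"
  shows "(\<lambda>\<omega>. spanned_hyperplane J (\<lambda>j. x j \<omega>)) \<in> M \<rightarrow>\<^sub>M hyperplane_space"
  unfolding hyperplane_space_def
proof (rule measurable_measure_of)
  show "(\<lambda>\<omega>. spanned_hyperplane J (\<lambda>j. x j \<omega>)) \<in> space M \<rightarrow> hyperplanes"
    using spanned_hyperplane_in by blast
  fix Y :: "'a set set" assume "Y \<in> {hitting K |K. compact K}"
  then obtain K where K: "compact K" "Y = hitting K" by auto
  note [measurable] = measurable_spans_hyperplane[OF J] measurable_incident_hitting[OF K(1) J]
  define H0 :: "'a set" where "H0 = hyperplane (SOME u. u \<in> sphere 0 1) 0"
  have "spanned_hyperplane J (\<lambda>j. x j \<omega>) \<in> Y \<longleftrightarrow>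
     (if spans_hyperplane J (\<lambda>j. x j \<omega>) then \<exists>H\<in>hitting K. incident J (\<lambda>j. x j \<omega>) H else H0 \<in> Y)" for \<omega>
  proof (cases "spans_hyperplane J (\<lambda>j. x j \<omega>)")
    case True
    then show ?thesis
      unfolding K(2) if_P[OF True]
      by (metis spanned_hyperplane_eq[OF True] spanned_hyperplane_incident[OF True])
  qed (simp add: spanned_hyperplane_def H0_def)
  moreover have "{\<omega>\<in>space M. if spans_hyperplane J (\<lambda>j. x j \<omega>) then
      \<exists>H\<in>hitting K. incident J (\<lambda>j. x j \<omega>) H else H0 \<in> Y} \<in> sets M"
    by measurable
  ultimately show "(\<lambda>\<omega>. spanned_hyperplane J (\<lambda>j. x j \<omega>)) -` Y \<inter> space M \<in> sets M"
    by (simp add: vimage_def Int_def conj_commute)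
qed (auto simp: hitting_def)

text \<open>The point lies on the hyperplane iff, at every scale, some ball of a countable family is
  close to the point and hit by the hyperplane; closedness makes the limit exact.\<close>

lemma measurable_mem_hyperplane:
  fixes f :: "'w \<Rightarrow> 'a::euclidean_space"
  assumes f: "f \<in> borel_measurable M" and g: "g \<in> M \<rightarrow>\<^sub>M hyperplane_space"
  shows "Measurable.pred M (\<lambda>\<omega>. f \<omega> \<in> g \<omega>)"
proof -
  obtain D :: "nat \<Rightarrow> 'a" where D: "\<And>x e. e > 0 \<Longrightarrow> \<exists>k. dist x (D k) < e"
    using dense_sequence by blast
  have "f \<omega> \<in> g \<omega> \<longleftrightarrow> (\<forall>n::nat. \<exists>k. dist (f \<omega>) (D k) < 1 / Suc n \<and> g \<omega> \<in> hitting (cball (D k) (1 / Suc n)))"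
    (is "?L \<longleftrightarrow> ?R") if w: "\<omega> \<in> space M" for \<omega>
  proof
    have hyp: "g \<omega> \<in> hyperplanes"
      using measurable_space[OF g w] by (simp add: space_hyperplane_space)
    {
      assume L: ?L
      show ?R
      proof
        fix n :: nat
        obtain k where k: "dist (f \<omega>) (D k) < 1 / Suc n" using D[of "1 / Suc n" "f \<omega>"] by auto
        then have "f \<omega> \<in> cball (D k) (1 / Suc n)" by (simp add: dist_commute)
        then show "\<exists>k. dist (f \<omega>) (D k) < 1 / Suc n \<and> g \<omega> \<in> hitting (cball (D k) (1 / Suc n))"
          using L hyp k unfolding hitting_def by blast
      qed
    next
      assume R: ?R
      have "\<exists>y\<in>g \<omega>. dist y (f \<omega>) < e" if e: "e > 0" for e
      proof -
        obtain n where n: "1 / Suc n < e / 2"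
          using reals_Archimedean[of "e / 2"] e by (auto simp: inverse_eq_divide)
        obtain k where k: "dist (f \<omega>) (D k) < 1 / Suc n" "g \<omega> \<in> hitting (cball (D k) (1 / Suc n))"
          using R by blast
        then obtain y where y: "y \<in> g \<omega>" "dist (D k) y \<le> 1 / Suc n" by (auto simp: hitting_def)
        have "dist y (f \<omega>) < e"
          using dist_triangle[of y "f \<omega>" "D k"] y(2) k(1) n by (simp add: dist_commute)
        then show ?thesis using y(1) by blast
      qed
      then show ?L using closed_approachable[OF closed_in_hyperplanes[OF hyp]] by blast
    }
  qed
  moreover have "Measurable.pred M (\<lambda>\<omega>. \<forall>n::nat. \<exists>k. dist (f \<omega>) (D k) < 1 / Suc n \<and>
      g \<omega> \<in> hitting (cball (D k) (1 / Suc n)))"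
  proof -
    note [measurable] = f measurable_hits[OF compact_cball g]
    show ?thesis by measurable
  qed
  ultimately show ?thesis by (subst measurable_cong) auto
qed

text \<open>Tuples are taken as extensional functions, so that \<open>random_finite_set_PiE\<close>
  applies to them.\<close>

lemma intersection_points_eq:
  "intersection_points (S :: 'a::euclidean_space set set) =
     meeting_point {..<DIM('a)} ` {h \<in> {..<DIM('a)} \<rightarrow>\<^sub>E S. meets_in_point {..<DIM('a)} h}"
proof (intro equalityI subsetI)
  fix x assume "x \<in> intersection_points S"
  then obtain H where H: "\<forall>i<DIM('a). H i \<in> S" "{x} = (\<Inter>i<DIM('a). H i)"
    by (auto simp: intersection_points_def)
  define h where "h = restrict H {..<DIM('a)}"
  have "(\<Inter>i\<in>{..<DIM('a)}. h i) = {x}" using H(2) by (simp add: h_def)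
  moreover have "h \<in> {..<DIM('a)} \<rightarrow>\<^sub>E S" using H(1) by (auto simp: h_def)
  ultimately
  show "x \<in> meeting_point {..<DIM('a)} ` {h \<in> {..<DIM('a)} \<rightarrow>\<^sub>E S. meets_in_point {..<DIM('a)} h}"
    using meeting_point_eq by blast
next
  fix x assume "x \<in> meeting_point {..<DIM('a)} ` {h \<in> {..<DIM('a)} \<rightarrow>\<^sub>E S. meets_in_point {..<DIM('a)} h}"
  then obtain h where h: "h \<in> {..<DIM('a)} \<rightarrow>\<^sub>E S" "meets_in_point {..<DIM('a)} h"
    "x = meeting_point {..<DIM('a)} h" by blast
  show "x \<in> intersection_points S"
    unfolding intersection_points_def
    using h(1) meets_in_pointD[OF h(2)] by (auto simp: h(3) intro!: exI[of _ h])
qed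

text \<open>Several tuples may meet in the same point, so counts of tuples are not counts of points.
  Hitting events do transfer, and \<open>random_finite_set_from_hits\<close> recovers the
  counts.\<close>

lemma random_finite_set_intersection_points:
  fixes S :: "'w \<Rightarrow> 'a::euclidean_space set set"
  assumes S: "random_finite_set M hyperplane_space S"
  shows "random_finite_set M borel (\<lambda>\<omega>. intersection_points (S \<omega>))"
proof -
  let ?I = "{..<DIM('a)}"
  let ?P = "Pi\<^sub>M ?I (\<lambda>_. hyperplane_space :: 'a set measure)"
  have SP: "random_finite_set M ?P (\<lambda>\<omega>. ?I \<rightarrow>\<^sub>E S \<omega>)"
    using S by (rule random_finite_set_PiE) simp
  obtain E where E: "separating (borel :: 'a measure) E" using separating_borel by blast
  show ?thesis
  proof (rule random_finite_set_from_hits[OF E])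
    fix \<omega> assume "\<omega> \<in> space M"
    then show "finite (intersection_points (S \<omega>)) \<and> intersection_points (S \<omega>) \<subseteq> space borel"
      using SP unfolding intersection_points_eq by (simp add: random_finite_set_def)
  next
    fix A :: "'a set" assume A: "A \<in> sets borel"
    define B where "B = {h\<in>space ?P. meets_in_point ?I h \<and> meeting_point ?I h \<in> A}"
    have [measurable]: "Measurable.pred ?P (meets_in_point ?I)" "meeting_point ?I \<in> borel_measurable ?P"
      using measurable_meets_in_point[of ?I "\<lambda>i h. h i" ?P] measurable_meeting_point[of ?I "\<lambda>i h. h i" ?P]
      by (auto intro: measurable_component_singleton)
    have "B \<in> sets ?P" unfolding B_def using A by measurable
    from random_finite_set_hits[OF SP this]
    have "{\<omega> \<in> space M. (?I \<rightarrow>\<^sub>E S \<omega>) \<inter> B \<noteq> {}} \<in> sets M" .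
    also have "{\<omega> \<in> space M. (?I \<rightarrow>\<^sub>E S \<omega>) \<inter> B \<noteq> {}} = {\<omega>\<in>space M. intersection_points (S \<omega>) \<inter> A \<noteq> {}}"
    proof (rule Collect_cong, rule conj_cong[OF refl])
      fix \<omega> assume "\<omega> \<in> space M"
      then have "(?I \<rightarrow>\<^sub>E S \<omega>) \<subseteq> space ?P" using SP by (simp add: random_finite_set_def)
      then show "((?I \<rightarrow>\<^sub>E S \<omega>) \<inter> B \<noteq> {}) = (intersection_points (S \<omega>) \<inter> A \<noteq> {})"
        unfolding intersection_points_eq B_def by blast
    qed
    finally show "{\<omega>\<in>space M. intersection_points (S \<omega>) \<inter> A \<noteq> {}} \<in> sets M" .
  qed
qed

section \<open>Certified hyperplanes\<close>

text \<open>A hyperplane is certified by \<open>S\<close> if it contains \<open>k\<close> points of \<open>S\<close> which cannot be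
  covered by \<open>q\<close> other hyperplanes, because each of them contains too few of the points.\<close>

definition certified :: "nat \<Rightarrow> nat \<Rightarrow> 'a::euclidean_space set \<Rightarrow> 'a set set" where
  "certified k q S = {H \<in> hyperplanes. \<exists>x\<in>{..<k} \<rightarrow>\<^sub>E S. (\<forall>j<k. x j \<in> H) \<and>
     (\<forall>G\<in>hyperplanes. G \<noteq> H \<longrightarrow> q * card {j\<in>{..<k}. x j \<in> G} < k)}"

text \<open>The condition on all hyperplanes \<open>G\<close> is uncountable. It says that any
  \<open>J\<close> with at least k / q of the indices already spans the hyperplane, and there are
  only finitely many such \<open>J\<close>.\<close>

lemma certified_eq:
  assumes "k > 0" "q > 0"
  shows "certified k q S = spanned_hyperplane {..<k} ` {x \<in> {..<k} \<rightarrow>\<^sub>E S.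
    \<forall>J\<in>Pow {..<k}. k \<le> q * card J \<longrightarrow> spans_hyperplane J x}" (is "_ = ?r ` ?X")
proof (intro equalityI subsetI)
  fix H assume "H \<in> certified k q S"
  then obtain x where x: "H \<in> hyperplanes" "x \<in> {..<k} \<rightarrow>\<^sub>E S" "\<forall>j<k. x j \<in> H"
    "\<And>G. G \<in> hyperplanes \<Longrightarrow> G \<noteq> H \<Longrightarrow> q * card {j\<in>{..<k}. x j \<in> G} < k"
    by (auto simp: certified_def)
  have H: "incident {..<k} x H" using x by (auto simp: incident_def)
  have sp: "spans_hyperplane J x" if J: "J \<subseteq> {..<k}" "k \<le> q * card J" for J
    unfolding spans_hyperplane_def
  proof (rule ex1I)
    show "incident J x H" using J H by (auto simp: incident_def)
    fix G assume G: "incident J x G"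
    show "G = H"
    proof (rule ccontr)
      assume "G \<noteq> H"
      then have "q * card {j\<in>{..<k}. x j \<in> G} < k" using x(4) G by (simp add: incident_def)
      moreover have "card J \<le> card {j\<in>{..<k}. x j \<in> G}"
        using G J by (intro card_mono) (auto simp: incident_def)
      ultimately show False using J(2) mult_le_mono2[of "card J" _ q] by (meson leD order_trans)
    qed
  qed
  have "spanned_hyperplane {..<k} x = H"
    using sp[of "{..<k}"] assms H by (intro spanned_hyperplane_eq) auto
  then show "H \<in> ?r ` ?X"
    using sp H x(2) by (intro image_eqI[of _ _ x]) auto
next
  fix H assume "H \<in> ?r ` ?X"
  then obtain x where x: "x \<in> {..<k} \<rightarrow>\<^sub>E S" "H = spanned_hyperplane {..<k} x"
    and sp: "\<And>J. J \<subseteq> {..<k} \<Longrightarrow> k \<le> q * card J \<Longrightarrow> spans_hyperplane J x" by blast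
  have "spans_hyperplane {..<k} x" using sp[of "{..<k}"] assms by simp
  then have H: "incident {..<k} x H" using spanned_hyperplane_incident x(2) by blast
  have "q * card {j\<in>{..<k}. x j \<in> G} < k" if G: "G \<in> hyperplanes" "G \<noteq> H" for G
  proof (rule ccontr)
    assume "\<not> ?thesis"
    then have "spans_hyperplane {j\<in>{..<k}. x j \<in> G} x" by (intro sp) auto
    moreover have "incident {j\<in>{..<k}. x j \<in> G} x G" "incident {j\<in>{..<k}. x j \<in> G} x H"
      using G H by (auto simp: incident_def)
    ultimately show False using G(2) unfolding spans_hyperplane_def by blast
  qed
  then show "H \<in> certified k q S"
    using x(1) H by (auto simp: certified_def incident_def)
qed

text \<open>One hyperplane may have many certificates, so again hitting events are transferred from
  tuples and counts follow from them.\<close>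

lemma random_finite_set_certified:
  fixes S :: "'w \<Rightarrow> 'a::euclidean_space set"
  assumes S: "random_finite_set M borel S" and kq: "k > 0" "q > 0"
  shows "random_finite_set M hyperplane_space (\<lambda>\<omega>. certified k q (S \<omega>))"
proof -
  let ?P = "Pi\<^sub>M {..<k} (\<lambda>_. borel :: 'a measure)"
  define X where "X = {x \<in> space ?P.
    \<forall>J\<in>Pow {..<k}. k \<le> q * card J \<longrightarrow> spans_hyperplane J x}"
  have SP: "random_finite_set M ?P (\<lambda>\<omega>. {..<k} \<rightarrow>\<^sub>E S \<omega>)"
    using S by (rule random_finite_set_PiE) simp
  have C: "certified k q (S \<omega>) = spanned_hyperplane {..<k} ` (({..<k} \<rightarrow>\<^sub>E S \<omega>) \<inter> X)" if "\<omega> \<in> space M" for \<omega>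
  proof -
    have "({..<k} \<rightarrow>\<^sub>E S \<omega>) \<subseteq> space ?P" using SP that by (simp add: random_finite_set_def)
    then show ?thesis unfolding certified_eq[OF kq] X_def by (intro arg_cong[of _ _ "image _"]) blast
  qed
  have X: "X \<in> sets ?P"
  proof -
    have "Measurable.pred ?P (spans_hyperplane J)" if "J \<subseteq> {..<k}" for J
      using measurable_spans_hyperplane[of J "\<lambda>j x. x j" ?P] that finite_subset[OF that]
      by (auto intro: measurable_component_singleton)
    then have J: "Measurable.pred ?P (\<lambda>x. k \<le> q * card J \<longrightarrow> spans_hyperplane J x)" if "J \<in> Pow {..<k}" for J
      using that by (cases "k \<le> q * card J") auto
    have "Measurable.pred ?P (\<lambda>x. \<forall>J\<in>Pow {..<k}. k \<le> q * card J \<longrightarrow> spans_hyperplane J x)"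
    proof (rule pred_intros_finite(3))
      show "Measurable.pred ?P (\<lambda>x. k \<le> q * card J \<longrightarrow> spans_hyperplane J x)" if "J \<in> Pow {..<k}" for J
        using that by (rule J)
    qed simp
    then show ?thesis unfolding X_def pred_def .
  qed
  have sp[measurable]: "spanned_hyperplane {..<k} \<in> ?P \<rightarrow>\<^sub>M hyperplane_space"
    using measurable_spanned_hyperplane[of "{..<k}" "\<lambda>j x. x j" ?P]
    by (auto intro: measurable_component_singleton)
  obtain E where E: "separating (hyperplane_space :: 'a set measure) E"
    using separating_hyperplane_space by blast
  show ?thesis
  proof (rule random_finite_set_from_hits[OF E])
    fix \<omega> assume w: "\<omega> \<in> space M"
    show "finite (certified k q (S \<omega>)) \<and> certified k q (S \<omega>) \<subseteq> space hyperplane_space"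
    proof
      show "finite (certified k q (S \<omega>))"
        unfolding C[OF w] using SP w by (simp add: random_finite_set_def)
    qed (auto simp: certified_def space_hyperplane_space)
  next
    fix A :: "'a set set" assume A: "A \<in> sets hyperplane_space"
    have "X \<inter> (spanned_hyperplane {..<k} -` A \<inter> space ?P) \<in> sets ?P"
      using X measurable_sets[OF sp A] by auto
    from random_finite_set_hits[OF SP this]
    show "{\<omega>\<in>space M. certified k q (S \<omega>) \<inter> A \<noteq> {}} \<in> sets M"
    proof (rule back_subst[of "\<lambda>Y. Y \<in> sets M"], intro Collect_cong conj_cong refl)
      fix \<omega> assume w: "\<omega> \<in> space M"
      show "(({..<k} \<rightarrow>\<^sub>E S \<omega>) \<inter> (X \<inter> (spanned_hyperplane {..<k} -` A \<inter> space ?P)) \<noteq> {}) =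
          (certified k q (S \<omega>) \<inter> A \<noteq> {})"
        unfolding C[OF w] by (auto simp: X_def)
    qed
  qed
qed

section \<open>The intersection process\<close>

lemma space_measure_restriction: "space (measure_restriction \<mu> B) = space \<mu>"
  by (simp add: measure_restriction_def)

lemma intersection_points_Int_subset:
  "intersection_points S \<inter> C \<subseteq> intersection_points (S \<inter> hitting C)" if "S \<subseteq> hyperplanes"
  using that unfolding intersection_points_def hitting_def by blast

lemma intersection_points_mono: "S \<subseteq> T \<Longrightarrow> intersection_points S \<subseteq> intersection_points T"
  unfolding intersection_points_def by blast

lemma finite_intersection_points: "finite S \<Longrightarrow> finite (intersection_points S)"
  by (simp add: intersection_points_eq finite_PiE)

lemma finite_intersection_points_compact:
  assumes "S \<in> hyperplane_configurations" "compact C"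
  shows "finite (intersection_points S \<inter> C)"
  using assms finite_subset[OF intersection_points_Int_subset finite_intersection_points]
  by (auto simp: hyperplane_configurations_def)

lemma emeasure_intersection_process:
  "A \<in> sets borel \<Longrightarrow>
    emeasure (intersection_process \<eta> \<omega>) A = emeasure (count_space UNIV) (intersection_points (\<eta> \<omega>) \<inter> A)"
  unfolding intersection_process_def by (rule emeasure_counting_measure) auto

lemma sets_intersection_process [simp]: "sets (intersection_process \<eta> \<omega>) = sets borel"
  by (simp add: intersection_process_def counting_measure_def)

lemma emeasure_restricted_intersection_process:
  assumes "A \<in> sets borel" "B \<in> sets borel"
  shows "emeasure (measure_restriction (intersection_process \<eta> \<omega>) B) A =
    emeasure (count_space UNIV) (intersection_points (\<eta> \<omega>) \<inter> B \<inter> A)"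
  using assms by (simp add: emeasure_measure_restriction emeasure_intersection_process Int_ac)

lemma atoms_restricted_intersection_process:
  fixes \<eta> :: "'w \<Rightarrow> 'a::euclidean_space set set"
  assumes B: "B \<in> sets borel"
  shows "atoms (measure_restriction (intersection_process \<eta> \<omega>) B) = intersection_points (\<eta> \<omega>) \<inter> B"
proof -
  have sp: "space (intersection_process \<eta> \<omega>) = UNIV"
    using sets_eq_imp_space_eq[OF sets_intersection_process[of \<eta> \<omega>]] by simp
  have one: "emeasure (count_space UNIV) (S \<inter> {x}) \<ge> 1 \<longleftrightarrow> x \<in> S" for S :: "'a set" and x
    by (cases "x \<in> S") auto
  from sp have "atoms (measure_restriction (intersection_process \<eta> \<omega>) B) =
      {x. emeasure (count_space UNIV) (intersection_points (\<eta> \<omega>) \<inter> B \<inter> {x}) \<ge> 1}"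
    unfolding atoms_def space_measure_restriction
    by (subst emeasure_restricted_intersection_process) (auto simp: B)
  also have "\<dots> = intersection_points (\<eta> \<omega>) \<inter> B"
    unfolding one by blast
  finally show ?thesis .
qed

text \<open>The measurable side of a hyperplane process, free of distributional assumptions.\<close>

locale random_hyperplanes =
  fixes M :: "'w measure" and \<eta> :: "'w \<Rightarrow> 'a::euclidean_space set set"
  assumes config: "\<And>\<omega>. \<omega> \<in> space M \<Longrightarrow> \<eta> \<omega> \<in> hyperplane_configurations"
    and counts: "\<And>A. A \<in> sets hyperplane_space \<Longrightarrow>
      (\<lambda>\<omega>. emeasure (counting_measure hyperplane_space (\<eta> \<omega>)) A) \<in> borel_measurable M"
begin

lemma subset_hyperplanes: "\<omega> \<in> space M \<Longrightarrow> \<eta> \<omega> \<subseteq> hyperplanes"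
  using config by (auto simp: hyperplane_configurations_def)

lemma emeasure_counts:
  "\<omega> \<in> space M \<Longrightarrow> A \<in> sets hyperplane_space \<Longrightarrow>
    emeasure (counting_measure hyperplane_space (\<eta> \<omega>)) A = emeasure (count_space UNIV) (\<eta> \<omega> \<inter> A)"
  using subset_hyperplanes by (intro emeasure_counting_measure) (auto simp: space_hyperplane_space)

lemma random_finite_set_hitting:
  assumes K: "compact K"
  shows "random_finite_set M hyperplane_space (\<lambda>\<omega>. \<eta> \<omega> \<inter> hitting K)"
  unfolding random_finite_set_def
proof (intro conjI ballI)
  fix \<omega> assume w: "\<omega> \<in> space M"
  then show fin: "finite (\<eta> \<omega> \<inter> hitting K)"
    using config K by (auto simp: hyperplane_configurations_def)
  show "\<eta> \<omega> \<inter> hitting K \<subseteq> space hyperplane_space"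
    by (auto simp: space_hyperplane_space hitting_def)
next
  fix A :: "'a set set" assume A: "A \<in> sets hyperplane_space"
  then have A': "hitting K \<inter> A \<in> sets hyperplane_space" using hitting_sets[OF K] by auto
  note [measurable] = counts[OF A']
  have "card (\<eta> \<omega> \<inter> hitting K \<inter> A) = k \<longleftrightarrow>
      emeasure (counting_measure hyperplane_space (\<eta> \<omega>)) (hitting K \<inter> A) = of_nat k" if w: "\<omega> \<in> space M" for \<omega> k
  proof -
    have "finite (\<eta> \<omega> \<inter> (hitting K \<inter> A))"
      using config[OF w] K by (auto simp: hyperplane_configurations_def Int_assoc[symmetric])
    then have "emeasure (counting_measure hyperplane_space (\<eta> \<omega>)) (hitting K \<inter> A) =
        of_nat (card (\<eta> \<omega> \<inter> (hitting K \<inter> A)))"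
      unfolding emeasure_counts[OF w A'] by (simp add: emeasure_count_space)
    then show ?thesis by (simp add: Int_assoc)
  qed
  then have "(\<lambda>\<omega>. card (\<eta> \<omega> \<inter> hitting K \<inter> A)) -` {k} \<inter> space M =
      {\<omega>\<in>space M. emeasure (counting_measure hyperplane_space (\<eta> \<omega>)) (hitting K \<inter> A) = of_nat k}" for k
    by auto
  moreover have "{\<omega>\<in>space M. emeasure (counting_measure hyperplane_space (\<eta> \<omega>)) (hitting K \<inter> A) = of_nat k} \<in> sets M" for k
    by measurable
  ultimately show "(\<lambda>\<omega>. card (\<eta> \<omega> \<inter> hitting K \<inter> A)) \<in> M \<rightarrow>\<^sub>M count_space UNIV"
    by (subst measurable_count_space_eq_countable) auto
qed

text \<open>The hyperplanes hitting a ball form a random finite set. As the radius grows, their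
  intersection points increase to those of \<eta>, so the counts are monotone limits.\<close>

lemma random_measure_intersection_process: "random_measure M (intersection_process \<eta>)"
  unfolding random_measure_def
proof (intro conjI ballI allI impI)
  show "intersection_process \<eta> \<in> M \<rightarrow>\<^sub>M measure_algebra borel"
  proof (rule measurable_measure_algebraI)
    fix A :: "'a set" assume A: "A \<in> sets borel"
    define S where "S m \<omega> = intersection_points (\<eta> \<omega> \<inter> hitting (cball 0 (real m)))" for m \<omega>
    have S: "random_finite_set M borel (S m)" for m
      unfolding S_def by (intro random_finite_set_intersection_points random_finite_set_hitting compact_cball)
    have "emeasure (intersection_process \<eta> \<omega>) A = (SUP m. of_nat (card (S m \<omega> \<inter> A)))" if w: "\<omega> \<in> space M" for \<omega>
    proof -
      have "intersection_points (\<eta> \<omega>) \<subseteq> (\<Union>m. S m \<omega>)"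
      proof
        fix x assume x: "x \<in> intersection_points (\<eta> \<omega>)"
        obtain m where "norm x \<le> real m" using real_arch_simple by blast
        then have "x \<in> intersection_points (\<eta> \<omega>) \<inter> cball 0 (real m)" using x by simp
        then have "x \<in> S m \<omega>"
          using intersection_points_Int_subset[OF subset_hyperplanes[OF w]] unfolding S_def by blast
        then show "x \<in> (\<Union>m. S m \<omega>)" by blast
      qed
      moreover have "S m \<omega> \<subseteq> intersection_points (\<eta> \<omega>)" for m
        unfolding S_def by (intro intersection_points_mono) auto
      ultimately have "intersection_points (\<eta> \<omega>) \<inter> A = (\<Union>m. S m \<omega> \<inter> A)" by blast
      moreover have "incseq (\<lambda>m. S m \<omega> \<inter> A)"
      proof (rule incseq_SucI)
        fix m
        have "hitting (cball 0 (real m)) \<subseteq> hitting (cball (0::'a) (real (Suc m)))"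
          unfolding hitting_def by (auto simp: dist_norm)
        then show "S m \<omega> \<inter> A \<subseteq> S (Suc m) \<omega> \<inter> A"
          unfolding S_def by (intro Int_mono intersection_points_mono) auto
      qed
      ultimately have "emeasure (intersection_process \<eta> \<omega>) A = (SUP m. emeasure (count_space UNIV) (S m \<omega> \<inter> A))"
        unfolding emeasure_intersection_process[OF A] by (simp add: SUP_emeasure_incseq)
      moreover have "emeasure (count_space UNIV) (S m \<omega> \<inter> A) = of_nat (card (S m \<omega> \<inter> A))" for m
      proof -
        have "finite (S m \<omega>)" using S w by (simp add: random_finite_set_def)
        then show ?thesis by (simp add: emeasure_count_space)
      qed
      ultimately show ?thesis by simp
    qed
    moreover have "(\<lambda>\<omega>. SUP m. of_nat (card (S m \<omega> \<inter> A)) :: ennreal) \<in> borel_measurable M"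
    proof -
      have [measurable]: "(\<lambda>\<omega>. card (S m \<omega> \<inter> A)) \<in> M \<rightarrow>\<^sub>M count_space UNIV" for m
        using S A by (auto simp: random_finite_set_def)
      show ?thesis by measurable
    qed
    ultimately show "(\<lambda>\<omega>. emeasure (intersection_process \<eta> \<omega>) A) \<in> borel_measurable M"
      by (subst measurable_cong) auto
  qed simp
  fix \<omega> and C :: "'a set" assume "\<omega> \<in> space M" "compact C"
  then show "emeasure (intersection_process \<eta> \<omega>) C < \<infinity>"
    using finite_intersection_points_compact[OF config]
    by (subst emeasure_intersection_process) (auto simp: borel_compact emeasure_count_space of_nat_less_top)
qed

end

section \<open>Reconstruction from the atoms of a measure\<close>

lemma finite_measures_sets:
  "{\<mu>. emeasure \<mu> (space N) < \<infinity>} \<inter> space (measure_algebra N) \<in> sets (measure_algebra N)"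
proof -
  have [measurable]: "(\<lambda>\<mu>. emeasure \<mu> (space N)) \<in> borel_measurable (measure_algebra N)"
    by (intro measurable_emeasure_measure_algebra) simp
  have "{\<mu>\<in>space (measure_algebra N). emeasure \<mu> (space N) < \<infinity>} \<in> sets (measure_algebra N)" by measurable
  then show ?thesis by (simp add: Int_def conj_commute)
qed

lemma random_finite_set_certified_atoms:
  assumes kq: "k > 0" "q > 0"
  shows "random_finite_set (restrict_space (measure_algebra borel) {\<mu>. emeasure \<mu> UNIV < \<infinity>})
    (hyperplane_space :: 'a::euclidean_space set measure) (\<lambda>\<mu>. certified k q (atoms \<mu>))"
proof -
  obtain E where E: "separating (borel :: 'a measure) E" using separating_borel by blast
  show ?thesis using random_finite_set_atoms[OF E] kq by (intro random_finite_set_certified) auto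
qed

lemma certified_counts_sets:
  fixes W :: "'b \<Rightarrow> 'a::euclidean_space set set"
  assumes kq: "k > 0" "q > 0" and B: "finite B" and W: "\<And>b. b \<in> B \<Longrightarrow> W b \<in> sets hyperplane_space"
  shows "{\<mu>\<in>space (measure_algebra borel). emeasure \<mu> UNIV < \<infinity> \<and>
    (\<forall>b\<in>B. n \<le> card (certified k q (atoms \<mu>) \<inter> W b))} \<in> sets (measure_algebra borel)"
proof -
  let ?F = "{\<mu> :: 'a measure. emeasure \<mu> UNIV < \<infinity>}"
  let ?R = "restrict_space (measure_algebra borel) ?F"
  have F: "?F \<inter> space (measure_algebra borel) \<in> sets (measure_algebra borel)"
    using finite_measures_sets[of borel] by simp
  have [measurable]: "(\<lambda>\<mu>. card (certified k q (atoms \<mu>) \<inter> W b)) \<in> ?R \<rightarrow>\<^sub>M count_space UNIV" if "b \<in> B" for b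
    using random_finite_set_certified_atoms[OF kq] W[OF that] by (auto simp: random_finite_set_def)
  have "Measurable.pred ?R (\<lambda>\<mu>. \<forall>b\<in>B. n \<le> card (certified k q (atoms \<mu>) \<inter> W b))"
    by (intro pred_intros_finite B) measurable
  then have "{\<mu>\<in>space ?R. \<forall>b\<in>B. n \<le> card (certified k q (atoms \<mu>) \<inter> W b)} \<in> sets ?R"
    by (simp add: pred_def)
  then have "{\<mu>\<in>space ?R. \<forall>b\<in>B. n \<le> card (certified k q (atoms \<mu>) \<inter> W b)} \<in> sets (measure_algebra borel)"
    using F by (simp add: sets_restrict_space_iff Int_commute)
  then show ?thesis by (simp add: space_restrict_space conj_ac Int_def)
qed

text \<open>The map that will recover \<eta> from the explored points. It has to be defined on all
  measures; where the total mass is infinite, the atoms might be infinite in number, and the empty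
  set keeps the value inside \<open>hyperplane_configurations\<close>.\<close>

definition reconstruction :: "nat \<Rightarrow> nat \<Rightarrow> 'a::euclidean_space set \<Rightarrow> 'a measure \<Rightarrow> 'a set set" where
  "reconstruction k q K \<mu> =
     (if emeasure \<mu> UNIV < \<infinity> then certified k q (atoms \<mu>) \<inter> hitting K else {})"

lemma measurable_reconstruction:
  fixes K :: "'a::euclidean_space set"
  assumes kq: "k > 0" "q > 0" and K: "compact K"
  shows "reconstruction k q K \<in> measure_algebra borel \<rightarrow>\<^sub>M configuration_algebra"
  unfolding configuration_algebra_def
proof (rule measurable_vimage_algebra2)
  let ?F = "{\<mu> :: 'a measure. emeasure \<mu> UNIV < \<infinity>}"
  let ?R = "restrict_space (measure_algebra borel) ?F"
  note C = random_finite_set_certified_atoms[OF kq]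
  have F: "?F \<inter> space (measure_algebra borel) \<in> sets (measure_algebra borel)"
    using finite_measures_sets[of borel] by simp
  have fin: "finite (reconstruction k q K \<mu>)" if "\<mu> \<in> space (measure_algebra borel)" for \<mu>
    using C that by (auto simp: reconstruction_def random_finite_set_def space_restrict_space)
  have sub: "reconstruction k q K \<mu> \<subseteq> space hyperplane_space" for \<mu>
    by (auto simp: reconstruction_def hitting_def space_hyperplane_space)
  show "reconstruction k q K \<in> space (measure_algebra borel) \<rightarrow> hyperplane_configurations"
    using fin sub by (auto simp: hyperplane_configurations_def space_hyperplane_space)
  show "(\<lambda>\<mu>. counting_measure hyperplane_space (reconstruction k q K \<mu>)) \<in>
      measure_algebra borel \<rightarrow>\<^sub>M measure_algebra hyperplane_space"
  proof (rule measurable_measure_algebraI)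
    fix A :: "'a set set" assume A: "A \<in> sets hyperplane_space"
    have eq: "emeasure (counting_measure hyperplane_space (reconstruction k q K \<mu>)) A =
        (if \<mu> \<in> ?F then of_nat (card (certified k q (atoms \<mu>) \<inter> (hitting K \<inter> A))) else 0)"
      if "\<mu> \<in> space (measure_algebra borel)" for \<mu>
    proof -
      have "finite (reconstruction k q K \<mu> \<inter> A)" using fin[OF that] by simp
      then show ?thesis
        unfolding emeasure_counting_measure[OF sub A]
        by (simp add: emeasure_count_space reconstruction_def Int_assoc)
    qed
    have [measurable]: "(\<lambda>\<mu>. card (certified k q (atoms \<mu>) \<inter> (hitting K \<inter> A))) \<in> ?R \<rightarrow>\<^sub>M count_space UNIV"
      using C A hitting_sets[OF K] by (auto simp: random_finite_set_def)
    have "(\<lambda>\<mu>. if \<mu> \<in> ?F then of_nat (card (certified k q (atoms \<mu>) \<inter> (hitting K \<inter> A))) else 0 :: ennreal)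
        \<in> borel_measurable (measure_algebra borel)"
    proof (subst measurable_If_restrict_space_iff)
      show "{x \<in> space (measure_algebra borel). x \<in> ?F} \<in> sets (measure_algebra borel)"
        using F by (simp add: Int_def conj_commute)
      have "(\<lambda>\<mu>. of_nat (card (certified k q (atoms \<mu>) \<inter> (hitting K \<inter> A))) :: ennreal) \<in> borel_measurable ?R"
        by measurable
      then show "(\<lambda>\<mu>. of_nat (card (certified k q (atoms \<mu>) \<inter> (hitting K \<inter> A))) :: ennreal)
          \<in> borel_measurable (restrict_space (measure_algebra borel) {x. x \<in> ?F}) \<and>
        (\<lambda>\<mu>. 0::ennreal) \<in> borel_measurable (restrict_space (measure_algebra borel) {x. x \<notin> ?F})"
        by simp
    qed
    then show "(\<lambda>\<mu>. emeasure (counting_measure hyperplane_space (reconstruction k q K \<mu>)) A)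
        \<in> borel_measurable (measure_algebra borel)"
      using eq by (subst measurable_cong) auto
  qed (simp add: counting_measure_def)
qed

section \<open>Poisson hyperplanes\<close>

locale poisson_hyperplanes = prob_space M for M :: "'w measure" +
  fixes \<gamma> :: real and Q :: "'a::euclidean_space measure" and \<eta> :: "'w \<Rightarrow> 'a set set"
  assumes \<gamma>: "\<gamma> > 0" and Q: "directional_distribution Q" and \<eta>: "poisson_hyperplane_process M \<gamma> Q \<eta>"
begin

abbreviation \<Lambda> :: "'a set measure" where
  "\<Lambda> \<equiv> hyperplane_intensity \<gamma> Q"

lemma sets_\<Lambda> [simp, measurable_cong]: "sets \<Lambda> = sets hyperplane_space"
  by (simp add: hyperplane_intensity_def)

lemma space_\<Lambda>: "space \<Lambda> = hyperplanes"
  using sets_eq_imp_space_eq[OF sets_\<Lambda>] by (simp add: space_hyperplane_space)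

lemma poisson: "poisson_process M \<Lambda> (\<lambda>\<omega>. counting_measure hyperplane_space (\<eta> \<omega>))"
  using \<eta> by (simp add: poisson_hyperplane_process_def)

sublocale random_hyperplanes M \<eta>
proof
  show "\<eta> \<omega> \<in> hyperplane_configurations" if "\<omega> \<in> space M" for \<omega>
    using \<eta> that by (simp add: poisson_hyperplane_process_def)
  fix A :: "'a set set" assume "A \<in> sets hyperplane_space"
  then have "(\<lambda>\<mu>. emeasure \<mu> A) \<in> borel_measurable (measure_algebra \<Lambda>)"
    by (intro measurable_emeasure_measure_algebra) simp
  moreover have "(\<lambda>\<omega>. counting_measure hyperplane_space (\<eta> \<omega>)) \<in> M \<rightarrow>\<^sub>M measure_algebra \<Lambda>"
    using poisson by (simp add: poisson_process_def)
  ultimately show "(\<lambda>\<omega>. emeasure (counting_measure hyperplane_space (\<eta> \<omega>)) A) \<in> borel_measurable M"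
    by (rule measurable_compose[rotated])
qed

interpretation Q: prob_space Q
  using Q by (simp add: directional_distribution_def)

lemma space_Q: "space Q = sphere 0 1"
proof -
  have "sets Q = sets (restrict_space borel (sphere 0 1))"
    using Q by (simp add: directional_distribution_def)
  from sets_eq_imp_space_eq[OF this] show ?thesis by (simp add: space_restrict_space)
qed

lemma intensity_cball_finite: "emeasure \<Lambda> (hitting (cball 0 r)) < \<infinity>"
proof -
  have "emeasure \<Lambda> (hitting (cball 0 r)) =
      ennreal \<gamma> * (\<integral>\<^sup>+u. \<integral>\<^sup>+s. indicator (hitting (cball 0 r)) (hyperplane u s) \<partial>lborel \<partial>Q)"
    by (intro emeasure_hyperplane_intensity Q hitting_sets) simp
  also have "\<dots> \<le> ennreal \<gamma> * (\<integral>\<^sup>+u. ennreal (2 * \<bar>r\<bar>) \<partial>Q)"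
  proof (intro mult_left_mono nn_integral_mono)
    fix u assume "u \<in> space Q"
    then have u: "norm u = 1" by (simp add: space_Q)
    have "(\<integral>\<^sup>+s. indicator (hitting (cball 0 r)) (hyperplane u s) \<partial>lborel) \<le>
        (\<integral>\<^sup>+s. indicator {- \<bar>r\<bar>..\<bar>r\<bar>} s \<partial>lborel)"
    proof (intro nn_integral_mono)
      fix s :: real
      have "s \<in> {- \<bar>r\<bar>..\<bar>r\<bar>}" if hit: "hyperplane u s \<in> hitting (cball 0 r)"
      proof -
        obtain y where y: "norm y \<le> r" "y \<in> hyperplane u s"
          using hit by (auto simp: hitting_def)
        from y(2) have s: "s = y \<bullet> u" by (simp add: hyperplane_def)
        have "\<bar>s\<bar> \<le> norm y * norm u" unfolding s by (rule Cauchy_Schwarz_ineq2)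
        then show ?thesis using y(1) u by auto
      qed
      then show "indicator (hitting (cball 0 r)) (hyperplane u s) \<le> (indicator {- \<bar>r\<bar>..\<bar>r\<bar>} s :: ennreal)"
        by (auto simp: indicator_def)
    qed
    also have "\<dots> = ennreal (2 * \<bar>r\<bar>)" by simp
    finally show "(\<integral>\<^sup>+s. indicator (hitting (cball 0 r)) (hyperplane u s) \<partial>lborel) \<le> ennreal (2 * \<bar>r\<bar>)" .
  qed simp
  also have "\<dots> < \<infinity>" by (simp add: Q.emeasure_space_1 ennreal_mult_less_top)
  finally show ?thesis .
qed

text \<open>For each normal \<open>u\<close> only the parameter \<open>p \<bullet> u\<close> gives a
  hyperplane through \<open>p\<close>, and a single value of \<open>s\<close> is Lebesgue null. This
  is the source of general position.\<close>

lemma intensity_point: "emeasure \<Lambda> (hitting {p}) = 0"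
proof -
  have "emeasure \<Lambda> (hitting {p}) =
      ennreal \<gamma> * (\<integral>\<^sup>+u. \<integral>\<^sup>+s. indicator (hitting {p}) (hyperplane u s) \<partial>lborel \<partial>Q)"
    by (intro emeasure_hyperplane_intensity Q hitting_sets) simp
  also have "(\<integral>\<^sup>+u. \<integral>\<^sup>+s. indicator (hitting {p}) (hyperplane u s) \<partial>lborel \<partial>Q) \<le> (\<integral>\<^sup>+u. 0 \<partial>Q)"
  proof (intro nn_integral_mono)
    fix u
    have "(\<integral>\<^sup>+s. indicator (hitting {p}) (hyperplane u s) \<partial>lborel) \<le> (\<integral>\<^sup>+s. indicator {p \<bullet> u} s \<partial>lborel)"
      by (intro nn_integral_mono) (auto simp: indicator_def hitting_def hyperplane_def)
    also have "\<dots> = 0" by simp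
    finally show "(\<integral>\<^sup>+s. indicator (hitting {p}) (hyperplane u s) \<partial>lborel) \<le> 0" .
  qed
  finally show ?thesis by (simp add: mult_left_mono)
qed

section \<open>Distribution of the counts in bounded sets\<close>

lemma finite_counts:
  assumes "\<omega> \<in> space M" "B \<subseteq> hitting (cball 0 r)"
  shows "finite (\<eta> \<omega> \<inter> B)"
proof -
  have "finite (\<eta> \<omega> \<inter> hitting (cball 0 r))"
    using config[OF assms(1)] by (simp add: hyperplane_configurations_def)
  from finite_subset[OF _ this] show ?thesis using assms(2) by blast
qed

lemma measurable_card:
  assumes "B \<in> sets hyperplane_space" "B \<subseteq> hitting (cball 0 r)"
  shows "(\<lambda>\<omega>. card (\<eta> \<omega> \<inter> B)) \<in> M \<rightarrow>\<^sub>M count_space UNIV"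
proof -
  have "(\<lambda>\<omega>. card (\<eta> \<omega> \<inter> hitting (cball 0 r) \<inter> B)) \<in> M \<rightarrow>\<^sub>M count_space UNIV"
    using random_finite_set_hitting[of "cball 0 r"] assms(1) by (simp add: random_finite_set_def)
  moreover have "hitting (cball 0 r) \<inter> B = B" using assms(2) by blast
  ultimately show ?thesis by (simp add: Int_assoc)
qed

lemma emeasure_counts_card:
  assumes "\<omega> \<in> space M" "B \<in> sets hyperplane_space" "B \<subseteq> hitting (cball 0 r)"
  shows "emeasure (counting_measure hyperplane_space (\<eta> \<omega>)) B = of_nat (card (\<eta> \<omega> \<inter> B))"
  using finite_counts[OF assms(1,3)] by (simp add: emeasure_counts assms emeasure_count_space)

lemma intensity_finite: "B \<subseteq> hitting (cball 0 r) \<Longrightarrow> emeasure \<Lambda> B < \<infinity>"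
  using emeasure_mono[of B "hitting (cball 0 r)" \<Lambda>] intensity_cball_finite[of r] hitting_sets[of "cball 0 r"]
  by (auto intro: le_less_trans)

lemma prob_card:
  assumes B: "B \<in> sets hyperplane_space" "B \<subseteq> hitting (cball 0 r)"
  shows "prob {\<omega>\<in>space M. card (\<eta> \<omega> \<inter> B) = k} = measure \<Lambda> B ^ k / fact k * exp (- measure \<Lambda> B)"
proof -
  have "prob {\<omega>\<in>space M. emeasure (counting_measure hyperplane_space (\<eta> \<omega>)) B = of_nat k} =
      measure \<Lambda> B ^ k / fact k * exp (- measure \<Lambda> B)"
    using poisson intensity_finite[OF B(2)] B(1) by (simp add: poisson_process_def)
  moreover have "{\<omega>\<in>space M. emeasure (counting_measure hyperplane_space (\<eta> \<omega>)) B = of_nat k} =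
      {\<omega>\<in>space M. card (\<eta> \<omega> \<inter> B) = k}"
    using emeasure_counts_card[OF _ B] by auto
  ultimately show ?thesis by simp
qed

lemma poisson_mean_sums:
  fixes l :: real
  shows "(\<lambda>k. real k * (l ^ k / fact k * exp (- l))) sums l"
proof -
  have "(\<lambda>k. l ^ k /\<^sub>R fact k) sums exp l" by (rule exp_converges)
  then have "(\<lambda>k. (l ^ k /\<^sub>R fact k) * (l * exp (- l))) sums (exp l * (l * exp (- l)))"
    by (rule sums_mult2)
  moreover have "exp l * (l * exp (- l)) = l" by (simp add: exp_minus)
  moreover have "(l ^ k /\<^sub>R fact k) * (l * exp (- l)) = real (Suc k) * (l ^ Suc k / fact (Suc k) * exp (- l))" for k
    by (simp add: field_simps del: of_nat_Suc)
  ultimately have "(\<lambda>k. real (Suc k) * (l ^ Suc k / fact (Suc k) * exp (- l))) sums l"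
    by (simp only:)
  then show ?thesis by (subst (asm) sums_Suc_iff) simp
qed

text \<open>A Poisson process is defined by probabilities of its counts; the mean comes from summing
  the series over the values.\<close>

lemma mean_card:
  assumes B: "B \<in> sets hyperplane_space" "B \<subseteq> hitting (cball 0 r)"
  shows "(\<integral>\<^sup>+\<omega>. of_nat (card (\<eta> \<omega> \<inter> B)) \<partial>M) = emeasure \<Lambda> B"
proof -
  note [measurable] = measurable_card[OF B]
  define l where "l = measure \<Lambda> B"
  have "(\<integral>\<^sup>+\<omega>. of_nat (card (\<eta> \<omega> \<inter> B)) \<partial>M) =
      (\<integral>\<^sup>+\<omega>. (\<Sum>k. of_nat k * indicator {\<omega>\<in>space M. card (\<eta> \<omega> \<inter> B) = k} \<omega>) \<partial>M)"
  proof (intro nn_integral_cong)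
    fix \<omega> assume w: "\<omega> \<in> space M"
    have "(\<lambda>k. if k = card (\<eta> \<omega> \<inter> B) then of_nat k else 0 :: ennreal) sums of_nat (card (\<eta> \<omega> \<inter> B))"
      by (rule sums_single)
    moreover have "(\<lambda>k. of_nat k * indicator {\<omega>\<in>space M. card (\<eta> \<omega> \<inter> B) = k} \<omega> :: ennreal) =
        (\<lambda>k. if k = card (\<eta> \<omega> \<inter> B) then of_nat k else 0)"
      using w by (auto simp: indicator_def)
    ultimately show "of_nat (card (\<eta> \<omega> \<inter> B)) =
        (\<Sum>k. of_nat k * indicator {\<omega>\<in>space M. card (\<eta> \<omega> \<inter> B) = k} \<omega> :: ennreal)"
      by (simp only: sums_unique)
  qed
  also have "\<dots> = (\<Sum>k. of_nat k * emeasure M {\<omega>\<in>space M. card (\<eta> \<omega> \<inter> B) = k})"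
    by (subst nn_integral_suminf) (auto simp: nn_integral_cmult)
  also have "\<dots> = (\<Sum>k. ennreal (real k * (l ^ k / fact k * exp (- l))))"
    by (intro suminf_cong)
      (simp add: emeasure_eq_measure prob_card[OF B] l_def ennreal_of_nat_eq_real_of_nat ennreal_mult[symmetric])
  also have "\<dots> = ennreal l"
    by (intro suminf_ennreal_eq poisson_mean_sums) (simp add: l_def)
  also have "\<dots> = emeasure \<Lambda> B"
    using intensity_finite[OF B(2)] by (simp add: l_def emeasure_eq_ennreal_measure less_top)
  finally show ?thesis .
qed

lemma power_div_fact_le_exp:
  fixes x :: real
  assumes "x \<ge> 0"
  shows "x ^ k / fact k \<le> exp x"
proof -
  have s: "(\<lambda>n. inverse (fact n) * x ^ n) sums exp x"
    using exp_converges[of x] by simp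
  have "(\<Sum>n\<in>{k}. inverse (fact n) * x ^ n) \<le> (\<Sum>n. inverse (fact n) * x ^ n)"
    using s assms by (intro sum_le_suminf) (auto simp: sums_iff)
  then show ?thesis using s by (simp add: sums_iff divide_inverse mult.commute)
qed

text \<open>Writing l^k / k! as 2^k (l/2)^k / k! and bounding the last quotient by exp (l/2) spends
  half of the exponent and leaves a factor independent of l.\<close>

lemma poisson_tail:
  assumes B: "B \<in> sets hyperplane_space" "B \<subseteq> hitting (cball 0 r)"
  shows "prob {\<omega>\<in>space M. card (\<eta> \<omega> \<inter> B) < N} \<le> 2 ^ N * exp (- measure \<Lambda> B / 2)"
proof -
  note [measurable] = measurable_card[OF B]
  define l where "l = measure \<Lambda> B"
  have l: "l \<ge> 0" by (simp add: l_def)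
  have "{\<omega>\<in>space M. card (\<eta> \<omega> \<inter> B) < N} = (\<Union>k\<in>{..<N}. {\<omega>\<in>space M. card (\<eta> \<omega> \<inter> B) = k})"
    by auto
  then have "prob {\<omega>\<in>space M. card (\<eta> \<omega> \<inter> B) < N} \<le> (\<Sum>k<N. prob {\<omega>\<in>space M. card (\<eta> \<omega> \<inter> B) = k})"
    by (simp only:) (intro finite_measure_subadditive_finite, auto)
  also have "\<dots> \<le> (\<Sum>k<N. 2 ^ k * exp (- l / 2))"
  proof (intro sum_mono)
    fix k
    have "(l/2) ^ k / fact k \<le> exp (l/2)"
      by (rule power_div_fact_le_exp) (use l in simp)
    then have "2 ^ k * ((l/2) ^ k / fact k) \<le> 2 ^ k * exp (l/2)"
      by (intro mult_left_mono) auto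
    moreover have "2 ^ k * ((l/2) ^ k / fact k) = l ^ k / fact k"
      by (simp add: power_divide)
    ultimately have "l ^ k / fact k \<le> 2 ^ k * exp (l/2)"
      by simp
    then have "l ^ k / fact k * exp (- l) \<le> 2 ^ k * exp (l/2) * exp (- l)"
      by (intro mult_right_mono) auto
    also have "\<dots> = 2 ^ k * exp (- l / 2)"
    proof -
      have "exp (l/2) * exp (- l) = exp (- l / 2)" unfolding exp_add[symmetric] by simp
      then show ?thesis by (simp only: mult.assoc)
    qed
    finally show "prob {\<omega>\<in>space M. card (\<eta> \<omega> \<inter> B) = k} \<le> 2 ^ k * exp (- l / 2)"
      by (simp add: prob_card[OF B] l_def)
  qed
  also have "\<dots> = (2 ^ N - 1) * exp (- l / 2)"
  proof -
    have "(\<Sum>k<N. (2::real) ^ k) = 2 ^ N - 1" by (induction N) auto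
    then show ?thesis by (simp add: sum_distrib_right[symmetric])
  qed
  also have "\<dots> \<le> 2 ^ N * exp (- l / 2)" by simp
  finally show ?thesis by (simp add: l_def)
qed

section \<open>Moment measures on cells and general position\<close>

lemma emeasure_cell:
  assumes "C \<in> sets hyperplane_space" "A \<in> sets hyperplane_space"
  shows "emeasure (density \<Lambda> (indicator C)) A = emeasure \<Lambda> (C \<inter> A)"
  using assms by (subst emeasure_density) (auto simp: indicator_inter_arith[symmetric])

text \<open>Products and Fubini are applied to the intensity restricted to bounded cells, where it
  is finite.\<close>

lemma finite_measure_cell:
  assumes "C \<in> sets hyperplane_space" "C \<subseteq> hitting (cball 0 r)"
  shows "finite_measure (density \<Lambda> (indicator C))"
proof
  have "hyperplanes \<in> sets hyperplane_space"
    using sets.top[of hyperplane_space] by (simp only: space_hyperplane_space)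
  then have "emeasure (density \<Lambda> (indicator C)) hyperplanes = emeasure \<Lambda> (C \<inter> hyperplanes)"
    by (rule emeasure_cell[OF assms(1)])
  also have "\<dots> < \<infinity>" using assms(2) by (intro intensity_finite[of _ r]) blast
  finally show "emeasure (density \<Lambda> (indicator C)) (space (density \<Lambda> (indicator C))) \<noteq> \<infinity>"
    by (simp add: space_\<Lambda>)
qed

text \<open>On disjoint cells the counts are independent, so the moment measure of \<open>\<eta>\<close> on a product of
  disjoint cells is the product of the intensity measures.\<close>

lemma AE_no_tuple_in_cells:
  fixes C :: "nat \<Rightarrow> 'a set set"
  assumes C: "\<And>i. C i \<in> sets hyperplane_space" "\<And>i. C i \<subseteq> hitting (cball 0 r)"
    and disj: "disjoint_family_on C {..<n}" and I: "I \<subseteq> {..<n}"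
    and R: "R \<in> sets (Pi\<^sub>M I (\<lambda>_. hyperplane_space))"
    and null: "emeasure (Pi\<^sub>M I (\<lambda>i. density \<Lambda> (indicator (C i)))) R = 0"
  shows "AE \<omega> in M. (\<Pi>\<^sub>E i\<in>I. \<eta> \<omega> \<inter> C i) \<inter> R = {}"
proof -
  let ?H = "hyperplane_space :: 'a set measure"
  let ?P = "Pi\<^sub>M I (\<lambda>_. ?H)"
  have finI: "finite I" using I by (rule finite_subset) simp
  define D where "D i = density \<Lambda> (indicator (C i))" for i
  have sD: "sets (D i) = sets ?H" for i by (simp add: D_def)
  have eD: "emeasure (D i) A = emeasure \<Lambda> (C i \<inter> A)" if "A \<in> sets ?H" for i A
    unfolding D_def using C(1) that by (rule emeasure_cell)
  have fD: "finite_measure (D i)" for i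
    unfolding D_def using C by (rule finite_measure_cell)
  interpret D: product_sigma_finite D
    by (rule product_sigma_finite.intro) (rule finite_measure.axioms(1)[OF fD])
  define F where "F \<omega> = (\<Pi>\<^sub>E i\<in>I. \<eta> \<omega> \<inter> C i)" for \<omega>
  have finF: "finite (F \<omega>)" if "\<omega> \<in> space M" for \<omega>
    unfolding F_def using finite_counts[OF that C(2)] finI by (intro finite_PiE) auto
  have box: "(\<Pi>\<^sub>E i\<in>I. C i) \<in> sets ?P" using finI C(1) by (intro sets_PiM_I_finite) auto
  have [measurable]: "(\<lambda>\<omega>. card (F \<omega> \<inter> A)) \<in> M \<rightarrow>\<^sub>M count_space UNIV" if A: "A \<in> sets ?P" for A
  proof -
    have "random_finite_set M ?P (\<lambda>\<omega>. I \<rightarrow>\<^sub>E (\<eta> \<omega> \<inter> hitting (cball 0 r)))"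
      by (intro random_finite_set_PiE random_finite_set_hitting finI) simp
    moreover have "(\<Pi>\<^sub>E i\<in>I. C i) \<inter> A \<in> sets ?P" using box A by auto
    ultimately have "(\<lambda>\<omega>. card ((I \<rightarrow>\<^sub>E (\<eta> \<omega> \<inter> hitting (cball 0 r))) \<inter> ((\<Pi>\<^sub>E i\<in>I. C i) \<inter> A))) \<in> M \<rightarrow>\<^sub>M count_space UNIV"
      unfolding random_finite_set_def by blast
    moreover have "(I \<rightarrow>\<^sub>E (\<eta> \<omega> \<inter> hitting (cball 0 r))) \<inter> ((\<Pi>\<^sub>E i\<in>I. C i) \<inter> A) = F \<omega> \<inter> A" for \<omega>
    proof -
      have "(I \<rightarrow>\<^sub>E (\<eta> \<omega> \<inter> hitting (cball 0 r))) \<inter> (\<Pi>\<^sub>E i\<in>I. C i) = F \<omega>"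
        unfolding F_def PiE_Int by (rule PiE_cong) (use C(2) in blast)
      then show ?thesis by (simp only: Int_assoc[symmetric])
    qed
    ultimately show ?thesis by (simp only:)
  qed
  \<comment> \<open>The moment measure: the mean number of tuples of \<eta> in \<open>A\<close>,
    with entry \<open>i\<close> taken from cell \<open>C i\<close>. It is identified with the
    product by its values on boxes.\<close>
  define m where "m A = (\<integral>\<^sup>+\<omega>. emeasure (count_space UNIV) (F \<omega> \<inter> A) \<partial>M)" for A
  have count: "emeasure (count_space UNIV) (F \<omega> \<inter> A) = of_nat (card (F \<omega> \<inter> A))" if "\<omega> \<in> space M" for \<omega> A
    using finF[OF that] by (simp add: emeasure_count_space)
  have meas: "(\<lambda>\<omega>. emeasure (count_space UNIV) (F \<omega> \<inter> A)) \<in> borel_measurable M" if "A \<in> sets ?P" for A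
    by (subst measurable_cong[OF count]) (use that in measurable)
  define P where "P = measure_of (space ?P) (sets ?P) m"
  have sP: "sets P = sets ?P" by (simp add: P_def sets.sigma_sets_eq)
  have eP: "emeasure P A = m A" if A: "A \<in> sets ?P" for A
    unfolding P_def
  proof (rule emeasure_measure_of_sigma)
    show "sigma_algebra (space ?P) (sets ?P)" by (rule sets.sigma_algebra_axioms)
    show "positive (sets ?P) m" by (simp add: positive_def m_def)
    show "countably_additive (sets ?P) m"
    proof (rule countably_additiveI)
      fix A :: "nat \<Rightarrow> (nat \<Rightarrow> 'a set) set"
      assume A: "range A \<subseteq> sets ?P" "disjoint_family A"
      have "(\<Sum>i. m (A i)) = (\<integral>\<^sup>+\<omega>. (\<Sum>i. emeasure (count_space UNIV) (F \<omega> \<inter> A i)) \<partial>M)"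
        unfolding m_def using A(1) by (intro nn_integral_suminf[symmetric] meas) auto
      also have "\<dots> = m (\<Union>i. A i)"
        unfolding m_def
      proof (intro nn_integral_cong)
        fix \<omega>
        have "(\<Sum>i. emeasure (count_space UNIV) (F \<omega> \<inter> A i)) = emeasure (count_space UNIV) (\<Union>i. F \<omega> \<inter> A i)"
          using A(2) by (intro suminf_emeasure) (auto simp: disjoint_family_on_def)
        then show "(\<Sum>i. emeasure (count_space UNIV) (F \<omega> \<inter> A i)) = emeasure (count_space UNIV) (F \<omega> \<inter> (\<Union>i. A i))"
          by (simp only: Int_UN_distrib)
      qed
      finally show "(\<Sum>i. m (A i)) = m (\<Union>i. A i)" .
    qed
    show "A \<in> sets ?P" by fact
  qed
  have "P = Pi\<^sub>M I D"
  proof (rule D.PiM_eqI[OF finI])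
    show "sets P = sets (Pi\<^sub>M I D)"
      unfolding sP by (intro sets_PiM_cong refl) (simp add: sD)
    fix A assume "\<And>i. i \<in> I \<Longrightarrow> A i \<in> sets (D i)"
    then have A: "A i \<in> sets ?H" if "i \<in> I" for i using that by (simp add: sD)
    \<comment> \<open>Independence is given for index sets of the form \<open>{..<n}\<close>, so the
      family is padded with empty sets outside \<open>I\<close>.\<close>
    define B where "B i = (if i \<in> I then C i \<inter> A i else {})" for i
    have B: "B i \<in> sets ?H" "B i \<subseteq> hitting (cball 0 r)" for i
      using A[of i] C[of i] by (auto simp: B_def)
    have "disjoint_family_on B {..<n}"
      using disj unfolding disjoint_family_on_def B_def by (auto split: if_splits)
    then have "indep_vars (\<lambda>_. borel) (\<lambda>i \<omega>. emeasure (counting_measure hyperplane_space (\<eta> \<omega>)) (B i)) {..<n}"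
      using poisson B(1) unfolding poisson_process_def sets_\<Lambda> by blast
    then have ind: "indep_vars (\<lambda>_. borel) (\<lambda>i \<omega>. emeasure (counting_measure hyperplane_space (\<eta> \<omega>)) (B i)) I"
      using I by (rule indep_vars_subset)
    have "emeasure P (Pi\<^sub>E I A) = m (Pi\<^sub>E I A)"
      using A finI by (intro eP sets_PiM_I_finite) auto
    also have "\<dots> = (\<integral>\<^sup>+\<omega>. (\<Prod>i\<in>I. emeasure (counting_measure hyperplane_space (\<eta> \<omega>)) (B i)) \<partial>M)"
      unfolding m_def
    proof (intro nn_integral_cong)
      fix \<omega> assume w: "\<omega> \<in> space M"
      have "F \<omega> \<inter> Pi\<^sub>E I A = (\<Pi>\<^sub>E i\<in>I. \<eta> \<omega> \<inter> B i)"
        unfolding F_def PiE_Int B_def by (intro PiE_cong) auto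
      then have "emeasure (count_space UNIV) (F \<omega> \<inter> Pi\<^sub>E I A) = of_nat (card (\<Pi>\<^sub>E i\<in>I. \<eta> \<omega> \<inter> B i))"
        using count[OF w, of "Pi\<^sub>E I A"] by (simp only:)
      also have "\<dots> = (\<Prod>i\<in>I. of_nat (card (\<eta> \<omega> \<inter> B i)))"
        by (simp add: card_PiE[OF finI])
      also have "\<dots> = (\<Prod>i\<in>I. emeasure (counting_measure hyperplane_space (\<eta> \<omega>)) (B i))"
        using emeasure_counts_card[OF w B] by simp
      finally show "emeasure (count_space UNIV) (F \<omega> \<inter> Pi\<^sub>E I A) = \<dots>" .
    qed
    also have "\<dots> = (\<Prod>i\<in>I. (\<integral>\<^sup>+\<omega>. emeasure (counting_measure hyperplane_space (\<eta> \<omega>)) (B i) \<partial>M))"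
      by (rule indep_vars_nn_integral[OF finI ind]) simp
    also have "\<dots> = (\<Prod>i\<in>I. emeasure (D i) (A i))"
    proof (intro prod.cong refl)
      fix i assume i: "i \<in> I"
      have "(\<integral>\<^sup>+\<omega>. emeasure (counting_measure hyperplane_space (\<eta> \<omega>)) (B i) \<partial>M) =
          (\<integral>\<^sup>+\<omega>. of_nat (card (\<eta> \<omega> \<inter> B i)) \<partial>M)"
        by (intro nn_integral_cong emeasure_counts_card[OF _ B])
      also have "\<dots> = emeasure \<Lambda> (B i)" by (rule mean_card[OF B])
      also have "\<dots> = emeasure (D i) (A i)" using i A by (simp add: B_def eD)
      finally show "(\<integral>\<^sup>+\<omega>. emeasure (counting_measure hyperplane_space (\<eta> \<omega>)) (B i) \<partial>M) = emeasure (D i) (A i)" .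
    qed
    finally show "emeasure P (Pi\<^sub>E I A) = (\<Prod>i\<in>I. emeasure (D i) (A i))" .
  qed
  moreover have "D = (\<lambda>i. density \<Lambda> (indicator (C i)))" by (rule ext) (simp add: D_def)
  ultimately have "m R = 0" using null eP[OF R] by (simp only:)
  then have "AE \<omega> in M. emeasure (count_space UNIV) (F \<omega> \<inter> R) = 0"
    unfolding m_def by (subst (asm) nn_integral_0_iff_AE[OF meas[OF R]]) simp
  then show ?thesis
  proof (rule AE_mp, intro AE_I2 impI)
    fix \<omega> assume w: "\<omega> \<in> space M" and "emeasure (count_space UNIV) (F \<omega> \<inter> R) = 0"
    then show "(\<Pi>\<^sub>E i\<in>I. \<eta> \<omega> \<inter> C i) \<inter> R = {}"
      using finF[OF w] by (simp add: F_def[symmetric] emeasure_count_space)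
  qed
qed

text \<open>If the entries of \<open>h\<close> lie in cells \<open>c\<close> and \<open>H\<close> in
  a different cell \<open>b0\<close>, the moment measure is a product there. Integrating over
  \<open>H\<close> with the other hyperplanes fixed gives at most the intensity of the hyperplanes
  through the fixed point \<open>z h\<close>, which vanishes. Countably many levels, radii and cell
  patterns cover all cases.\<close>

lemma AE_general_position:
  fixes z :: "('i \<Rightarrow> 'a set) \<Rightarrow> 'a"
  assumes I: "finite I" and z: "z \<in> borel_measurable (Pi\<^sub>M I (\<lambda>_. hyperplane_space))"
  shows "AE \<omega> in M. \<forall>h\<in>I \<rightarrow>\<^sub>E \<eta> \<omega>. \<forall>H\<in>\<eta> \<omega> - h ` I. z h \<notin> H"
proof -
  let ?H = "hyperplane_space :: 'a set measure"
  obtain E where E: "separating ?H E" using separating_hyperplane_space by blast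
  define C where "C m R j = hitting (cball 0 (real R)) \<inter> (cell_index E m -` {j} \<inter> hyperplanes)" for m R j :: nat
  have C: "C m R j \<in> sets ?H" "C m R j \<subseteq> hitting (cball 0 (real R))" for m R j
    unfolding C_def
    using measurable_sets[OF measurable_cell_index[OF E], of "{j}" m] hitting_sets[of "cball (0::'a) (real R)"]
    by (auto simp: space_hyperplane_space)
  \<comment> \<open>Hyperplanes are indexed by cells and not by \<open>I\<close>: entries of
    \<open>h\<close> may repeat, and \<open>c\<close> sends equal entries to the same cell.\<close>
  define T where "T b0 c = {h\<in>space (Pi\<^sub>M (insert b0 (c ` I)) (\<lambda>_. ?H)). z (\<lambda>i\<in>I. h (c i)) \<in> h b0}"
    for b0 :: nat and c :: "'i \<Rightarrow> nat"
  have *: "AE \<omega> in M. (\<Pi>\<^sub>E j\<in>insert b0 (c ` I). \<eta> \<omega> \<inter> C m R j) \<inter> T b0 c = {}"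
    if c: "c \<in> I \<rightarrow>\<^sub>E {..<2^m}" and b0: "b0 < 2^m" "b0 \<notin> c ` I" for m R b0 c
  proof (rule AE_no_tuple_in_cells[OF C, where n="2^m"])
    let ?J = "insert b0 (c ` I)"
    let ?P = "Pi\<^sub>M ?J (\<lambda>_. ?H)"
    show "disjoint_family_on (C m R) {..<2^m}"
      by (auto simp: disjoint_family_on_def C_def)
    show "?J \<subseteq> {..<2^m}" using c b0 by auto
    have "(\<lambda>h. z (\<lambda>i\<in>I. h (c i))) \<in> borel_measurable ?P"
      using z by (rule measurable_compose[rotated])
        (intro measurable_restrict measurable_component_singleton, auto)
    moreover have "(\<lambda>h. h b0) \<in> ?P \<rightarrow>\<^sub>M ?H" by (rule measurable_component_singleton) simp
    ultimately have "Measurable.pred ?P (\<lambda>h. z (\<lambda>i\<in>I. h (c i)) \<in> h b0)"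
      by (rule measurable_mem_hyperplane)
    then show T: "T b0 c \<in> sets ?P" unfolding T_def pred_def .
    define D where "D i = density \<Lambda> (indicator (C m R i))" for i
    have sD: "sets (D i) = sets ?H" for i by (simp add: D_def)
    have eD: "emeasure (D i) A = emeasure \<Lambda> (C m R i \<inter> A)" if "A \<in> sets ?H" for i A
      unfolding D_def using C(1) that by (rule emeasure_cell)
    have fD: "finite_measure (D i)" for i
      unfolding D_def using C by (rule finite_measure_cell)
    interpret D: product_sigma_finite D
      by (rule product_sigma_finite.intro) (rule finite_measure.axioms(1)[OF fD])
    have sP: "sets (Pi\<^sub>M ?J D) = sets ?P" by (intro sets_PiM_cong refl) (simp add: sD)
    have "emeasure (Pi\<^sub>M ?J D) (T b0 c) = (\<integral>\<^sup>+h. indicator (T b0 c) h \<partial>Pi\<^sub>M ?J D)"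
      using T sP by simp
    also have "\<dots> = (\<integral>\<^sup>+h. (\<integral>\<^sup>+H. indicator (T b0 c) (h(b0 := H)) \<partial>D b0) \<partial>Pi\<^sub>M (c ` I) D)"
      using T sP I b0(2) by (intro D.product_nn_integral_insert borel_measurable_indicator) auto
    also have "\<dots> \<le> (\<integral>\<^sup>+h. 0 \<partial>Pi\<^sub>M (c ` I) D)"
    proof (intro nn_integral_mono)
      fix h
      let ?p = "z (\<lambda>i\<in>I. h (c i))"
      have "(\<integral>\<^sup>+H. indicator (T b0 c) (h(b0 := H)) \<partial>D b0) \<le> (\<integral>\<^sup>+H. indicator (hitting {?p}) H \<partial>D b0)"
      proof (intro nn_integral_mono)
        fix H
        have "H \<in> hitting {?p}" if "h(b0 := H) \<in> T b0 c"
        proof -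
          have "(\<lambda>i\<in>I. (h(b0 := H)) (c i)) = (\<lambda>i\<in>I. h (c i))" using b0(2) by (intro restrict_ext) auto
          moreover have "(h(b0 := H)) b0 \<in> hyperplanes"
            using that unfolding T_def space_PiM by (auto simp: PiE_iff space_hyperplane_space)
          ultimately show ?thesis using that by (auto simp: T_def hitting_def)
        qed
        then show "indicator (T b0 c) (h(b0 := H)) \<le> (indicator (hitting {?p}) H :: ennreal)"
          by (auto simp: indicator_def)
      qed
      also have "\<dots> = emeasure (D b0) (hitting {?p})"
        using hitting_sets[of "{?p}"] sD by simp
      also have "\<dots> = emeasure \<Lambda> (C m R b0 \<inter> hitting {?p})"
        by (intro eD hitting_sets) simp
      also have "\<dots> \<le> emeasure \<Lambda> (hitting {?p})"
        by (intro emeasure_mono) (auto simp: hitting_sets)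
      finally show "(\<integral>\<^sup>+H. indicator (T b0 c) (h(b0 := H)) \<partial>D b0) \<le> 0"
        by (simp add: intensity_point)
    qed
    finally have "emeasure (Pi\<^sub>M ?J D) (T b0 c) = 0" by simp
    moreover have "D = (\<lambda>i. density \<Lambda> (indicator (C m R i)))" by (rule ext) (simp add: D_def)
    ultimately show "emeasure (Pi\<^sub>M ?J (\<lambda>i. density \<Lambda> (indicator (C m R i)))) (T b0 c) = 0"
      by (simp only:)
  qed
  have "AE \<omega> in M. \<forall>m R. \<forall>b0\<in>{..<2^m}. \<forall>c\<in>I \<rightarrow>\<^sub>E {..<2^m}. b0 \<notin> c ` I \<longrightarrow>
      (\<Pi>\<^sub>E j\<in>insert b0 (c ` I). \<eta> \<omega> \<inter> C m R j) \<inter> T b0 c = {}"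
    unfolding AE_all_countable
    using * I by (intro allI AE_finite_allI finite_PiE) auto
  then show ?thesis
  proof (rule AE_mp, intro AE_I2 impI ballI notI)
    fix \<omega> h H
    assume w: "\<omega> \<in> space M" and h: "h \<in> I \<rightarrow>\<^sub>E \<eta> \<omega>" and H: "H \<in> \<eta> \<omega> - h ` I" and zH: "z h \<in> H"
      and cells: "\<forall>m R. \<forall>b0\<in>{..<2^m}. \<forall>c\<in>I \<rightarrow>\<^sub>E {..<2^m}. b0 \<notin> c ` I \<longrightarrow>
        (\<Pi>\<^sub>E j\<in>insert b0 (c ` I). \<eta> \<omega> \<inter> C m R j) \<inter> T b0 c = {}"
    define S where "S = insert H (h ` I)"
    have S: "finite S" "S \<subseteq> \<eta> \<omega>" using I h H by (auto simp: S_def)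
    then have Sh: "S \<subseteq> hyperplanes" using subset_hyperplanes[OF w] by blast
    \<comment> \<open>A level that separates \<open>H\<close> and all different entries of
      \<open>h\<close>; below, \<open>R\<close> is the radius of a ball hit by all of them.\<close>
    obtain m where inj: "inj_on (cell_index E m) S"
      using cell_index_inj_on[OF E S(1)] Sh by (auto simp: space_hyperplane_space)
    have "\<forall>G\<in>S. \<exists>y. y \<in> G"
    proof
      fix G assume "G \<in> S"
      then obtain u s where "norm u = 1" "G = hyperplane u s" using Sh by (auto simp: hyperplanes_def)
      then have "s *\<^sub>R u \<in> G" by (simp add: hyperplane_def dot_square_norm)
      then show "\<exists>y. y \<in> G" by blast
    qed
    then obtain y where y: "\<And>G. G \<in> S \<Longrightarrow> y G \<in> G" by metis
    obtain R where R: "Max (insert 0 (norm ` y ` S)) \<le> real R" using real_arch_simple by blast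
    have hit: "G \<in> hitting (cball 0 (real R))" if "G \<in> S" for G
    proof -
      have "norm (y G) \<le> real R" using R S(1) that by auto
      then show ?thesis using y[OF that] that Sh by (auto simp: hitting_def)
    qed
    define b0 where "b0 = cell_index E m H"
    define c where "c = (\<lambda>i\<in>I. cell_index E m (h i))"
    define g where "g = (\<lambda>j\<in>insert b0 (c ` I). inv_into S (cell_index E m) j)"
    have cI: "c ` I = cell_index E m ` (h ` I)" by (auto simp: c_def image_iff)
    have b0: "b0 < 2^m" "b0 \<notin> c ` I"
      unfolding cI b0_def using cell_index_less[of E m H] H inj_onD[OF inj] by (auto simp: S_def)
    have c: "c \<in> I \<rightarrow>\<^sub>E {..<2^m}" by (auto simp: c_def cell_index_less)
    have gG: "g (cell_index E m G) = G" if "G \<in> S" for G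
    proof -
      have "cell_index E m G \<in> insert b0 (c ` I)" using that unfolding cI b0_def S_def by auto
      then show ?thesis using that inj by (simp add: g_def)
    qed
    have g: "g \<in> (\<Pi>\<^sub>E j\<in>insert b0 (c ` I). \<eta> \<omega> \<inter> C m R j)"
    proof (rule PiE_I)
      fix j assume "j \<in> insert b0 (c ` I)"
      then have "j \<in> cell_index E m ` S" unfolding cI b0_def S_def by auto
      then obtain G where G: "G \<in> S" "j = cell_index E m G" by blast
      then have "g j = G" using gG by simp
      then show "g j \<in> \<eta> \<omega> \<inter> C m R j"
        using G S(2) Sh hit by (auto simp: C_def)
    qed (simp add: g_def)
    moreover from g have "g \<in> T b0 c"
    proof -
      have "(\<lambda>i\<in>I. g (c i)) = h"
      proof
        fix i show "(\<lambda>i\<in>I. g (c i)) i = h i"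
          using gG[of "h i"] PiE_arb[OF h, of i] by (cases "i \<in> I") (simp_all add: c_def S_def)
      qed
      moreover have "g b0 = H" unfolding b0_def by (rule gG) (simp add: S_def)
      moreover have "g \<in> space (Pi\<^sub>M (insert b0 (c ` I)) (\<lambda>_. ?H))"
      proof -
        have "(\<Pi>\<^sub>E j\<in>insert b0 (c ` I). \<eta> \<omega> \<inter> C m R j) \<subseteq> (\<Pi>\<^sub>E j\<in>insert b0 (c ` I). space ?H)"
          by (rule PiE_mono) (use subset_hyperplanes[OF w] in \<open>auto simp: space_hyperplane_space\<close>)
        then show ?thesis unfolding space_PiM using g by blast
      qed
      ultimately show ?thesis using zH by (simp add: T_def)
    qed
    ultimately show False using cells b0 c by blast
  qed
qed

end

section \<open>Hyperplanes meeting in a single point\<close>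

lemma hyperplanesE:
  assumes "H \<in> hyperplanes"
  obtains u s where "norm u = 1" "H = hyperplane u s"
  using assms by (auto simp: hyperplanes_def)

lemma normals_span:
  fixes n :: "'l \<Rightarrow> 'a::euclidean_space"
  assumes L: "finite L" and orth: "\<And>a. (\<And>l. l \<in> L \<Longrightarrow> a \<bullet> n l = 0) \<Longrightarrow> a = 0"
  shows "span (n ` L) = UNIV"
proof (rule ccontr)
  assume "span (n ` L) \<noteq> UNIV"
  then obtain a where a: "a \<noteq> 0" "\<forall>x\<in>span (n ` L). a \<bullet> x = 0"
    using span_not_UNIV_orthogonal by blast
  then have "a \<bullet> n l = 0" if "l \<in> L" for l
    using that by (auto intro: span_base)
  then show False using orth a(1) by blast
qed

text \<open>Coefficients are attached to indices instead of vectors, so that they remain meaningful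
  if \<open>n\<close> repeats a value.\<close>

lemma normals_combination:
  fixes n :: "'l \<Rightarrow> 'a::euclidean_space"
  assumes L: "finite L" and orth: "\<And>a. (\<And>l. l \<in> L \<Longrightarrow> a \<bullet> n l = 0) \<Longrightarrow> a = 0"
  shows "\<exists>c. g = (\<Sum>l\<in>L. c l *\<^sub>R n l)"
proof -
  define V where "V = {y. \<exists>c. y = (\<Sum>l\<in>L. c l *\<^sub>R n l)}"
  have "subspace V"
    unfolding subspace_def
  proof (intro conjI ballI allI)
    show "0 \<in> V" unfolding V_def by (auto intro!: exI[of _ "\<lambda>_. 0"])
    fix x y assume "x \<in> V" "y \<in> V"
    then obtain c c' where "x = (\<Sum>l\<in>L. c l *\<^sub>R n l)" "y = (\<Sum>l\<in>L. c' l *\<^sub>R n l)"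
      unfolding V_def by blast
    then have "x + y = (\<Sum>l\<in>L. (c l + c' l) *\<^sub>R n l)"
      by (simp add: scaleR_add_left sum.distrib)
    then show "x + y \<in> V" unfolding V_def mem_Collect_eq by (rule exI[of _ "\<lambda>l. c l + c' l"])
  next
    fix x and a :: real assume "x \<in> V"
    then obtain c where "x = (\<Sum>l\<in>L. c l *\<^sub>R n l)" unfolding V_def by blast
    then have "a *\<^sub>R x = (\<Sum>l\<in>L. (a * c l) *\<^sub>R n l)" by (simp add: scaleR_sum_right)
    then show "a *\<^sub>R x \<in> V" unfolding V_def mem_Collect_eq by (rule exI[of _ "\<lambda>l. a * c l"])
  qed
  moreover have "n ` L \<subseteq> V"
  proof
    fix y assume "y \<in> n ` L"
    then obtain l where l: "l \<in> L" "y = n l" by blast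
    have "(\<Sum>l'\<in>L. (if l' = l then 1 else 0) *\<^sub>R n l') = (\<Sum>l'\<in>L. if l' = l then n l' else 0)"
      by (intro sum.cong) auto
    also have "\<dots> = n l" using L l(1) by simp
    finally have "y = (\<Sum>l'\<in>L. (if l' = l then 1 else 0) *\<^sub>R n l')" by (simp add: l(2))
    then show "y \<in> V" unfolding V_def mem_Collect_eq by (rule exI[of _ "\<lambda>l'. if l' = l then 1 else 0"])
  qed
  ultimately have "span (n ` L) \<subseteq> V" by (rule span_minimal[rotated])
  then have "g \<in> V" using normals_span[OF L orth] by blast
  then show ?thesis unfolding V_def by blast
qed

text \<open>The translate \<open>x + a\<close> lies on the same hyperplanes.\<close>

lemma point_normals_orthogonal:
  assumes x: "(\<Inter>l\<in>L. hyperplane (n l) (s l)) = {x}" and a: "\<And>l. l \<in> L \<Longrightarrow> a \<bullet> n l = 0"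
  shows "a = 0"
proof -
  have "x \<in> (\<Inter>l\<in>L. hyperplane (n l) (s l))" using x by simp
  then have "x + a \<in> (\<Inter>l\<in>L. hyperplane (n l) (s l))"
    using a by (auto simp: hyperplane_def inner_add_left)
  then show ?thesis using x by simp
qed

lemma point_card_ge_DIM:
  fixes f :: "'l \<Rightarrow> 'a::euclidean_space set"
  assumes L: "finite L" and f: "\<And>l. l \<in> L \<Longrightarrow> f l \<in> hyperplanes" and x: "(\<Inter>l\<in>L. f l) = {x}"
  shows "DIM('a) \<le> card L"
proof -
  have "\<forall>l\<in>L. \<exists>u s. f l = hyperplane u s" using f unfolding hyperplanes_def by blast
  then obtain n s where ns: "\<And>l. l \<in> L \<Longrightarrow> f l = hyperplane (n l) (s l)" by metis
  have "(\<Inter>l\<in>L. hyperplane (n l) (s l)) = {x}" using x ns by simp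
  note x' = this
  have "span (n ` L) = UNIV"
  proof (rule normals_span[OF L])
    fix a assume "\<And>l. l \<in> L \<Longrightarrow> a \<bullet> n l = 0"
    then show "a = 0" by (rule point_normals_orthogonal[OF x'])
  qed
  then have "DIM('a) \<le> card (n ` L)"
    using dim_le_card[of "UNIV :: 'a set" "n ` L"] L by simp
  also have "\<dots> \<le> card L" using L by (rule card_image_le)
  finally show ?thesis .
qed

text \<open>Dropping a repeated hyperplane would leave the intersection unchanged, but fewer than d
  hyperplanes never meet in a single point.\<close>

lemma point_inj_on:
  fixes f :: "'l \<Rightarrow> 'a::euclidean_space set"
  assumes L: "finite L" "card L = DIM('a)" and f: "\<And>l. l \<in> L \<Longrightarrow> f l \<in> hyperplanes"
    and x: "(\<Inter>l\<in>L. f l) = {x}"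
  shows "inj_on f L"
proof (rule inj_onI, rule ccontr)
  fix a b assume ab: "a \<in> L" "b \<in> L" "f a = f b" "a \<noteq> b"
  have "(\<Inter>l\<in>L - {a}. f l) = (\<Inter>l\<in>L. f l)"
  proof (intro equalityI subsetI INT_I)
    fix y l assume y: "y \<in> (\<Inter>l\<in>L - {a}. f l)" and l: "l \<in> L"
    have "y \<in> f b" using y ab by blast
    then show "y \<in> f l" using y l ab(3) by (cases "l = a") auto
  qed auto
  then have "DIM('a) \<le> card (L - {a})" using f x L(1) by (intro point_card_ge_DIM[of _ f x]) auto
  then show False using ab(1) L by (metis DIM_positive card_Diff1_less not_le)
qed

text \<open>Steinitz exchange: the normal of \<open>H\<close> is a combination of the given normals,
  and any index with nonzero coefficient can be replaced.\<close>

lemma exchange_hyperplane: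
  fixes f :: "'l \<Rightarrow> 'a::euclidean_space set"
  assumes L: "finite L" and f: "\<And>l. l \<in> L \<Longrightarrow> f l \<in> hyperplanes" and y: "(\<Inter>l\<in>L. f l) = {y}"
    and H: "H \<in> hyperplanes" "y \<in> H"
  shows "\<exists>e\<in>L. (\<Inter>l\<in>L. if l = e then H else f l) = {y}"
proof -
  have "\<forall>l\<in>L. \<exists>u s. f l = hyperplane u s" using f unfolding hyperplanes_def by blast
  then obtain n s where ns: "\<And>l. l \<in> L \<Longrightarrow> f l = hyperplane (n l) (s l)" by metis
  have y': "(\<Inter>l\<in>L. hyperplane (n l) (s l)) = {y}" using y ns by simp
  obtain w t where w: "norm w = 1" "H = hyperplane w t" using H by (auto elim: hyperplanesE)
  obtain c where c: "w = (\<Sum>l\<in>L. c l *\<^sub>R n l)"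
    using normals_combination[OF L point_normals_orthogonal[OF y']] by blast
  have "\<exists>e\<in>L. c e \<noteq> 0"
  proof (rule ccontr)
    assume "\<not> ?thesis"
    then have "w = 0" unfolding c by (intro sum.neutral) auto
    then show False using w(1) by simp
  qed
  then obtain e where e: "e \<in> L" "c e \<noteq> 0" by blast
  have "x = y" if x: "x \<in> (\<Inter>l\<in>L. if l = e then H else f l)" for x
  proof -
    have yl: "y \<bullet> n l = s l" if "l \<in> L" for l using y' that by (auto simp: hyperplane_def)
    have xl: "x \<bullet> n l = s l" if "l \<in> L" "l \<noteq> e" for l
    proof -
      have "x \<in> f l" using x that by (auto split: if_splits)
      then show ?thesis using ns[OF that(1)] by (simp add: hyperplane_def)
    qed
    have "x \<in> H" using x e(1) by (auto split: if_splits)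
    then have "(x - y) \<bullet> w = 0" using H(2) w(2) by (simp add: hyperplane_def inner_diff_left)
    also have "(x - y) \<bullet> w = (\<Sum>l\<in>L. c l * ((x - y) \<bullet> n l))" by (simp add: c inner_sum_right)
    also have "\<dots> = (\<Sum>l\<in>L. if l = e then c e * ((x - y) \<bullet> n e) else 0)"
      using xl yl by (intro sum.cong) (auto simp: inner_diff_left)
    also have "\<dots> = c e * ((x - y) \<bullet> n e)" using L e(1) by simp
    finally have "(x - y) \<bullet> n e = 0" using e(2) by simp
    then have "x \<bullet> n e = s e" using yl[OF e(1)] by (simp add: inner_diff_left)
    then have "x \<in> (\<Inter>l\<in>L. hyperplane (n l) (s l))" using xl by (auto simp: hyperplane_def)
    then show ?thesis using y' by simp
  qed
  moreover have "y \<in> (\<Inter>l\<in>L. if l = e then H else f l)" using y H(2) by auto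
  ultimately show ?thesis using e(1) by blast
qed

lemma affine_in_hyperplanes: "H \<in> hyperplanes \<Longrightarrow> affine (H :: 'a::euclidean_space set)"
  by (auto simp: hyperplanes_def hyperplane_def inner_commute affine_hyperplane)

text \<open>An affine basis of \<open>X\<close> lies in a hyperplane and so has at most d elements.
  Hyperplanes are affine, so one through the basis contains \<open>X\<close>, and uniqueness passes
  to the basis.\<close>

lemma spanning_points:
  fixes X :: "'a::euclidean_space set"
  assumes H: "H \<in> hyperplanes" "X \<subseteq> H" and ne: "X \<noteq> {}"
    and uniq: "\<And>G. G \<in> hyperplanes \<Longrightarrow> X \<subseteq> G \<Longrightarrow> G = H"
  shows "\<exists>p. (\<forall>i<DIM('a). p i \<in> X) \<and> spans_hyperplane {..<DIM('a)} p \<and> incident {..<DIM('a)} p H"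
proof -
  obtain B where B: "B \<subseteq> X" "\<not> affine_dependent B" "affine hull X = affine hull B"
    using affine_basis_exists[of X] by blast
  obtain u s where us: "norm u = 1" "H = hyperplane u s" using H(1) by (rule hyperplanesE)
  have "aff_dim B \<le> aff_dim H" using B(1) H(2) by (intro aff_dim_subset) auto
  also have "aff_dim H = int (DIM('a)) - 1"
  proof -
    have "u \<noteq> 0" using us(1) by auto
    then show ?thesis unfolding us(2) hyperplane_def
      using aff_dim_hyperplane[of u s] by (simp add: inner_commute)
  qed
  finally have "aff_dim B \<le> int (DIM('a)) - 1" .
  moreover have "aff_dim B = int (card B) - 1" using aff_dim_affine_independent[OF B(2)] by simp
  ultimately have card: "card B \<le> DIM('a)" by simp
  have fin: "finite B" using B(2) by (rule aff_independent_finite)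
  have "B \<noteq> {}" using B(3) ne by auto
  obtain h where h: "bij_betw h {..<card B} B"
    using ex_bij_betw_nat_finite[OF fin] by (auto simp: atLeast0LessThan)
  \<comment> \<open>If the basis has fewer than d elements, one of them is repeated.\<close>
  define p where "p i = (if i < card B then h i else (SOME b. b \<in> B))" for i
  have pB: "p i \<in> B" for i
    using bij_betwE[OF h] some_in_eq[of B] \<open>B \<noteq> {}\<close> by (simp add: p_def)
  have inc: "incident {..<DIM('a)} p H"
    using pB B(1) H by (auto simp: incident_def)
  have "G = H" if G: "incident {..<DIM('a)} p G" for G
  proof -
    have "B \<subseteq> G"
    proof
      fix b assume "b \<in> B"
      then obtain i where "i < card B" "b = h i" using h by (auto simp: bij_betw_def)
      then show "b \<in> G" using G card by (auto simp: incident_def p_def dest: bspec[of _ _ i])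
    qed
    then have "affine hull B \<subseteq> G"
      using G by (intro hull_minimal affine_in_hyperplanes) (auto simp: incident_def)
    then have "X \<subseteq> G" using hull_subset[of X affine] B(3) by blast
    then show ?thesis using uniq G by (simp add: incident_def)
  qed
  then have "spans_hyperplane {..<DIM('a)} p"
    unfolding spans_hyperplane_def using inc by blast
  then show ?thesis using pB B(1) inc by blast
qed

text \<open>A certificate concerns its own k points only, so further points of \<open>T\<close>
  cannot spoil it. This carries certificates in an annulus over to all of \<Phi>.\<close>

lemma certified_mono: "S \<subseteq> T \<Longrightarrow> certified k q S \<subseteq> certified k q T"
  unfolding certified_def
proof (intro Collect_mono impI, elim conjE bexE, intro conjI bexI)
  fix x assume "S \<subseteq> T" "x \<in> {..<k} \<rightarrow>\<^sub>E S"
  then show "x \<in> {..<k} \<rightarrow>\<^sub>E T" using PiE_mono[of "{..<k}" "\<lambda>_. S" "\<lambda>_. T"] by blast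
qed auto

section \<open>Certified hyperplanes belong to the process\<close>

text \<open>Rows \<open>0, \<dots>, d - 1\<close> of the array \<open>h\<close> are points spanning a hyperplane; this hyperplane
  replaces the entry \<open>e\<close> of the last row.\<close>

definition exchange_point :: "nat \<Rightarrow> (nat \<times> nat \<Rightarrow> 'a::euclidean_space set) \<Rightarrow> 'a" where
  "exchange_point e h = meeting_point {..<DIM('a)} (\<lambda>i. if i = e
     then spanned_hyperplane {..<DIM('a)} (\<lambda>j. meeting_point {..<DIM('a)} (\<lambda>l. h (j, l)))
     else h (DIM('a), i))"

text \<open>There are d + 1 rows of length d. The entry \<open>(d, e)\<close> is left out because it
  is the hyperplane on which the exchange point must not lie by general position.\<close>

definition exchange_index :: "nat \<Rightarrow> nat \<Rightarrow> (nat \<times> nat) set" where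
  "exchange_index d e = {..d} \<times> {..<d} - {(d, e)}"

lemma measurable_exchange_point:
  "exchange_point e \<in> borel_measurable
     (Pi\<^sub>M (exchange_index DIM('a) e) (\<lambda>_. hyperplane_space :: 'a::euclidean_space set measure))"
  (is "_ \<in> borel_measurable ?P")
proof -
  have comp: "(\<lambda>h. h i) \<in> ?P \<rightarrow>\<^sub>M hyperplane_space" if "i \<in> exchange_index DIM('a) e" for i
    using that by (rule measurable_component_singleton)
  have pts: "(\<lambda>h. meeting_point {..<DIM('a)} (\<lambda>l. h (j, l) :: 'a set)) \<in> borel_measurable ?P" if "j < DIM('a)" for j
    using that by (intro measurable_meeting_point comp) (auto simp: exchange_index_def)
  show ?thesis
    unfolding exchange_point_def[abs_def]
  proof (rule measurable_meeting_point)
    fix i assume "i \<in> {..<DIM('a)}"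
    show "(\<lambda>h. if i = e then spanned_hyperplane {..<DIM('a)} (\<lambda>j. meeting_point {..<DIM('a)} (\<lambda>l. h (j, l)))
        else h (DIM('a), i)) \<in> ?P \<rightarrow>\<^sub>M hyperplane_space"
    proof (cases "i = e")
      case True
      then show ?thesis using pts by (simp, intro measurable_spanned_hyperplane) auto
    next
      case False
      then show ?thesis
        using comp[of "(DIM('a), i)"] \<open>i \<in> {..<DIM('a)}\<close> by (simp add: exchange_index_def)
    qed
  qed simp
qed

text \<open>If \<open>H\<close> were not in \<open>S\<close>, the at most \<open>d\<^sup>2\<close> hyperplanes through \<open>d\<close> spanning points would not
  cover all \<open>k\<close> points; a point off them can be computed after exchanging one of its hyperplanes
  for \<open>H\<close>, and still lies on the exchanged one.\<close>

lemma certified_subset: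
  fixes S :: "'a::euclidean_space set set"
  assumes S: "S \<subseteq> hyperplanes" and k: "k > 0"
    and gp: "\<And>e h H. e < DIM('a) \<Longrightarrow> h \<in> exchange_index DIM('a) e \<rightarrow>\<^sub>E S \<Longrightarrow>
      H \<in> S - h ` exchange_index DIM('a) e \<Longrightarrow> exchange_point e h \<notin> H"
  shows "certified k (DIM('a) * DIM('a)) (intersection_points S) \<subseteq> S"
proof (rule subsetI, rule ccontr)
  let ?d = "DIM('a)"
  let ?q = "?d * ?d"
  fix H assume "H \<in> certified k ?q (intersection_points S)" and HS: "H \<notin> S"
  then obtain x where H: "H \<in> hyperplanes" and x: "\<And>j. j < k \<Longrightarrow> x j \<in> intersection_points S" "\<And>j. j < k \<Longrightarrow> x j \<in> H"
    and few: "\<And>G. G \<in> hyperplanes \<Longrightarrow> G \<noteq> H \<Longrightarrow> ?q * card {j\<in>{..<k}. x j \<in> G} < k"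
  proof -
    from \<open>H \<in> certified k ?q (intersection_points S)\<close> obtain x where "H \<in> hyperplanes"
      and x: "x \<in> {..<k} \<rightarrow>\<^sub>E intersection_points S" "\<forall>j<k. x j \<in> H"
        "\<forall>G\<in>hyperplanes. G \<noteq> H \<longrightarrow> ?q * card {j\<in>{..<k}. x j \<in> G} < k"
      unfolding certified_def by blast
    moreover have "x j \<in> intersection_points S" if "j < k" for j
      using x(1) that by auto
    ultimately show ?thesis by (intro that[of x]) auto
  qed
  have "\<exists>p. (\<forall>i<?d. p i \<in> x ` {..<k}) \<and> spans_hyperplane {..<?d} p \<and> incident {..<?d} p H"
  proof (rule spanning_points[OF H])
    show "x ` {..<k} \<subseteq> H" "x ` {..<k} \<noteq> {}" using x(2) k by auto
    fix G assume G: "G \<in> hyperplanes" "x ` {..<k} \<subseteq> G"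
    then have "{j\<in>{..<k}. x j \<in> G} = {..<k}" by auto
    then have "\<not> ?q * card {j\<in>{..<k}. x j \<in> G} < k" by simp
    then show "G = H" using few[OF G(1)] by blast
  qed
  then obtain p where p: "\<And>i. i < ?d \<Longrightarrow> p i \<in> x ` {..<k}"
    and sp: "spans_hyperplane {..<?d} p" "incident {..<?d} p H" by blast
  have "\<forall>i<?d. \<exists>g. (\<forall>l<?d. g l \<in> S) \<and> (\<Inter>l<?d. g l) = {p i}"
  proof (intro allI impI)
    fix i assume "i < ?d"
    then have "p i \<in> intersection_points S" using p[of i] x(1) by auto
    then show "\<exists>g. (\<forall>l<?d. g l \<in> S) \<and> (\<Inter>l<?d. g l) = {p i}"
      unfolding intersection_points_def by (auto intro: exI[of _ "_ :: nat \<Rightarrow> 'a set"])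
  qed
  then obtain g where g: "\<And>i l. i < ?d \<Longrightarrow> l < ?d \<Longrightarrow> g i l \<in> S" "\<And>i. i < ?d \<Longrightarrow> (\<Inter>l<?d. g i l) = {p i}"
    by metis
  define I where "I = (\<lambda>(i, l). g i l) ` ({..<?d} \<times> {..<?d})"
  have I: "finite I" "I \<subseteq> S" "card I \<le> ?q"
    using g(1) card_image_le[of "{..<?d} \<times> {..<?d}" "\<lambda>(i, l). g i l"] by (auto simp: I_def)
  \<comment> \<open>Each \<open>G\<close> in \<open>I\<close> differs from \<open>H\<close>, which
    is not in \<open>S\<close>, and so carries fewer than k / d^2 of the points; at most d^2 such
    hyperplanes cannot cover all k.\<close>
  have "\<exists>j<k. \<forall>G\<in>I. x j \<notin> G"
  proof (rule ccontr)
    assume "\<not> ?thesis"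
    then have "{..<k} \<subseteq> (\<Union>G\<in>I. {j\<in>{..<k}. x j \<in> G})" by auto
    then have "k \<le> card (\<Union>G\<in>I. {j\<in>{..<k}. x j \<in> G})"
      using card_mono[of "\<Union>G\<in>I. {j\<in>{..<k}. x j \<in> G}" "{..<k}"] I(1) by simp
    also have "\<dots> \<le> (\<Sum>G\<in>I. card {j\<in>{..<k}. x j \<in> G})" using I(1) by (rule card_UN_le)
    finally have "?q * k \<le> (\<Sum>G\<in>I. ?q * card {j\<in>{..<k}. x j \<in> G})"
      unfolding sum_distrib_left[symmetric] by (rule mult_le_mono2)
    also have "\<dots> \<le> (\<Sum>G\<in>I. k - 1)"
    proof (rule sum_mono)
      fix G assume "G \<in> I"
      then have "G \<in> hyperplanes" "G \<noteq> H" using I(2) S HS by auto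
      from few[OF this] show "?q * card {j\<in>{..<k}. x j \<in> G} \<le> k - 1" by simp
    qed
    also have "\<dots> \<le> ?q * (k - 1)" using I(3) by simp
    also have "\<dots> < ?q * k" using k by simp
    finally show False by simp
  qed
  then obtain j where j: "j < k" "\<And>G. G \<in> I \<Longrightarrow> x j \<notin> G" by blast
  obtain f where f: "\<And>l. l < ?d \<Longrightarrow> f l \<in> S" "(\<Inter>l\<in>{..<?d}. f l) = {x j}"
    using x(1)[OF j(1)] unfolding intersection_points_def by auto
  have fh: "f l \<in> hyperplanes" if "l \<in> {..<?d}" for l using f(1) S that by auto
  obtain e where e: "e \<in> {..<?d}" "(\<Inter>l\<in>{..<?d}. if l = e then H else f l) = {x j}"
    using exchange_hyperplane[OF _ fh f(2) H x(2)[OF j(1)]] by auto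
  define h where "h = (\<lambda>(i, l)\<in>exchange_index ?d e. if i = ?d then f l else g i l)"
  have hS: "h \<in> exchange_index ?d e \<rightarrow>\<^sub>E S"
  proof (rule PiE_I)
    fix y assume "y \<in> exchange_index ?d e"
    moreover obtain i l where "y = (i, l)" by (cases y)
    ultimately show "h y \<in> S"
      using g(1)[of i l] f(1)[of l] by (auto simp: h_def exchange_index_def le_less)
  qed (simp add: h_def)
  \<comment> \<open>\<open>f e\<close> passes through \<open>x j\<close>, which avoids all of
    \<open>I\<close>, and the tuple \<open>f\<close> is injective. So \<open>f e\<close> is none of
    the entries from which \<open>x j\<close> is recomputed.\<close>
  have "f e \<notin> h ` exchange_index ?d e"
  proof
    assume "f e \<in> h ` exchange_index ?d e"
    then obtain i l where il: "(i, l) \<in> exchange_index ?d e" "f e = h (i, l)" by auto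
    have xe: "x j \<in> f e" using f(2) e(1) by auto
    show False
    proof (cases "i = ?d")
      case True
      then have "f e = f l" "l \<noteq> e" "l < ?d" using il by (auto simp: h_def exchange_index_def)
      moreover have "inj_on f {..<?d}" by (rule point_inj_on[OF _ _ fh f(2)]) auto
      ultimately show False using e(1) by (auto dest: inj_onD)
    next
      case False
      then have "f e \<in> I" using il by (auto simp: h_def exchange_index_def I_def)
      then show False using j(2) xe by blast
    qed
  qed
  then have "f e \<in> S - h ` exchange_index ?d e" using f(1) e(1) by auto
  from gp[OF _ hS this] have "exchange_point e h \<notin> f e" using e(1) by simp
  moreover have "exchange_point e h = x j"
  proof -
    have "meeting_point {..<?d} (\<lambda>l. h (i, l)) = p i" if i: "i \<in> {..<?d}" for i
    proof -
      have "(\<Inter>l\<in>{..<?d}. h (i, l)) = {p i}"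
        using g(2)[of i] i by (simp add: h_def exchange_index_def)
      then show ?thesis using meeting_point_eq by blast
    qed
    then have inc: "incident {..<?d} (\<lambda>i. meeting_point {..<?d} (\<lambda>l. h (i, l))) G \<longleftrightarrow> incident {..<?d} p G" for G
      by (simp add: incident_def)
    have "spanned_hyperplane {..<?d} (\<lambda>i. meeting_point {..<?d} (\<lambda>l. h (i, l))) = H"
      using sp by (intro spanned_hyperplane_eq) (simp_all add: spans_hyperplane_def inc)
    then have "exchange_point e h = meeting_point {..<?d} (\<lambda>l. if l = e then H else f l)"
      unfolding exchange_point_def by (intro meeting_point_cong) (auto simp: h_def exchange_index_def)
    also have "\<dots> = x j" using meeting_point_eq[OF e(2)] by blast
    finally show ?thesis .
  qed
  moreover have "x j \<in> f e" using f(2) e(1) by auto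
  ultimately show False by simp
qed

lemma (in poisson_hyperplanes) AE_certified_subset:
  assumes "k > 0"
  shows "AE \<omega> in M. certified k (DIM('a) * DIM('a)) (intersection_points (\<eta> \<omega>)) \<subseteq> \<eta> \<omega>"
proof -
  have "AE \<omega> in M. \<forall>e\<in>{..<DIM('a)}. \<forall>h\<in>exchange_index DIM('a) e \<rightarrow>\<^sub>E \<eta> \<omega>.
      \<forall>H\<in>\<eta> \<omega> - h ` exchange_index DIM('a) e. exchange_point e h \<notin> H"
    by (intro AE_finite_allI AE_general_position measurable_exchange_point) (auto simp: exchange_index_def)
  then show ?thesis
  proof (rule AE_mp, intro AE_I2 impI)
    fix \<omega> assume w: "\<omega> \<in> space M" and gp: "\<forall>e\<in>{..<DIM('a)}. \<forall>h\<in>exchange_index DIM('a) e \<rightarrow>\<^sub>E \<eta> \<omega>.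
      \<forall>H\<in>\<eta> \<omega> - h ` exchange_index DIM('a) e. exchange_point e h \<notin> H"
    show "certified k (DIM('a) * DIM('a)) (intersection_points (\<eta> \<omega>)) \<subseteq> \<eta> \<omega>"
      by (rule certified_subset[OF subset_hyperplanes[OF w] assms]) (use gp in blast)
  qed
qed

section \<open>Grids certify hyperplanes\<close>

lemma intersection_pointsI:
  fixes f :: "'l \<Rightarrow> 'a::euclidean_space set"
  assumes L: "finite L" "card L = DIM('a)" and f: "\<And>l. l \<in> L \<Longrightarrow> f l \<in> S"
    and x: "(\<Inter>l\<in>L. f l) = {x}"
  shows "x \<in> intersection_points S"
proof -
  obtain b where b: "bij_betw b {..<DIM('a)} L"
    using ex_bij_betw_nat_finite[OF L(1)] L(2) by (auto simp: atLeast0LessThan)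
  then have "(\<Inter>i<DIM('a). f (b i)) = {x}"
    using x by (simp add: bij_betw_imp_surj_on image_image[symmetric, of f b])
  moreover have "\<forall>i<DIM('a). f (b i) \<in> S" using b f by (auto dest: bij_betwE)
  ultimately show ?thesis unfolding intersection_points_def by (auto intro!: exI[of _ "\<lambda>i. f (b i)"])
qed

text \<open>An intersection point of d hyperplanes lies on no further one. For tuples without a
  single common point the default makes this a condition on 0, which also holds almost
  surely.\<close>

definition simple_configuration :: "'a::euclidean_space set set \<Rightarrow> bool" where
  "simple_configuration S \<longleftrightarrow> (\<forall>h\<in>{..<DIM('a)} \<rightarrow>\<^sub>E S. \<forall>H\<in>S - h ` {..<DIM('a)}. meeting_point {..<DIM('a)} h \<notin> H)"

lemma simple_configurationD:
  fixes f :: "'l \<Rightarrow> 'a::euclidean_space set"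
  assumes S: "simple_configuration S" and L: "finite L" "card L = DIM('a)"
    and f: "\<And>l. l \<in> L \<Longrightarrow> f l \<in> S" and x: "(\<Inter>l\<in>L. f l) = {x}"
    and H: "H \<in> S" "x \<in> H"
  shows "H \<in> f ` L"
proof (rule ccontr)
  assume no: "H \<notin> f ` L"
  obtain b where b: "bij_betw b {..<DIM('a)} L"
    using ex_bij_betw_nat_finite[OF L(1)] L(2) by (auto simp: atLeast0LessThan)
  define h where "h = (\<lambda>i\<in>{..<DIM('a)}. f (b i))"
  have bL: "b ` {..<DIM('a)} = L" using b by (rule bij_betw_imp_surj_on)
  have im: "h ` {..<DIM('a)} = f ` L"
    unfolding bL[symmetric] image_image by (intro image_cong) (auto simp: h_def)
  then have "(\<Inter>i\<in>{..<DIM('a)}. h i) = {x}" using x by simp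
  then have "meeting_point {..<DIM('a)} h = x" using meeting_point_eq by blast
  moreover have "h \<in> {..<DIM('a)} \<rightarrow>\<^sub>E S" using f bL by (auto simp: h_def)
  moreover have "H \<in> S - h ` {..<DIM('a)}" using H(1) no im by auto
  ultimately show False using S H(2) unfolding simple_configuration_def by metis
qed

text \<open>A hyperplane other than \<open>H\<close> cannot contain a grid point together with a further grid point in
  each of the directions, since these would span \<open>H\<close>. So the grid points on it are determined by
  all but one of their coordinates.\<close>

lemma grid_points_on_hyperplane:
  fixes S :: "'a::euclidean_space set set" and B :: "'l set"
  assumes S: "S \<subseteq> hyperplanes" "simple_configuration S"
    and B: "finite B" "card B = DIM('a)" and e: "e \<in> B" and d: "DIM('a) \<ge> 2"
    and F: "\<And>b. b \<in> B - {e} \<Longrightarrow> F b \<subseteq> S" "\<And>b. b \<in> B - {e} \<Longrightarrow> finite (F b) \<and> card (F b) = N"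
    and H: "H \<in> S" and G: "G \<in> hyperplanes" "G \<noteq> H"
    and X: "\<And>\<phi>. \<phi> \<in> (\<Pi>\<^sub>E b\<in>B - {e}. F b) \<Longrightarrow> H \<inter> (\<Inter>b\<in>B - {e}. \<phi> b) = {X \<phi>}"
  shows "card {\<phi> \<in> (\<Pi>\<^sub>E b\<in>B - {e}. F b). X \<phi> \<in> G} \<le> (DIM('a) - 1) * N ^ (DIM('a) - 2)"
proof -
  let ?P = "\<Pi>\<^sub>E b\<in>B - {e}. F b"
  have finP: "finite ?P" using B(1) F(2) by (intro finite_PiE) auto
  \<comment> \<open>The tuples whose grid point is the only one on \<open>G\<close> along its grid
    line in direction \<open>b\<close>.\<close>
  define Pb where "Pb b = {\<phi>\<in>?P. X \<phi> \<in> G \<and> (\<forall>g\<in>F b - {\<phi> b}. X (\<phi>(b := g)) \<notin> G)}" for b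
  have tuple: "(\<Inter>b\<in>B. (\<phi>(e := H)) b) = {X \<phi>}" if "\<phi> \<in> ?P" for \<phi>
  proof -
    have "(\<Inter>b\<in>B. (\<phi>(e := H)) b) = (\<phi>(e := H)) e \<inter> (\<Inter>b\<in>B - {e}. (\<phi>(e := H)) b)"
      using e by blast
    also have "(\<Inter>b\<in>B - {e}. (\<phi>(e := H)) b) = (\<Inter>b\<in>B - {e}. \<phi> b)"
      by (intro INF_cong) auto
    finally show ?thesis using X[OF that] by simp
  qed
  have tupleS: "(\<phi>(e := H)) b \<in> S" if "\<phi> \<in> ?P" "b \<in> B" for \<phi> b
    using that H F(1)[of b] by (auto simp: PiE_iff)
  have cover: "\<exists>b\<in>B - {e}. \<phi> \<in> Pb b" if \<phi>: "\<phi> \<in> ?P" "X \<phi> \<in> G" for \<phi>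
  proof (rule ccontr)
    assume "\<not> ?thesis"
    then have "\<forall>b\<in>B - {e}. \<exists>g. g \<in> F b \<and> g \<noteq> \<phi> b \<and> X (\<phi>(b := g)) \<in> G"
      using \<phi> by (auto simp: Pb_def)
    then obtain g where g: "\<And>b. b \<in> B - {e} \<Longrightarrow> g b \<in> F b" "\<And>b. b \<in> B - {e} \<Longrightarrow> g b \<noteq> \<phi> b"
      "\<And>b. b \<in> B - {e} \<Longrightarrow> X (\<phi>(b := g b)) \<in> G" by metis
    define \<psi> where "\<psi> b = \<phi>(b := g b)" for b
    have \<psi>: "\<psi> b \<in> ?P" if "b \<in> B - {e}" for b
      using \<phi>(1) g(1)[OF that] that by (auto simp: \<psi>_def PiE_iff extensional_def)
    have "\<forall>b\<in>B. \<exists>u s. (\<phi>(e := H)) b = hyperplane u s"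
      using tupleS[OF \<phi>(1)] S(1) unfolding hyperplanes_def by blast
    then obtain n s where ns: "\<And>b. b \<in> B \<Longrightarrow> (\<phi>(e := H)) b = hyperplane (n b) (s b)" by metis
    have "(\<Inter>b\<in>B. hyperplane (n b) (s b)) = (\<Inter>b\<in>B. (\<phi>(e := H)) b)"
      by (intro INF_cong refl) (rule ns[symmetric])
    then have pt: "(\<Inter>b\<in>B. hyperplane (n b) (s b)) = {X \<phi>}"
      unfolding tuple[OF \<phi>(1)] .
    obtain w r where w: "norm w = 1" "G = hyperplane w r" using G(1) by (rule hyperplanesE)
    obtain c where c: "w = (\<Sum>b\<in>B. c b *\<^sub>R n b)"
      using normals_combination[OF B(1) point_normals_orthogonal[OF pt]] by blast
    define y where "y b = X (\<psi> b) - X \<phi>" for b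
    have X\<phi>: "X \<phi> \<bullet> n b = s b" if "b \<in> B" for b using pt that by (auto simp: hyperplane_def)
    have yn: "y b \<bullet> n b' = 0" if b: "b \<in> B - {e}" and b': "b' \<in> B" "b' \<noteq> b" for b b'
    proof -
      have "X (\<psi> b) \<in> ((\<psi> b)(e := H)) b'" using tuple[OF \<psi>[OF b]] b'(1) by blast
      also have "((\<psi> b)(e := H)) b' = (\<phi>(e := H)) b'" using b' b by (auto simp: \<psi>_def)
      finally have "X (\<psi> b) \<bullet> n b' = s b'" using ns[OF b'(1)] by (simp add: hyperplane_def)
      then show ?thesis using X\<phi>[OF b'(1)] by (simp add: y_def inner_diff_left)
    qed
    \<comment> \<open>Otherwise the two grid points coincide and \<open>g b\<close> passes through
      \<open>X \<phi>\<close>. By simplicity it is then \<open>H\<close> or another entry of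
      \<open>\<phi>\<close>, so it occurs twice in the tuple of \<open>\<psi> b\<close>, against
      \<open>point_inj_on\<close>.\<close>
    have yb: "y b \<bullet> n b \<noteq> 0" if b: "b \<in> B - {e}" for b
    proof
      assume "y b \<bullet> n b = 0"
      then have "y b \<bullet> n b' = 0" if "b' \<in> B" for b' using yn[OF b that] by (cases "b' = b") auto
      from point_normals_orthogonal[OF pt this] have "X (\<psi> b) = X \<phi>" by (simp add: y_def)
      moreover have "X (\<psi> b) \<in> ((\<psi> b)(e := H)) b" using tuple[OF \<psi>[OF b]] b by blast
      ultimately have "X \<phi> \<in> g b" using b by (simp add: \<psi>_def)
      moreover have "g b \<in> S" using g(1)[OF b] F(1)[OF b] by blast
      ultimately have "g b \<in> (\<phi>(e := H)) ` B"
        by (intro simple_configurationD[OF S(2) B tupleS[OF \<phi>(1)] tuple[OF \<phi>(1)]])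
      then obtain b' where b': "b' \<in> B" "g b = (\<phi>(e := H)) b'" by blast
      have "b' \<noteq> b"
      proof
        assume "b' = b"
        then have "g b = \<phi> b" using b'(2) b by simp
        then show False using g(2)[OF b] by contradiction
      qed
      moreover have "((\<psi> b)(e := H)) b' = ((\<psi> b)(e := H)) b"
      proof -
        have "((\<psi> b)(e := H)) b' = (\<phi>(e := H)) b'" using \<open>b' \<noteq> b\<close> by (simp add: \<psi>_def)
        also have "\<dots> = g b" by (rule b'(2)[symmetric])
        also have "\<dots> = ((\<psi> b)(e := H)) b" using b by (simp add: \<psi>_def)
        finally show ?thesis .
      qed
      moreover have "inj_on ((\<psi> b)(e := H)) B"
        by (rule point_inj_on[OF B subsetD[OF S(1) tupleS[OF \<psi>[OF b]]] tuple[OF \<psi>[OF b]]])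
      ultimately show False using b b'(1) inj_onD by (metis DiffD1)
    qed
    \<comment> \<open>The step \<open>y b\<close> stays in \<open>G\<close> and is orthogonal to all
      normals except \<open>n b\<close>, so \<open>n b\<close> does not occur in the normal
      \<open>w\<close>. Only \<open>n e\<close> survives: \<open>G\<close> is parallel to
      \<open>H\<close>, and they share \<open>X \<phi>\<close>.\<close>
    have c0: "c b = 0" if b: "b \<in> B - {e}" for b
    proof -
      have "X (\<psi> b) \<in> G" using g(3)[OF b] by (simp add: \<psi>_def)
      then have "y b \<bullet> w = 0" using \<phi>(2) w(2) by (simp add: y_def hyperplane_def inner_diff_left)
      also have "y b \<bullet> w = (\<Sum>b'\<in>B. c b' * (y b \<bullet> n b'))" by (simp add: c inner_sum_right)
      also have "\<dots> = (\<Sum>b'\<in>B. if b' = b then c b * (y b \<bullet> n b) else 0)"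
        using yn[OF b] by (intro sum.cong) auto
      also have "\<dots> = c b * (y b \<bullet> n b)" using B(1) b by simp
      finally show ?thesis using yb[OF b] by simp
    qed
    have "w = (\<Sum>b\<in>B. if b = e then c e *\<^sub>R n e else 0)"
      unfolding c using c0 by (intro sum.cong) auto
    then have we: "w = c e *\<^sub>R n e" using B(1) e by simp
    then have ce: "c e \<noteq> 0" using w(1) by auto
    have He: "H = hyperplane (n e) (s e)" using ns[OF e] by simp
    have "r = X \<phi> \<bullet> w" using \<phi>(2) w(2) by (simp add: hyperplane_def)
    also have "\<dots> = c e * s e" using X\<phi>[OF e] by (simp add: we)
    finally have "G = H" unfolding w(2) He we using ce by (auto simp: hyperplane_def)
    then show False using G(2) by simp
  qed
  have bound: "card (Pb b) \<le> N ^ (DIM('a) - 2)" if b: "b \<in> B - {e}" for b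
  proof -
    let ?Q = "\<Pi>\<^sub>E b'\<in>B - {e} - {b}. F b'"
    have finQ: "finite ?Q" using B(1) F(2) by (intro finite_PiE) auto
    \<comment> \<open>On \<open>Pb b\<close> the coordinate \<open>b\<close> is determined by the
      others, so forgetting it loses nothing.\<close>
    have "inj_on (\<lambda>\<phi>. restrict \<phi> (B - {e} - {b})) (Pb b)"
    proof (rule inj_onI)
      fix \<phi> \<psi> assume \<phi>: "\<phi> \<in> Pb b" and \<psi>: "\<psi> \<in> Pb b"
        and eq: "restrict \<phi> (B - {e} - {b}) = restrict \<psi> (B - {e} - {b})"
      have \<phi>P: "\<phi> \<in> ?P" and \<psi>P: "\<psi> \<in> ?P" using \<phi> \<psi> by (auto simp: Pb_def)
      have upd: "\<psi> = \<phi>(b := \<psi> b)"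
      proof
        fix b' show "\<psi> b' = (\<phi>(b := \<psi> b)) b'"
        proof (cases "b' \<in> B - {e} - {b}")
          case True
          then show ?thesis using fun_cong[OF eq, of b'] by simp
        next
          case False
          then show ?thesis using PiE_arb[OF \<phi>P, of b'] PiE_arb[OF \<psi>P, of b'] by auto
        qed
      qed
      have same: "\<psi> b = \<phi> b"
      proof (rule ccontr)
        assume ne: "\<psi> b \<noteq> \<phi> b"
        have "\<psi> b \<in> F b" using \<psi>P b by (rule PiE_mem)
        then have "X (\<phi>(b := \<psi> b)) \<notin> G" using \<phi> ne unfolding Pb_def by blast
        then have "X \<psi> \<notin> G" unfolding upd[symmetric] .
        then show False using \<psi> unfolding Pb_def by blast
      qed
      have "\<psi> = \<phi>(b := \<phi> b)" unfolding same[symmetric] by (rule upd)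
      then show "\<phi> = \<psi>" by simp
    qed
    moreover have "(\<lambda>\<phi>. restrict \<phi> (B - {e} - {b})) ` Pb b \<subseteq> ?Q"
    proof (rule image_subsetI)
      fix \<phi> assume "\<phi> \<in> Pb b"
      then have "\<phi> \<in> ?P" unfolding Pb_def by blast
      then show "restrict \<phi> (B - {e} - {b}) \<in> ?Q" by (intro restrict_PiE_iff[THEN iffD2]) auto
    qed
    ultimately have "card (Pb b) \<le> card ?Q" using finQ by (rule card_inj_on_le)
    also have "\<dots> = (\<Prod>b'\<in>B - {e} - {b}. card (F b'))" using B(1) by (intro card_PiE) auto
    also have "\<dots> = (\<Prod>b'\<in>B - {e} - {b}. N)" using F(2) by (intro prod.cong) auto
    also have "\<dots> = N ^ (DIM('a) - 2)" using B b e by (simp add: card_Diff_singleton numeral_2_eq_2)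
    finally show ?thesis .
  qed
  have "{\<phi> \<in> ?P. X \<phi> \<in> G} \<subseteq> (\<Union>b\<in>B - {e}. Pb b)" using cover by auto
  then have "card {\<phi> \<in> ?P. X \<phi> \<in> G} \<le> card (\<Union>b\<in>B - {e}. Pb b)"
    using B(1) finP by (intro card_mono) (auto simp: Pb_def)
  also have "\<dots> \<le> (\<Sum>b\<in>B - {e}. card (Pb b))" using B(1) by (intro card_UN_le) auto
  also have "\<dots> \<le> (\<Sum>b\<in>B - {e}. N ^ (DIM('a) - 2))" using bound by (rule sum_mono)
  also have "\<dots> = (DIM('a) - 1) * N ^ (DIM('a) - 2)" using B e by simp
  finally show ?thesis .
qed

text \<open>Of the N^(d-1) grid points another hyperplane holds at most (d-1) N^(d-2), so q times
  this number stays below the total as soon as q (d-1) < N.\<close>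

lemma grid_certifies:
  fixes S :: "'a::euclidean_space set set" and B :: "'l set"
  assumes S: "S \<subseteq> hyperplanes" "simple_configuration S"
    and B: "finite B" "card B = DIM('a)" and e: "e \<in> B" and d: "DIM('a) \<ge> 2"
    and F: "\<And>b. b \<in> B - {e} \<Longrightarrow> F b \<subseteq> S" "\<And>b. b \<in> B - {e} \<Longrightarrow> finite (F b) \<and> card (F b) = N"
    and H: "H \<in> S" and N: "q * (DIM('a) - 1) < N"
    and A: "\<And>\<phi>. \<phi> \<in> (\<Pi>\<^sub>E b\<in>B - {e}. F b) \<Longrightarrow> \<exists>x\<in>A. H \<inter> (\<Inter>b\<in>B - {e}. \<phi> b) = {x}"
  shows "H \<in> certified (N ^ (DIM('a) - 1)) q (intersection_points S \<inter> A)"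
proof -
  let ?P = "\<Pi>\<^sub>E b\<in>B - {e}. F b"
  let ?k = "N ^ (DIM('a) - 1)"
  have finP: "finite ?P" using B(1) F(2) by (intro finite_PiE) auto
  obtain X where X: "\<And>\<phi>. \<phi> \<in> ?P \<Longrightarrow> X \<phi> \<in> A" "\<And>\<phi>. \<phi> \<in> ?P \<Longrightarrow> H \<inter> (\<Inter>b\<in>B - {e}. \<phi> b) = {X \<phi>}"
    using A by metis
  have XS: "X \<phi> \<in> intersection_points S" if \<phi>: "\<phi> \<in> ?P" for \<phi>
  proof (rule intersection_pointsI[OF B])
    show "(\<phi>(e := H)) b \<in> S" if "b \<in> B" for b
      using \<phi> that H F(1)[of b] by (auto simp: PiE_iff)
    have "(\<Inter>b\<in>B. (\<phi>(e := H)) b) = (\<phi>(e := H)) e \<inter> (\<Inter>b\<in>B - {e}. (\<phi>(e := H)) b)"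
      using e by blast
    also have "(\<Inter>b\<in>B - {e}. (\<phi>(e := H)) b) = (\<Inter>b\<in>B - {e}. \<phi> b)"
      by (intro INF_cong) auto
    finally show "(\<Inter>b\<in>B. (\<phi>(e := H)) b) = {X \<phi>}" using X(2)[OF \<phi>] by simp
  qed
  have "card ?P = (\<Prod>b\<in>B - {e}. card (F b))" using B(1) by (intro card_PiE) auto
  also have "\<dots> = (\<Prod>b\<in>B - {e}. N)" using F(2) by (intro prod.cong) auto
  also have "\<dots> = ?k" using B e by simp
  finally have card: "card ?P = ?k" .
  obtain \<beta> where \<beta>: "bij_betw \<beta> {..<?k} ?P"
    using ex_bij_betw_nat_finite[OF finP] card by (auto simp: atLeast0LessThan)
  have \<beta>P: "\<beta> j \<in> ?P" if "j < ?k" for j using bij_betwE[OF \<beta>] that by simp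
  define x where "x = (\<lambda>j\<in>{..<?k}. X (\<beta> j))"
  have "x \<in> {..<?k} \<rightarrow>\<^sub>E intersection_points S \<inter> A"
    using \<beta>P XS X(1) by (auto simp: x_def simp del: PiE_iff)
  moreover have "\<forall>j<?k. x j \<in> H"
  proof (intro allI impI)
    fix j assume j: "j < ?k"
    then show "x j \<in> H" using X(2)[OF \<beta>P[OF j]] by (auto simp: x_def)
  qed
  moreover have "q * card {j\<in>{..<?k}. x j \<in> G} < ?k" if G: "G \<in> hyperplanes" "G \<noteq> H" for G
  proof -
    have "card {j\<in>{..<?k}. x j \<in> G} = card (\<beta> ` {j\<in>{..<?k}. x j \<in> G})"
      using \<beta> by (intro card_image[symmetric]) (auto simp: bij_betw_def intro: inj_on_subset)
    also have "\<dots> \<le> card {\<phi>\<in>?P. X \<phi> \<in> G}"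
      using finP \<beta>P by (intro card_mono) (auto simp: x_def simp del: PiE_iff)
    also have "\<dots> \<le> (DIM('a) - 1) * N ^ (DIM('a) - 2)"
      by (rule grid_points_on_hyperplane[OF S B e d F H G X(2)])
    finally have "q * card {j\<in>{..<?k}. x j \<in> G} \<le> q * (DIM('a) - 1) * N ^ (DIM('a) - 2)"
      by (simp add: mult.assoc)
    also have "\<dots> < N * N ^ (DIM('a) - 2)" using N by (intro mult_strict_right_mono) auto
    also have "\<dots> = N ^ (DIM('a) - 1)" using d
      by (metis Suc_1 Suc_diff_Suc Suc_le_lessD diff_Suc_1 power_Suc)
    finally show ?thesis .
  qed
  ultimately show ?thesis using H S(1) unfolding certified_def by blast
qed

section \<open>Directions in the support of the directional distribution\<close>

text \<open>The d normals span, hence form a basis. The point represents the linear functional with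
  value \<open>s l\<close> at \<open>n l\<close>; uniqueness is the orthogonality
  assumption.\<close>

lemma solution_exists:
  fixes n :: "'l \<Rightarrow> 'a::euclidean_space"
  assumes L: "finite L" "card L = DIM('a)" and orth: "\<And>a. (\<And>l. l \<in> L \<Longrightarrow> a \<bullet> n l = 0) \<Longrightarrow> a = 0"
  shows "\<exists>x. (\<Inter>l\<in>L. hyperplane (n l) (s l)) = {x}"
proof -
  have sp: "span (n ` L) = UNIV" by (rule normals_span[OF L(1) orth])
  have "DIM('a) \<le> card (n ` L)"
    using dim_le_card[of "UNIV :: 'a set" "n ` L"] L(1) sp by simp
  moreover have "card (n ` L) \<le> card L" using L(1) by (rule card_image_le)
  ultimately have card: "card (n ` L) = DIM('a)" using L(2) by simp
  then have inj: "inj_on n L" using L by (simp add: eq_card_imp_inj_on)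
  have "independent (n ` L)"
    by (rule card_le_dim_spanning[of _ UNIV]) (use sp card L(1) in auto)
  from linear_independent_extend[OF this, of "\<lambda>v. s (inv_into L n v)"]
  obtain f :: "'a \<Rightarrow> real" where f: "linear f" "\<forall>v\<in>n ` L. f v = s (inv_into L n v)"
    by blast
  define x where "x = adjoint f 1"
  have x: "x \<bullet> n l = s l" if "l \<in> L" for l
  proof -
    have "n l \<bullet> x = f (n l) \<bullet> 1" unfolding x_def by (rule adjoint_works[OF f(1)])
    also have "\<dots> = s l" using f(2) that inj by simp
    finally show ?thesis by (simp add: inner_commute)
  qed
  have "y = x" if "\<And>l. l \<in> L \<Longrightarrow> y \<bullet> n l = s l" for y
  proof -
    have "y - x = 0" by (rule orth) (use x that in \<open>simp add: inner_diff_left\<close>)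
    then show ?thesis by simp
  qed
  then show ?thesis using x by (intro exI[of _ x]) (auto simp: hyperplane_def)
qed

text \<open>The sum is continuous and has no zero on the compact unit sphere; \<open>C\<close> is
  the reciprocal of its minimum there.\<close>

lemma basis_norm_bound:
  fixes B :: "'a::euclidean_space set"
  assumes B: "finite B" "span B = UNIV"
  shows "\<exists>C>0. \<forall>x. norm x \<le> C * (\<Sum>b\<in>B. \<bar>x \<bullet> b\<bar>)"
proof -
  define f where "f x = (\<Sum>b\<in>B. \<bar>x \<bullet> b\<bar>)" for x :: 'a
  have "continuous_on (sphere 0 1) f" unfolding f_def by (intro continuous_intros)
  moreover have "sphere (0::'a) 1 \<noteq> {}" by simp
  ultimately obtain m where m: "m \<in> sphere 0 1" "\<And>x. x \<in> sphere 0 1 \<Longrightarrow> f m \<le> f x"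
    using continuous_attains_inf[OF compact_sphere] by metis
  have "f m > 0"
  proof (rule ccontr)
    assume "\<not> f m > 0"
    moreover have "f m \<ge> 0" unfolding f_def by (intro sum_nonneg) auto
    ultimately have "f m = 0" by simp
    then have "\<forall>b\<in>B. m \<bullet> b = 0" unfolding f_def using B(1) by (simp add: sum_nonneg_eq_0_iff)
    then have "span B \<subseteq> {y. m \<bullet> y = 0}"
      by (intro span_minimal subspace_hyperplane) auto
    then have "m \<bullet> m = 0" using B(2) by blast
    then show False using m(1) by simp
  qed
  moreover have "norm x \<le> 1 / f m * f x" for x
  proof (cases "x = 0")
    case False
    have "f m \<le> f (x /\<^sub>R norm x)" using False by (intro m(2)) simp
    also have "\<dots> = f x / norm x"
      by (simp add: f_def sum_distrib_left[symmetric] abs_mult divide_inverse mult.commute)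
    finally have "f m * norm x \<le> f x" using False by (simp add: pos_le_divide_eq)
    then show ?thesis using \<open>f m > 0\<close> by (simp add: pos_le_divide_eq mult.commute)
  qed (simp add: f_def)
  ultimately show ?thesis unfolding f_def[symmetric] by (intro exI[of _ "1 / f m"]) auto
qed

text \<open>The basis vector to be replaced by \<open>w\<close> is the one with the largest coefficient in \<open>w\<close>.\<close>

lemma exchange_norm_bound:
  fixes B :: "'a::euclidean_space set"
  assumes B: "finite B" "span B = UNIV" "B \<subseteq> sphere 0 1"
  shows "\<exists>C>0. \<exists>\<epsilon>>0. \<forall>w. norm w = 1 \<longrightarrow> (\<exists>e\<in>B. \<forall>v. (\<forall>b\<in>B - {e}. norm (v b - b) \<le> \<epsilon>) \<longrightarrow>
    (\<forall>x. norm x \<le> C * (\<bar>x \<bullet> w\<bar> + (\<Sum>b\<in>B - {e}. \<bar>x \<bullet> v b\<bar>))))"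
proof -
  obtain C0 where C0: "C0 > 0" "\<And>x. norm x \<le> C0 * (\<Sum>b\<in>B. \<bar>x \<bullet> b\<bar>)"
    using basis_norm_bound[OF B(1,2)] by blast
  define d where "d = real (card B)"
  have "B \<noteq> {}" using B(2) by (metis UNIV_not_singleton span_empty)
  then have d: "d \<ge> 1" using B(1) by (simp add: d_def Suc_leI card_gt_0_iff)
  \<comment> \<open>Chosen so that replacing each \<open>b\<close> by \<open>v b\<close> costs at
    most half of \<open>norm x\<close>, which is absorbed on the left. This explains the factor 2 in
    \<open>C\<close>; its factor \<open>d + 2\<close> dominates both coefficients \<open>d\<close>
    and 2.\<close>
  define \<epsilon> where "\<epsilon> = 1 / (4 * C0 * d)"
  have \<epsilon>: "\<epsilon> > 0" using C0(1) d by (simp add: \<epsilon>_def)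
  define C where "C = 2 * C0 * (d + 2)"
  have C: "C > 0" using C0(1) d by (simp add: C_def)
  have "\<exists>e\<in>B. \<forall>v. (\<forall>b\<in>B - {e}. norm (v b - b) \<le> \<epsilon>) \<longrightarrow>
    (\<forall>x. norm x \<le> C * (\<bar>x \<bullet> w\<bar> + (\<Sum>b\<in>B - {e}. \<bar>x \<bullet> v b\<bar>)))" if w: "norm w = 1" for w
  proof -
    have "w \<in> span B" using B(2) by simp
    then obtain a where a: "w = (\<Sum>b\<in>B. a b *\<^sub>R b)" using span_finite[OF B(1)] by auto
    obtain e where e: "e \<in> B" "\<And>b. b \<in> B \<Longrightarrow> \<bar>a b\<bar> \<le> \<bar>a e\<bar>"
      using Max_in[of "(\<lambda>b. \<bar>a b\<bar>) ` B"] Max_ge[of "(\<lambda>b. \<bar>a b\<bar>) ` B"] B(1) \<open>B \<noteq> {}\<close> by fastforce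
    have "1 \<le> (\<Sum>b\<in>B. norm (a b *\<^sub>R b))" unfolding w[symmetric] a by (rule norm_sum)
    also have "\<dots> \<le> (\<Sum>b\<in>B. \<bar>a e\<bar>)" using e B(3) by (intro sum_mono) auto
    \<comment> \<open>The largest coefficient is at least 1 / d, so \<open>x \<bullet> e\<close> can
      be recovered from \<open>x \<bullet> w\<close> with a bounded factor.\<close>
    finally have ae: "1 \<le> d * \<bar>a e\<bar>" by (simp add: d_def)
    then have ae0: "\<bar>a e\<bar> > 0" using d by (smt (verit) mult_nonneg_nonpos)
    have xe: "\<bar>x \<bullet> e\<bar> \<le> d * \<bar>x \<bullet> w\<bar> + (\<Sum>b\<in>B - {e}. \<bar>x \<bullet> b\<bar>)" for x
    proof -
      have "x \<bullet> w = (\<Sum>b\<in>B. a b * (x \<bullet> b))" by (simp add: a inner_sum_right)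
      also have "\<dots> = a e * (x \<bullet> e) + (\<Sum>b\<in>B - {e}. a b * (x \<bullet> b))"
        using B(1) e(1) by (rule sum.remove)
      finally have "\<bar>a e * (x \<bullet> e)\<bar> \<le> \<bar>x \<bullet> w\<bar> + \<bar>\<Sum>b\<in>B - {e}. a b * (x \<bullet> b)\<bar>" by linarith
      also have "\<bar>\<Sum>b\<in>B - {e}. a b * (x \<bullet> b)\<bar> \<le> (\<Sum>b\<in>B - {e}. \<bar>a e\<bar> * \<bar>x \<bullet> b\<bar>)"
        using e(2) by (intro order_trans[OF sum_abs] sum_mono) (auto simp: abs_mult intro!: mult_right_mono)
      also have "\<dots> = \<bar>a e\<bar> * (\<Sum>b\<in>B - {e}. \<bar>x \<bullet> b\<bar>)" by (simp add: sum_distrib_left)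
      also have "\<bar>x \<bullet> w\<bar> \<le> \<bar>a e\<bar> * (d * \<bar>x \<bullet> w\<bar>)"
        using mult_right_mono[OF ae, of "\<bar>x \<bullet> w\<bar>"] by (simp add: mult_ac)
      finally have "\<bar>a e\<bar> * \<bar>x \<bullet> e\<bar> \<le> \<bar>a e\<bar> * (d * \<bar>x \<bullet> w\<bar> + (\<Sum>b\<in>B - {e}. \<bar>x \<bullet> b\<bar>))"
        by (simp add: abs_mult distrib_left)
      then show ?thesis using ae0 by (simp add: mult_le_cancel_left)
    qed
    have "norm x \<le> C * (\<bar>x \<bullet> w\<bar> + (\<Sum>b\<in>B - {e}. \<bar>x \<bullet> v b\<bar>))" if v: "\<forall>b\<in>B - {e}. norm (v b - b) \<le> \<epsilon>" for v x
    proof -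
      define s where "s = (\<Sum>b\<in>B - {e}. \<bar>x \<bullet> v b\<bar>)"
      have s0: "s \<ge> 0" unfolding s_def by (intro sum_nonneg) auto
      have "(\<Sum>b\<in>B - {e}. \<bar>x \<bullet> b\<bar>) \<le> (\<Sum>b\<in>B - {e}. \<bar>x \<bullet> v b\<bar> + norm x * \<epsilon>)"
      proof (rule sum_mono)
        fix b assume b: "b \<in> B - {e}"
        have "\<bar>x \<bullet> (v b - b)\<bar> \<le> norm x * norm (v b - b)" by (rule Cauchy_Schwarz_ineq2)
        also have "\<dots> \<le> norm x * \<epsilon>" using v b by (intro mult_left_mono) auto
        finally show "\<bar>x \<bullet> b\<bar> \<le> \<bar>x \<bullet> v b\<bar> + norm x * \<epsilon>" by (simp add: inner_diff_right)
      qed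
      also have "\<dots> = s + real (card (B - {e})) * (norm x * \<epsilon>)"
        by (simp add: sum.distrib s_def)
      also have "\<dots> \<le> s + d * (norm x * \<epsilon>)"
        using \<epsilon> B(1) by (intro add_left_mono mult_right_mono) (auto simp: d_def intro: card_mono)
      finally have sb: "(\<Sum>b\<in>B - {e}. \<bar>x \<bullet> b\<bar>) \<le> s + d * (norm x * \<epsilon>)" .
      have "norm x \<le> C0 * (\<Sum>b\<in>B. \<bar>x \<bullet> b\<bar>)" by (rule C0(2))
      also have "(\<Sum>b\<in>B. \<bar>x \<bullet> b\<bar>) = \<bar>x \<bullet> e\<bar> + (\<Sum>b\<in>B - {e}. \<bar>x \<bullet> b\<bar>)"
        using B(1) e(1) by (rule sum.remove)
      also have "C0 * \<dots> \<le> C0 * (d * \<bar>x \<bullet> w\<bar> + 2 * (s + d * (norm x * \<epsilon>)))"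
        using xe[of x] sb C0(1) by (intro mult_left_mono) auto
      also have "\<dots> = C0 * (d * \<bar>x \<bullet> w\<bar> + 2 * s) + 2 * C0 * d * \<epsilon> * norm x"
        by (simp add: algebra_simps)
      also have "2 * C0 * d * \<epsilon> = 1 / 2" using C0(1) d by (simp add: \<epsilon>_def)
      finally have "norm x \<le> 2 * C0 * (d * \<bar>x \<bullet> w\<bar> + 2 * s)" by simp
      also have "\<dots> \<le> 2 * C0 * ((d + 2) * (\<bar>x \<bullet> w\<bar> + s))"
      proof (rule mult_left_mono)
        have "d * s \<ge> 0" using d s0 by simp
        then show "d * \<bar>x \<bullet> w\<bar> + 2 * s \<le> (d + 2) * (\<bar>x \<bullet> w\<bar> + s)"
          by (simp add: algebra_simps)
      qed (use C0(1) in simp)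
      finally show ?thesis by (simp add: C_def s_def mult.assoc)
    qed
    then show ?thesis using e(1) by blast
  qed
  then show ?thesis using C \<epsilon> by blast
qed

text \<open>If the support lay in a linear hyperplane, each point of the sphere off it would be the
  centre of a null cap. Countably many caps suffice, so Q would be concentrated on a great
  subsphere.\<close>

lemma support_basis:
  fixes Q :: "'a::euclidean_space measure"
  assumes Q: "directional_distribution Q"
  shows "\<exists>B. finite B \<and> card B = DIM('a) \<and> span B = UNIV \<and> B \<subseteq> sphere 0 1 \<and>
    (\<forall>b\<in>B. \<forall>\<delta>>0. emeasure Q {u\<in>sphere 0 1. b \<bullet> u > 1 - \<delta>} > 0)"
proof -
  interpret Q: prob_space Q using Q by (simp add: directional_distribution_def)
  have sQ: "sets Q = sets (restrict_space borel (sphere 0 1))"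
    using Q by (simp add: directional_distribution_def)
  have spQ: "space Q = sphere 0 1"
    using sets_eq_imp_space_eq[OF sQ] by (simp add: space_restrict_space)
  have setsI: "sphere 0 1 \<inter> A \<in> sets Q" if "A \<in> sets borel" for A
    using that unfolding sQ sets_restrict_space by blast
  define S where "S = {b\<in>sphere 0 1. \<forall>\<delta>>0. emeasure Q {u\<in>sphere 0 1. b \<bullet> u > 1 - \<delta>} > 0}"
  have "span S = UNIV"
  proof (rule ccontr)
    assume "span S \<noteq> UNIV"
    then obtain a where a: "a \<noteq> 0" "\<forall>x\<in>span S. a \<bullet> x = 0"
      using span_not_UNIV_orthogonal by blast
    define L where "L = {x. a \<bullet> x = 0}"
    have L: "subspace L" "dim L = DIM('a) - 1"
      using a(1) by (auto simp: L_def subspace_hyperplane dim_hyperplane)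
    have SL: "S \<subseteq> L" using a(2) by (auto simp: L_def intro: span_base)
    \<comment> \<open>Open sets whose traces on the sphere are the null caps; Lindelof extracts a
      countable subfamily with the same union.\<close>
    define U where "U = (\<lambda>(b, \<delta>). {u. b \<bullet> u > 1 - \<delta>}) `
      {(b::'a, \<delta>). b \<in> sphere 0 1 \<and> \<delta> > 0 \<and> emeasure Q {u\<in>sphere 0 1. b \<bullet> u > 1 - \<delta>} = 0}"
    have open_U: "open V" if "V \<in> U" for V
      using that by (auto simp: U_def intro!: open_Collect_less continuous_intros)
    then obtain U' where U': "U' \<subseteq> U" "countable U'" "\<Union>U' = \<Union>U"
      using Lindelof[of U] open_U by metis
    have N: "(\<Union>V\<in>U'. sphere 0 1 \<inter> V) \<in> null_sets Q"
    proof (rule null_sets_UN'[OF U'(2)])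
      fix V assume "V \<in> U'"
      then have V: "V \<in> U" using U'(1) by blast
      then obtain b \<delta> where b: "V = {u. b \<bullet> u > 1 - \<delta>}" "emeasure Q {u\<in>sphere 0 1. b \<bullet> u > 1 - \<delta>} = 0"
        unfolding U_def by auto
      have "sphere 0 1 \<inter> V = {u\<in>sphere 0 1. b \<bullet> u > 1 - \<delta>}" unfolding b(1) by blast
      then show "sphere 0 1 \<inter> V \<in> null_sets Q"
        using b(2) setsI[of V] open_U[OF V] by (intro null_setsI) simp_all
    qed
    have "sphere 0 1 - L \<subseteq> \<Union>U"
    proof
      fix u assume u: "u \<in> sphere 0 1 - L"
      then have "u \<notin> S" using SL by blast
      then obtain \<delta> where \<delta>: "\<delta> > 0" "emeasure Q {v\<in>sphere 0 1. u \<bullet> v > 1 - \<delta>} = 0"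
        using u unfolding S_def by (auto simp: not_gr_zero)
      have "{v. u \<bullet> v > 1 - \<delta>} \<in> U"
        unfolding U_def using u \<delta> by (intro image_eqI[of _ _ "(u, \<delta>)"]) auto
      moreover have "u \<bullet> u > 1 - \<delta>" using u \<delta>(1) by (simp add: dot_square_norm)
      ultimately show "u \<in> \<Union>U" by blast
    qed
    then have "(sphere 0 1 \<inter> L) \<union> (\<Union>V\<in>U'. sphere 0 1 \<inter> V) = space Q"
      unfolding spQ using U'(3) by blast
    then have "emeasure Q (sphere 0 1 \<inter> L) = emeasure Q (space Q)"
      using emeasure_Un_null_set[OF setsI N, of L] closed_subspace[OF L(1)]
      by (simp add: borel_closed)
    also have "\<dots> = 1" by (rule Q.emeasure_space_1)
    finally show False
      using Q L unfolding directional_distribution_def by blast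
  qed
  obtain B where B: "B \<subseteq> S" "independent B" "S \<subseteq> span B" "card B = dim S"
    using basis_exists by blast
  have "span B = UNIV"
    using \<open>span S = UNIV\<close> span_minimal[OF B(3) subspace_span] by blast
  moreover have "card B = DIM('a)"
    using B(4) \<open>span S = UNIV\<close> dim_span[of S] by simp
  moreover have "finite B" using B(2) by (rule independent_imp_finite)
  moreover have "B \<subseteq> sphere 0 1" "\<forall>b\<in>B. \<forall>\<delta>>0. emeasure Q {u\<in>sphere 0 1. b \<bullet> u > 1 - \<delta>} > 0"
    using B(1) unfolding S_def by blast+
  ultimately show ?thesis by blast
qed

section \<open>Exploring the intersection process\<close>

lemma (in poisson_hyperplanes) AE_simple_configuration: "AE \<omega> in M. simple_configuration (\<eta> \<omega>)"
  unfolding simple_configuration_def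
  by (intro AE_general_position measurable_meeting_point measurable_component_singleton) auto

lemma origin_radius_le:
  assumes "F \<subseteq> cball 0 s" "0 \<le> s"
  shows "origin_radius F \<le> ereal s"
proof -
  have "bounded F" using assms(1) bounded_cball bounded_subset by blast
  moreover have "Inf {r. 0 \<le> r \<and> F \<subseteq> cball 0 r} \<le> s"
    using assms by (intro cInf_lower bdd_belowI[of _ 0]) auto
  ultimately show ?thesis by (simp add: origin_radius_def)
qed

text \<open>Fixes the constants: \<open>B\<close> is the basis of directions, \<open>C\<close> and
  \<epsilon> give the stable exchange bound, \<delta> is the relative width of the sectors,
  \<open>r\<close> the radius of a ball that will contain K, and \<open>a\<close> the exponential
  rate.\<close>

locale exploration = poisson_hyperplanes M \<gamma> Q \<eta>
  for M :: "'w measure" and \<gamma> :: real and Q :: "'a::euclidean_space measure" and \<eta> :: "'w \<Rightarrow> 'a set set" +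
  fixes B :: "'a set" and C \<epsilon> \<delta> r a :: real
  assumes d: "DIM('a) \<ge> 2"
    and B: "finite B" "card B = DIM('a)" "B \<subseteq> sphere 0 1"
    and C: "C > 0"
    and exchange: "\<And>w. norm w = 1 \<Longrightarrow> \<exists>e\<in>B. \<forall>v. (\<forall>b\<in>B - {e}. norm (v b - b) \<le> \<epsilon>) \<longrightarrow>
      (\<forall>x. norm x \<le> C * (\<bar>x \<bullet> w\<bar> + (\<Sum>b\<in>B - {e}. \<bar>x \<bullet> v b\<bar>)))"
    and \<epsilon>: "\<epsilon> > 0" and \<delta>: "0 < \<delta>" "\<delta> \<le> 1 / 2" "6 * \<delta> \<le> \<epsilon>\<^sup>2"
    and r: "r \<ge> 1"
    and a: "a > 0" "\<And>b. b \<in> B \<Longrightarrow> a \<le> \<gamma> * \<delta> * measure Q {u\<in>sphere 0 1. b \<bullet> u > 1 - \<delta>}"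
begin

text \<open>The hyperplanes with normal near \<open>b\<close> and distance about \<open>n\<close> from the origin, expressed by
  hitting events.\<close>

definition sector :: "'a \<Rightarrow> real \<Rightarrow> 'a set set" where
  "sector b n = hitting (cball (n *\<^sub>R b) (2 * \<delta> * n)) - hitting (cball 0 ((1 - \<delta>) * n))"

lemma sector_sets: "sector b n \<in> sets hyperplane_space"
  unfolding sector_def by (intro sets.Diff hitting_sets compact_cball)

text \<open>Hitting the ball around n b gives |n (b . v) - s| \<le> 2 \<delta> n, and missing the
  central ball gives s > (1 - \<delta>) n. Hence b . v \<ge> 1 - 3 \<delta>, so |v - b|^2 \<le> 6
  \<delta>, which is at most \<epsilon>^2.\<close>

lemma sectorE:
  assumes b: "b \<in> B" and n: "n > 0" and H: "H \<in> sector b n"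
  obtains v s where "norm v = 1" "H = hyperplane v s" "norm (v - b) \<le> \<epsilon>" "(1 - \<delta>) * n < s" "s \<le> (1 + 2 * \<delta>) * n"
proof -
  have nb: "norm b = 1" using b B(3) by auto
  have "H \<in> hyperplanes" using H by (auto simp: sector_def hitting_def)
  then obtain u t where ut: "norm u = 1" "H = hyperplane u t" by (rule hyperplanesE)
  \<comment> \<open>The normal is oriented so that the distance parameter is nonnegative.\<close>
  define v where "v = (if t \<ge> 0 then u else - u)"
  define s where "s = \<bar>t\<bar>"
  have v: "norm v = 1" "H = hyperplane v s" "s \<ge> 0"
    using ut by (auto simp: v_def s_def hyperplane_def)
  have "s *\<^sub>R v \<in> H" using v by (simp add: hyperplane_def dot_square_norm)
  then have "s *\<^sub>R v \<notin> cball 0 ((1 - \<delta>) * n)"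
    using H \<open>H \<in> hyperplanes\<close> by (auto simp: sector_def hitting_def)
  then have s1: "(1 - \<delta>) * n < s" using v(1,3) by simp
  obtain y where y: "y \<in> H" "dist (n *\<^sub>R b) y \<le> 2 * \<delta> * n"
    using H by (auto simp: sector_def hitting_def)
  have "y \<bullet> v = s" using y(1) v(2) by (simp add: hyperplane_def)
  then have "\<bar>n * (b \<bullet> v) - s\<bar> = \<bar>(n *\<^sub>R b - y) \<bullet> v\<bar>" by (simp add: inner_diff_left)
  also have "\<dots> \<le> norm (n *\<^sub>R b - y) * norm v" by (rule Cauchy_Schwarz_ineq2)
  finally have close: "\<bar>n * (b \<bullet> v) - s\<bar> \<le> 2 * \<delta> * n" using y(2) v(1) by (simp add: dist_norm)
  have bv: "b \<bullet> v \<le> 1" using norm_cauchy_schwarz[of b v] nb v(1) by simp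
  then have "n * (b \<bullet> v) \<le> n" using n by simp
  then have s2: "s \<le> (1 + 2 * \<delta>) * n" using close by (simp add: algebra_simps)
  have "n * (1 - 3 * \<delta>) \<le> n * (b \<bullet> v)" using close s1 by (simp add: algebra_simps)
  then have "1 - 3 * \<delta> \<le> b \<bullet> v" using n by simp
  moreover have "(norm (v - b))\<^sup>2 = 2 - 2 * (b \<bullet> v)"
  proof -
    have "(norm (v - b))\<^sup>2 = v \<bullet> v - 2 * (b \<bullet> v) + b \<bullet> b"
      unfolding power2_norm_eq_inner by (simp add: inner_diff_left inner_diff_right inner_commute)
    then show ?thesis using nb v(1) by (simp add: dot_square_norm)
  qed
  ultimately have "(norm (v - b))\<^sup>2 \<le> \<epsilon>\<^sup>2" using \<delta>(3) by simp
  then have "norm (v - b) \<le> \<epsilon>" using \<epsilon> by (simp add: power2_le_iff_abs_le)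
  then show ?thesis using that[OF v(1,2) _ s1 s2] by blast
qed

lemma sector_bounded: "n > 0 \<Longrightarrow> sector b n \<subseteq> hitting (cball 0 (n * norm b + 2 * \<delta> * n))"
proof
  fix H assume n: "n > 0" and H: "H \<in> sector b n"
  then obtain y where y: "H \<in> hyperplanes" "y \<in> H" "dist (n *\<^sub>R b) y \<le> 2 * \<delta> * n"
    by (auto simp: sector_def hitting_def)
  have "norm y \<le> norm (n *\<^sub>R b) + norm (y - n *\<^sub>R b)" using norm_triangle_sub by blast
  also have "\<dots> \<le> n * norm b + 2 * \<delta> * n" using y(3) n by (simp add: dist_norm norm_minus_commute)
  finally show "H \<in> hitting (cball 0 (n * norm b + 2 * \<delta> * n))"
    using y by (auto simp: hitting_def)
qed

text \<open>For each \<open>u\<close> in the cap around \<open>b\<close>, all \<open>s\<close> in an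
  interval of length 2 \<delta> n give hyperplanes of the sector. The factor 2 in the bound
  compensates the halved exponent of \<open>poisson_tail\<close>.\<close>

lemma intensity_sector:
  assumes b: "b \<in> B" and n: "n > 0"
  shows "measure \<Lambda> (sector b n) \<ge> 2 * a * n"
proof -
  interpret Q: prob_space Q using Q by (simp add: directional_distribution_def)
  define U where "U = {u\<in>sphere 0 1. b \<bullet> u > 1 - \<delta>}"
  have sQ: "sets Q = sets (restrict_space borel (sphere 0 1))"
    using Q by (simp add: directional_distribution_def)
  have "{u. b \<bullet> u > 1 - \<delta>} \<in> sets borel" by (intro borel_open open_Collect_less continuous_intros)
  moreover have "U = sphere 0 1 \<inter> {u. b \<bullet> u > 1 - \<delta>}" by (auto simp: U_def)
  ultimately have U: "U \<in> sets Q" unfolding sQ sets_restrict_space by blast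
  have le: "ennreal (2 * \<delta> * n) * indicator U u \<le>
      (\<integral>\<^sup>+s. indicator (sector b n) (hyperplane u s) \<partial>lborel)" for u
  proof (cases "u \<in> U")
    case True
    then have u: "norm u = 1" "b \<bullet> u > 1 - \<delta>" by (auto simp: U_def)
    have bu: "b \<bullet> u \<le> 1" using norm_cauchy_schwarz[of b u] b B(3) u(1) by auto
    have "ennreal (2 * \<delta> * n) = (\<integral>\<^sup>+s. indicator {(1 - \<delta>) * n<..(1 + \<delta>) * n} s \<partial>lborel)"
      using \<delta>(1) n by (simp add: algebra_simps)
    also have "\<dots> \<le> (\<integral>\<^sup>+s. indicator (sector b n) (hyperplane u s) \<partial>lborel)"
    proof (intro nn_integral_mono)
      fix s :: real
      have "hyperplane u s \<in> sector b n" if s: "(1 - \<delta>) * n < s" "s \<le> (1 + \<delta>) * n"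
      proof -
        have hyp: "hyperplane u s \<in> hyperplanes" using u(1) by (auto simp: hyperplanes_def)
        \<comment> \<open>The foot of the perpendicular from \<open>n *\<^sub>R b\<close>, the point
          of the hyperplane nearest to it.\<close>
        define y where "y = n *\<^sub>R b + (s - n * (b \<bullet> u)) *\<^sub>R u"
        have "y \<in> hyperplane u s"
          using u(1) by (simp add: y_def hyperplane_def inner_add_left dot_square_norm)
        moreover have "dist (n *\<^sub>R b) y \<le> 2 * \<delta> * n"
        proof -
          have "dist (n *\<^sub>R b) y = \<bar>s - n * (b \<bullet> u)\<bar>" using u(1) by (simp add: y_def dist_norm)
          moreover have "n * (1 - \<delta>) \<le> n * (b \<bullet> u)" "n * (b \<bullet> u) \<le> n" using u(2) bu n by simp_all
          ultimately show ?thesis using s by (auto simp: algebra_simps)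
        qed
        ultimately have "hyperplane u s \<in> hitting (cball (n *\<^sub>R b) (2 * \<delta> * n))"
          using hyp by (auto simp: hitting_def)
        moreover have "hyperplane u s \<notin> hitting (cball 0 ((1 - \<delta>) * n))"
        proof
          assume "hyperplane u s \<in> hitting (cball 0 ((1 - \<delta>) * n))"
          then obtain z where z: "z \<in> hyperplane u s" "norm z \<le> (1 - \<delta>) * n"
            by (auto simp: hitting_def)
          from z(1) have zs: "s = z \<bullet> u" by (simp add: hyperplane_def)
          have "s \<le> norm z * norm u" unfolding zs by (rule norm_cauchy_schwarz)
          then show False using z(2) u(1) s(1) by simp
        qed
        ultimately show ?thesis by (simp add: sector_def)
      qed
      then show "indicator {(1 - \<delta>) * n<..(1 + \<delta>) * n} s \<le> (indicator (sector b n) (hyperplane u s) :: ennreal)"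
        by (auto simp: indicator_def)
    qed
    finally show ?thesis using True by simp
  qed simp
  have "ennreal (2 * a * n) \<le> ennreal (\<gamma> * (2 * \<delta> * n * measure Q U))"
    using a(2)[OF b] n by (intro ennreal_leI) (simp add: U_def mult_ac)
  also have "\<dots> = ennreal \<gamma> * (ennreal (2 * \<delta> * n) * emeasure Q U)"
    using \<gamma> \<delta>(1) n by (simp add: Q.emeasure_eq_measure ennreal_mult[symmetric])
  also have "ennreal (2 * \<delta> * n) * emeasure Q U = (\<integral>\<^sup>+u. ennreal (2 * \<delta> * n) * indicator U u \<partial>Q)"
    using U by (simp add: nn_integral_cmult_indicator)
  also have "ennreal \<gamma> * \<dots> \<le> ennreal \<gamma> * (\<integral>\<^sup>+u. \<integral>\<^sup>+s. indicator (sector b n) (hyperplane u s) \<partial>lborel \<partial>Q)"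
    using le by (intro mult_left_mono nn_integral_mono) auto
  also have "\<dots> = emeasure \<Lambda> (sector b n)"
    by (rule emeasure_hyperplane_intensity[OF Q sector_sets, symmetric])
  also have "\<dots> = ennreal (measure \<Lambda> (sector b n))"
    using intensity_finite[OF sector_bounded[OF n], of b]
    by (intro emeasure_eq_ennreal_measure) (simp add: less_top)
  finally show ?thesis using a(1) n by (simp add: ennreal_le_iff)
qed

section \<open>Constants of the certificates, and the annuli\<close>

definition covers :: nat where "covers = DIM('a) * DIM('a)"
definition grid :: nat where "grid = covers * (DIM('a) - 1) + 1"
definition points :: nat where "points = grid ^ (DIM('a) - 1)"
text \<open>By \<open>exchange\<close>, grid points on hyperplanes at distance at most \<open>2 * n\<close> have norm at most
  \<open>outer * n\<close>.\<close>

definition outer :: real where "outer = 2 * C * (real DIM('a) + 1) + 1"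

text \<open>The removed ball will contain K; it is open, so that the annulus is compact.\<close>

definition region :: "nat \<Rightarrow> 'a set" where
  "region n = cball 0 (outer * n) - ball 0 r"

lemma covers_pos: "covers > 0" and points_pos: "points > 0"
  by (simp_all add: covers_def points_def grid_def)

lemma outer_ge: "outer \<ge> 1"
  using C by (simp add: outer_def)

lemma compact_region: "compact (region n)"
  unfolding region_def by (intro compact_diff) auto

lemma region_borel: "region n \<in> sets borel"
  by (intro borel_compact compact_region)

lemma region_mono: "m \<le> n \<Longrightarrow> region m \<subseteq> region n"
proof -
  assume "m \<le> n"
  then have "outer * real m \<le> outer * real n" using outer_ge by (intro mult_left_mono) auto
  then show ?thesis by (auto simp: region_def)
qed

lemma region_nonempty:
  assumes n: "real n \<ge> r"
  shows "region n \<noteq> {}"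
proof -
  obtain b where "b \<in> B" using B(1,2) by (metis DIM_positive card.empty ex_in_conv less_irrefl)
  then have "norm b = 1" using B(3) by auto
  moreover have "r \<le> outer * n" using outer_ge n r mult_mono[of 1 outer r "real n"] by simp
  ultimately have "r *\<^sub>R b \<in> region n" using r by (simp add: region_def)
  then show ?thesis by blast
qed

text \<open>\<open>exchange\<close>, applied to the normal \<open>w\<close>, tells which direction
  to drop; the remaining sectors cut the hyperplane in a grid. The same bound keeps the grid points
  within the outer radius, however close \<open>w\<close> is to other normals in the
  sectors.\<close>

lemma sectors_certify:
  assumes S: "S \<subseteq> hyperplanes" "simple_configuration S" and n: "real n \<ge> 2 * r"
    and sectors: "\<And>b. b \<in> B \<Longrightarrow> finite (S \<inter> sector b n) \<and> grid \<le> card (S \<inter> sector b n)"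
    and H: "hyperplane w t \<in> S" "norm w = 1" "\<bar>t\<bar> \<le> 2 * real n"
  shows "hyperplane w t \<in> certified points covers (intersection_points S \<inter> region n)"
proof -
  have n0: "real n > 0" using n r by simp
  have "\<forall>b\<in>B. \<exists>T. T \<subseteq> S \<inter> sector b n \<and> card T = grid \<and> finite T"
    using sectors by (meson obtain_subset_with_card_n)
  then obtain F where F: "\<And>b. b \<in> B \<Longrightarrow> F b \<subseteq> S \<inter> sector b n" "\<And>b. b \<in> B \<Longrightarrow> card (F b) = grid"
    "\<And>b. b \<in> B \<Longrightarrow> finite (F b)" by metis
  obtain e where e: "e \<in> B" "\<And>v x. (\<forall>b\<in>B - {e}. norm (v b - b) \<le> \<epsilon>) \<Longrightarrow>
      norm x \<le> C * (\<bar>x \<bullet> w\<bar> + (\<Sum>b\<in>B - {e}. \<bar>x \<bullet> v b\<bar>))"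
    using exchange[OF H(2)] by blast
  have cB: "card (B - {e}) = DIM('a) - 1" using B(1,2) e(1) by simp
  show ?thesis
    unfolding points_def
  proof (rule grid_certifies[OF S B(1,2) e(1) d _ _ H(1)])
    show "F b \<subseteq> S" "finite (F b) \<and> card (F b) = grid" if "b \<in> B - {e}" for b
      using F that by auto
    show "covers * (DIM('a) - 1) < grid" by (simp add: grid_def)
    fix \<phi> assume \<phi>: "\<phi> \<in> (\<Pi>\<^sub>E b\<in>B - {e}. F b)"
    have "\<forall>b\<in>B - {e}. \<exists>p. \<phi> b = hyperplane (fst p) (snd p) \<and> norm (fst p) = 1 \<and> norm (fst p - b) \<le> \<epsilon> \<and>
        (1 - \<delta>) * n < snd p \<and> snd p \<le> (1 + 2 * \<delta>) * n"
    proof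
      fix b assume b: "b \<in> B - {e}"
      then have "\<phi> b \<in> sector b n" using PiE_mem[OF \<phi> b] F(1)[of b] by blast
      then obtain v s where "norm v = 1" "\<phi> b = hyperplane v s" "norm (v - b) \<le> \<epsilon>"
          "(1 - \<delta>) * n < s" "s \<le> (1 + 2 * \<delta>) * n"
        using sectorE[OF _ n0] b by blast
      then show "\<exists>p. \<phi> b = hyperplane (fst p) (snd p) \<and> norm (fst p) = 1 \<and> norm (fst p - b) \<le> \<epsilon> \<and>
        (1 - \<delta>) * n < snd p \<and> snd p \<le> (1 + 2 * \<delta>) * n"
        by (intro exI[of _ "(v, s)"]) simp
    qed
    from bchoice[OF this] obtain p where p: "\<forall>b\<in>B - {e}. \<phi> b = hyperplane (fst (p b)) (snd (p b)) \<and>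
        norm (fst (p b)) = 1 \<and> norm (fst (p b) - b) \<le> \<epsilon> \<and>
        (1 - \<delta>) * n < snd (p b) \<and> snd (p b) \<le> (1 + 2 * \<delta>) * n" ..
    define v where "v b = (if b = e then w else fst (p b))" for b
    define s where "s b = (if b = e then t else snd (p b))" for b
    have bound: "norm x \<le> C * (\<bar>x \<bullet> w\<bar> + (\<Sum>b\<in>B - {e}. \<bar>x \<bullet> v b\<bar>))" for x
      by (rule e(2)) (use p in \<open>simp add: v_def\<close>)
    have "\<exists>x. (\<Inter>b\<in>B. hyperplane (v b) (s b)) = {x}"
    proof (rule solution_exists[OF B(1,2)])
      fix y assume y: "\<And>b. b \<in> B \<Longrightarrow> y \<bullet> v b = 0"
      have "y \<bullet> w = 0" using y[OF e(1)] by (simp add: v_def)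
      then have "norm y \<le> 0" using bound[of y] y by simp
      then show "y = 0" by simp
    qed
    then obtain x where x: "(\<Inter>b\<in>B. hyperplane (v b) (s b)) = {x}" by blast
    have "(\<Inter>b\<in>B. hyperplane (v b) (s b)) =
        hyperplane (v e) (s e) \<inter> (\<Inter>b\<in>B - {e}. hyperplane (v b) (s b))"
      using e(1) by blast
    also have "(\<Inter>b\<in>B - {e}. hyperplane (v b) (s b)) = (\<Inter>b\<in>B - {e}. \<phi> b)"
      using p by (intro INF_cong) (auto simp: v_def s_def)
    finally have eq: "hyperplane w t \<inter> (\<Inter>b\<in>B - {e}. \<phi> b) = {x}"
      unfolding x by (simp add: v_def s_def)
    have xb: "x \<bullet> v b = s b" if "b \<in> B" for b using x that by (auto simp: hyperplane_def)
    have sb: "(1 - \<delta>) * n < x \<bullet> v b" "x \<bullet> v b \<le> 2 * real n" "norm (v b) = 1" if b: "b \<in> B - {e}" for b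
    proof -
      have le: "(1 + 2 * \<delta>) * n \<le> 2 * real n" using \<delta>(2) n0 by (intro mult_right_mono) auto
      have pb: "norm (fst (p b)) = 1" "(1 - \<delta>) * n < snd (p b)" "snd (p b) \<le> (1 + 2 * \<delta>) * n"
        using p b by blast+
      have xv: "x \<bullet> v b = snd (p b)" using xb[of b] b by (simp add: s_def)
      show "(1 - \<delta>) * n < x \<bullet> v b" unfolding xv by (rule pb(2))
      show "x \<bullet> v b \<le> 2 * real n" unfolding xv using pb(3) le by (rule order_trans)
      show "norm (v b) = 1" using pb(1) b by (simp add: v_def)
    qed
    have low: "(1 - \<delta>) * n \<ge> r"
    proof -
      have "1 / 2 * real n \<le> (1 - \<delta>) * n" using \<delta>(2) n0 by (intro mult_right_mono) auto
      then show ?thesis using n by simp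
    qed
    have "norm x \<le> C * (2 * real n + (\<Sum>b\<in>B - {e}. 2 * real n))"
    proof (rule order_trans[OF bound], intro mult_left_mono add_mono sum_mono)
      show "\<bar>x \<bullet> w\<bar> \<le> 2 * real n" using xb[OF e(1)] H(3) by (simp add: v_def s_def)
      show "\<bar>x \<bullet> v b\<bar> \<le> 2 * real n" if "b \<in> B - {e}" for b
        using sb[OF that] low r by simp
    qed (use C in simp)
    also have "\<dots> = C * (2 * real n + real (DIM('a) - 1) * (2 * real n))" by (simp add: cB)
    also have "\<dots> \<le> C * (2 * real n + real DIM('a) * (2 * real n))"
      using C n0 by (intro mult_left_mono add_left_mono mult_right_mono) auto
    also have "\<dots> \<le> outer * n" using n0 by (simp add: outer_def algebra_simps)
    finally have up: "norm x \<le> outer * n" .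
    \<comment> \<open>Since d \<ge> 2, some sector hyperplane passes through \<open>x\<close>; its
      distance from the origin exceeds n / 2, hence r, and keeps \<open>x\<close> off the
      ball.\<close>
    have "B - {e} \<noteq> {}" using cB d by (intro notI) simp
    then obtain b where b: "b \<in> B - {e}" by blast
    have "x \<bullet> v b \<le> norm x * norm (v b)" by (rule norm_cauchy_schwarz)
    then have "r \<le> norm x" using sb(1,3)[OF b] low by simp
    then have "x \<in> region n" using up by (simp add: region_def)
    then show "\<exists>x\<in>region n. hyperplane w t \<inter> (\<Inter>b\<in>B - {e}. \<phi> b) = {x}" using eq by blast
  qed
qed

section \<open>The stopping rule and its correctness\<close>

text \<open>A set of measures instead of an event in \<omega>, so that it can be tested on a
  restriction of \<Phi> alone.\<close>

definition complete_at :: "nat \<Rightarrow> 'a measure set" where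
  "complete_at n = {\<mu>\<in>space (measure_algebra borel). emeasure \<mu> UNIV < \<infinity> \<and>
     (\<forall>b\<in>B. grid \<le> card (certified points covers (atoms \<mu>) \<inter> sector b n))}"

lemma complete_at_sets: "complete_at n \<in> sets (measure_algebra borel)"
  unfolding complete_at_def
  by (intro certified_counts_sets points_pos covers_pos B(1) sector_sets)

abbreviation \<Phi> :: "'w \<Rightarrow> 'a measure" where
  "\<Phi> \<equiv> intersection_process \<eta>"

definition found :: "nat \<Rightarrow> 'w \<Rightarrow> bool" where
  "found n \<omega> \<longleftrightarrow> real n \<ge> 2 * r \<and> measure_restriction (\<Phi> \<omega>) (region n) \<in> complete_at n"

lemma found_iff:
  assumes w: "\<omega> \<in> space M"
  shows "found n \<omega> \<longleftrightarrow> real n \<ge> 2 * r \<and>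
    (\<forall>b\<in>B. grid \<le> card (certified points covers (intersection_points (\<eta> \<omega>) \<inter> region n) \<inter> sector b n))"
proof -
  have "emeasure (measure_restriction (\<Phi> \<omega>) (region n)) UNIV < \<infinity>"
    using finite_intersection_points_compact[OF config[OF w] compact_region]
    by (simp add: emeasure_restricted_intersection_process region_borel emeasure_count_space of_nat_less_top)
  moreover have "measure_restriction (\<Phi> \<omega>) (region n) \<in> space (measure_algebra borel)"
    by (simp add: space_measure_algebra measure_restriction_def)
  ultimately show ?thesis
    by (simp add: found_def complete_at_def atoms_restricted_intersection_process region_borel)
qed

definition good :: "'w \<Rightarrow> bool" where
  "good \<omega> \<longleftrightarrow> simple_configuration (\<eta> \<omega>) \<and> certified points covers (intersection_points (\<eta> \<omega>)) \<subseteq> \<eta> \<omega>"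

lemma AE_good: "AE \<omega> in M. good \<omega>"
  unfolding good_def covers_def
  using AE_simple_configuration AE_certified_subset[OF points_pos] by (rule AE_conjI)

lemma certified_region_subset:
  "good \<omega> \<Longrightarrow> certified points covers (intersection_points (\<eta> \<omega>) \<inter> region n) \<subseteq> \<eta> \<omega>"
  using certified_mono[of "intersection_points (\<eta> \<omega>) \<inter> region n" "intersection_points (\<eta> \<omega>)"]
  by (auto simp: good_def)

definition sparse :: "nat \<Rightarrow> 'w set" where
  "sparse n = (\<Union>b\<in>B. {\<omega>\<in>space M. card (\<eta> \<omega> \<inter> sector b n) < grid})"

text \<open>Sector hyperplanes have distance at most (1 + 2 \<delta>) n \<le> 2 n from the origin,
  so \<open>sectors_certify\<close> applies to them too: without a sparse sector, they certify each
  other.\<close>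

lemma found_dense:
  assumes w: "\<omega> \<in> space M" "good \<omega>" and n: "real n \<ge> 2 * r" and dense: "\<omega> \<notin> sparse n"
  shows "found n \<omega>"
  unfolding found_iff[OF w(1)]
proof (intro conjI ballI n)
  have n0: "real n > 0" using n r by simp
  fix b assume b: "b \<in> B"
  let ?T = "certified points covers (intersection_points (\<eta> \<omega>) \<inter> region n)"
  have fin: "finite (\<eta> \<omega> \<inter> sector b n)" for b
    by (rule finite_counts[OF w(1) sector_bounded[OF n0]])
  have "\<eta> \<omega> \<inter> sector b n \<subseteq> ?T \<inter> sector b n"
  proof
    fix H assume H: "H \<in> \<eta> \<omega> \<inter> sector b n"
    then obtain v s where v: "norm v = 1" "H = hyperplane v s" "(1 - \<delta>) * n < s" "s \<le> (1 + 2 * \<delta>) * n"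
      using sectorE[OF b n0] by blast
    have "(1 + 2 * \<delta>) * n \<le> 2 * real n" using \<delta>(2) n0 by (intro mult_right_mono) auto
    moreover have "0 \<le> (1 - \<delta>) * n" using \<delta>(2) n0 by simp
    ultimately have "\<bar>s\<bar> \<le> 2 * real n" using v(3,4) by linarith
    then have "hyperplane v s \<in> ?T"
      using w dense fin H v(1,2) n
      by (intro sectors_certify subset_hyperplanes) (auto simp: good_def sparse_def not_less)
    then show "H \<in> ?T \<inter> sector b n" using H v(2) by blast
  qed
  moreover have "?T \<inter> sector b n \<subseteq> \<eta> \<omega> \<inter> sector b n"
    using certified_region_subset[OF w(2)] by blast
  ultimately have "?T \<inter> sector b n = \<eta> \<omega> \<inter> sector b n" by blast
  then show "grid \<le> card (?T \<inter> sector b n)"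
    using dense b w(1) by (auto simp: sparse_def not_less)
qed

text \<open>Certified hyperplanes belong to \<eta>, so success shows that \<eta> really has enough
  hyperplanes in every sector. These certify each hyperplane of \<eta> hitting \<open>K\<close>,
  whose distance from the origin is below r.\<close>

lemma found_reconstruction:
  assumes w: "\<omega> \<in> space M" "good \<omega>" and n: "found n \<omega>" and K: "K \<subseteq> ball 0 r"
  shows "\<eta> \<omega> \<inter> hitting K = reconstruction points covers K (measure_restriction (\<Phi> \<omega>) (region n))"
proof -
  let ?T = "certified points covers (intersection_points (\<eta> \<omega>) \<inter> region n)"
  have n2: "real n \<ge> 2 * r" and n0: "real n > 0" using n r by (auto simp: found_def)
  have fin: "finite (\<eta> \<omega> \<inter> sector b n)" for b
    by (rule finite_counts[OF w(1) sector_bounded[OF n0]])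
  have sectors: "finite (\<eta> \<omega> \<inter> sector b n) \<and> grid \<le> card (\<eta> \<omega> \<inter> sector b n)" if b: "b \<in> B" for b
  proof
    have "grid \<le> card (?T \<inter> sector b n)" using n b unfolding found_iff[OF w(1)] by blast
    also have "\<dots> \<le> card (\<eta> \<omega> \<inter> sector b n)"
      using certified_region_subset[OF w(2)] by (intro card_mono fin) blast
    finally show "grid \<le> card (\<eta> \<omega> \<inter> sector b n)" .
  qed (rule fin)
  have "\<eta> \<omega> \<inter> hitting K \<subseteq> ?T"
  proof
    fix H assume H: "H \<in> \<eta> \<omega> \<inter> hitting K"
    then obtain y where y: "H \<in> hyperplanes" "y \<in> H" "y \<in> K" by (auto simp: hitting_def)
    obtain v s where v: "norm v = 1" "H = hyperplane v s" using y(1) by (rule hyperplanesE)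
    have "\<bar>y \<bullet> v\<bar> \<le> norm y * norm v" by (rule Cauchy_Schwarz_ineq2)
    also have "\<dots> < r" using y(3) K v(1) by auto
    finally have "\<bar>s\<bar> < r" using y(2) v(2) by (simp add: hyperplane_def)
    then have "\<bar>s\<bar> \<le> 2 * real n" using n2 r by simp
    then show "H \<in> ?T"
      unfolding v(2) using w sectors H v n2
      by (intro sectors_certify subset_hyperplanes) (auto simp: good_def)
  qed
  then have "\<eta> \<omega> \<inter> hitting K = ?T \<inter> hitting K"
    using certified_region_subset[OF w(2)] by blast
  moreover have "emeasure (measure_restriction (\<Phi> \<omega>) (region n)) UNIV < \<infinity>"
    using n by (simp add: found_def complete_at_def)
  ultimately show ?thesis
    by (simp add: reconstruction_def atoms_restricted_intersection_process region_borel)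
qed

section \<open>Sparse sectors, the stopping set and its tail\<close>

lemma sparse_sets: "real n > 0 \<Longrightarrow> sparse n \<in> sets M"
proof -
  assume n: "real n > 0"
  have [measurable]: "(\<lambda>\<omega>. card (\<eta> \<omega> \<inter> sector b n)) \<in> M \<rightarrow>\<^sub>M count_space UNIV" for b
    by (rule measurable_card[OF sector_sets sector_bounded[OF n]])
  show ?thesis unfolding sparse_def using B(1) by (intro sets.finite_UN) measurable
qed

lemma prob_sparse:
  assumes n: "real n > 0"
  shows "prob (sparse n) \<le> real DIM('a) * 2 ^ grid * exp (- a * n)"
proof -
  have [measurable]: "(\<lambda>\<omega>. card (\<eta> \<omega> \<inter> sector b n)) \<in> M \<rightarrow>\<^sub>M count_space UNIV" for b
    by (rule measurable_card[OF sector_sets sector_bounded[OF n]])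
  have "prob (sparse n) \<le> (\<Sum>b\<in>B. prob {\<omega>\<in>space M. card (\<eta> \<omega> \<inter> sector b n) < grid})"
    unfolding sparse_def using B(1) by (intro finite_measure_subadditive_finite) auto
  also have "\<dots> \<le> (\<Sum>b\<in>B. 2 ^ grid * exp (- a * n))"
  proof (rule sum_mono)
    fix b assume b: "b \<in> B"
    have "prob {\<omega>\<in>space M. card (\<eta> \<omega> \<inter> sector b n) < grid} \<le> 2 ^ grid * exp (- measure \<Lambda> (sector b n) / 2)"
      by (rule poisson_tail[OF sector_sets sector_bounded[OF n]])
    also have "\<dots> \<le> 2 ^ grid * exp (- a * n)"
      using intensity_sector[OF b n] by (intro mult_left_mono) auto
    finally show "prob {\<omega>\<in>space M. card (\<eta> \<omega> \<inter> sector b n) < grid} \<le> 2 ^ grid * exp (- a * n)" .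
  qed
  also have "\<dots> = real DIM('a) * 2 ^ grid * exp (- a * n)" by (simp add: B(2))
  finally show ?thesis .
qed

text \<open>Without success the value is the complement of the ball, which contains all annuli. So a
  closed set containing this default contains every value, and any other one can only be reached
  through a success.\<close>

definition explored :: "'w \<Rightarrow> 'a set" where
  "explored \<omega> = (if \<exists>n. found n \<omega> then region (LEAST n. found n \<omega>) else - ball 0 r)"

text \<open>Only successes at \<open>n\<close> with \<open>region n \<subseteq> F\<close> matter.
  Earlier annuli then lie in \<open>F\<close> as well, so \<Phi> restricted to \<open>F\<close>
  decides that \<open>n\<close> is the first success.\<close>

lemma explored_stopping_set: "stopping_set M \<Phi> explored"
  unfolding stopping_set_def
proof (intro conjI allI ballI impI random_measure_intersection_process)
  fix \<omega>
  have "closed (explored \<omega>) \<and> explored \<omega> \<noteq> {}"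
  proof (cases "\<exists>n. found n \<omega>")
    case True
    then have "found (LEAST n. found n \<omega>) \<omega>" by (rule LeastI_ex)
    then have "real (LEAST n. found n \<omega>) \<ge> r" using r by (simp add: found_def)
    then show ?thesis
      using True region_nonempty compact_imp_closed[OF compact_region] by (simp add: explored_def)
  next
    case False
    obtain b where "b \<in> B" using B(1,2) by (metis DIM_positive card.empty ex_in_conv less_irrefl)
    then have "r *\<^sub>R b \<in> - ball 0 r" using B(3) r by auto
    then have "- ball (0::'a) r \<noteq> {}" by blast
    then show ?thesis using False by (simp add: explored_def closed_Compl)
  qed
  then show "closed (explored \<omega>)" "explored \<omega> \<noteq> {}" by auto
next
  fix F :: "'a set" assume F: "closed F"
  let ?V = "vimage_algebra (space M) (\<lambda>\<omega>. measure_restriction (\<Phi> \<omega>) F) (measure_algebra borel)"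
  have V: "(\<lambda>\<omega>. measure_restriction (\<Phi> \<omega>) F) \<in> ?V \<rightarrow>\<^sub>M measure_algebra borel"
    by (rule measurable_vimage_algebra1) (auto simp: space_measure_algebra measure_restriction_def)
  have meas: "Measurable.pred ?V (found n)" if sub: "region n \<subseteq> F" for n
  proof (cases "real n \<ge> 2 * r")
    case True
    have "(\<lambda>\<omega>. measure_restriction (measure_restriction (\<Phi> \<omega>) F) (region n)) \<in> ?V \<rightarrow>\<^sub>M measure_algebra borel"
      using V by (rule measurable_compose) (intro measurable_measure_restriction region_borel)
    moreover have "measure_restriction (measure_restriction (\<Phi> \<omega>) F) (region n) =
        measure_restriction (\<Phi> \<omega>) (region n)" for \<omega>
      using F sub region_borel by (intro measure_restriction_restriction) (auto simp: borel_closed)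
    ultimately have "(\<lambda>\<omega>. measure_restriction (\<Phi> \<omega>) (region n)) \<in> ?V \<rightarrow>\<^sub>M measure_algebra borel"
      by (simp only:)
    from measurable_sets[OF this complete_at_sets[of n]] show ?thesis
      using True unfolding found_def pred_def by (simp add: vimage_def Int_def conj_commute)
  next
    case False
    then have "found n = (\<lambda>_. False)" by (auto simp: found_def)
    then show ?thesis by simp
  qed
  show "{\<omega>\<in>space M. explored \<omega> \<subseteq> F} \<in> sets ?V"
  proof (cases "- ball 0 r \<subseteq> F")
    case True
    have "explored \<omega> \<subseteq> F" for \<omega>
      using True by (auto simp: explored_def region_def)
    then have "{\<omega>\<in>space M. explored \<omega> \<subseteq> F} = space ?V" by simp
    then show ?thesis by (simp only: sets.top)
  next
    case False
    have "{\<omega>\<in>space M. explored \<omega> \<subseteq> F} =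
        (\<Union>n\<in>{n. region n \<subseteq> F}. {\<omega>\<in>space ?V. found n \<omega> \<and> (\<forall>m\<in>{..<n}. \<not> found m \<omega>)})"
    proof (intro equalityI subsetI)
      fix \<omega> assume "\<omega> \<in> {\<omega>\<in>space M. explored \<omega> \<subseteq> F}"
      then have w: "\<omega> \<in> space M" and sub: "explored \<omega> \<subseteq> F" by auto
      have ex: "\<exists>n. found n \<omega>" using sub False by (auto simp: explored_def split: if_splits)
      define l where "l = (LEAST n. found n \<omega>)"
      have "found l \<omega>" unfolding l_def using ex by (rule LeastI_ex)
      moreover have "\<forall>m\<in>{..<l}. \<not> found m \<omega>" unfolding l_def by (auto dest: not_less_Least)
      moreover have "region l \<subseteq> F" using sub ex by (simp add: explored_def l_def)
      ultimately show "\<omega> \<in> (\<Union>n\<in>{n. region n \<subseteq> F}. {\<omega>\<in>space ?V. found n \<omega> \<and> (\<forall>m\<in>{..<n}. \<not> found m \<omega>)})"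
        using w by (intro UN_I[of l]) simp_all
    next
      fix \<omega> assume "\<omega> \<in> (\<Union>n\<in>{n. region n \<subseteq> F}. {\<omega>\<in>space ?V. found n \<omega> \<and> (\<forall>m\<in>{..<n}. \<not> found m \<omega>)})"
      then obtain n where n: "region n \<subseteq> F" "\<omega> \<in> space M" "found n \<omega>" "\<And>m. m < n \<Longrightarrow> \<not> found m \<omega>"
        by (elim UN_E CollectE conjE) (simp add: Ball_def)
      have "n \<le> m" if "found m \<omega>" for m using n(4)[of m] that by (meson not_le)
      then have "(LEAST n. found n \<omega>) = n" using n(3) by (rule Least_equality[rotated])
      then have "explored \<omega> = region n" using n(3) by (auto simp: explored_def)
      then show "\<omega> \<in> {\<omega>\<in>space M. explored \<omega> \<subseteq> F}" using n(1,2) by simp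
    qed
    also have "\<dots> \<in> sets ?V"
    proof (rule sets.countable_UN''[OF countableI_type])
      fix n assume "n \<in> {n. region n \<subseteq> F}"
      then have "Measurable.pred ?V (found m)" if "m \<le> n" for m
        using region_mono[OF that] by (intro meas) auto
      then have [measurable]: "Measurable.pred ?V (found n)" "\<And>m. m \<in> {..<n} \<Longrightarrow> Measurable.pred ?V (found m)"
        by auto
      show "{\<omega>\<in>space ?V. found n \<omega> \<and> (\<forall>m\<in>{..<n}. \<not> found m \<omega>)} \<in> sets ?V"
        by measurable
    qed
    finally show ?thesis .
  qed
qed

text \<open>Permanent failure would force sparse sectors at every large n, and their probabilities
  tend to 0; no independence between different n is involved.\<close>

lemma AE_found: "AE \<omega> in M. \<exists>n. found n \<omega>"
proof -
  obtain n0 :: nat where n0: "real n0 \<ge> 2 * r" using real_arch_simple by blast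
  define X where "X = (\<Inter>k. sparse (n0 + k))"
  have pos: "real (n0 + k) > 0" for k using n0 r by simp
  have X: "X \<in> sets M" unfolding X_def using sparse_sets[OF pos] by auto
  have "prob X \<le> real DIM('a) * 2 ^ grid * exp (- a * real (n0 + k))" for k
  proof -
    have "prob X \<le> prob (sparse (n0 + k))"
      by (intro finite_measure_mono sparse_sets pos) (auto simp: X_def)
    also have "\<dots> \<le> real DIM('a) * 2 ^ grid * exp (- a * real (n0 + k))" by (rule prob_sparse[OF pos])
    finally show ?thesis .
  qed
  note bound = this
  have lim: "(\<lambda>k. real DIM('a) * 2 ^ grid * exp (- a * real (n0 + k))) \<longlonglongrightarrow> 0"
  proof -
    have "filterlim (\<lambda>k. real (n0 + k)) at_top sequentially"
      by (intro filterlim_compose[OF filterlim_real_sequentially] filterlim_subseq strict_monoI) simp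
    then have "filterlim (\<lambda>k. - a * real (n0 + k)) at_bot sequentially"
      using a(1) by (intro filterlim_tendsto_neg_mult_at_bot[OF tendsto_const]) auto
    then have "(\<lambda>k. exp (- a * real (n0 + k))) \<longlonglongrightarrow> 0" by (rule filterlim_compose[OF exp_at_bot])
    then show ?thesis by (rule tendsto_mult_right_zero)
  qed
  have "prob X \<le> 0" using LIMSEQ_le_const[OF lim, of "prob X"] bound by blast
  then have "prob X = 0" by (simp add: measure_le_0_iff)
  then have "X \<in> null_sets M" using X by (simp add: null_sets_def emeasure_eq_measure)
  from AE_not_in[OF this] AE_good AE_space show ?thesis
  proof eventually_elim
    case (elim \<omega>)
    then obtain k where "\<omega> \<notin> sparse (n0 + k)" by (auto simp: X_def)
    then have "found (n0 + k) \<omega>" using elim n0 by (intro found_dense) auto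
    then show ?case by blast
  qed
qed

lemma explored_radius:
  assumes "found n \<omega>"
  shows "origin_radius (explored \<omega>) \<le> ereal (outer * n)"
proof (rule origin_radius_le)
  have "region (LEAST n. found n \<omega>) \<subseteq> region n" using assms by (intro region_mono Least_le)
  then show "explored \<omega> \<subseteq> cball 0 (outer * n)" using assms by (auto simp: explored_def region_def)
  show "0 \<le> outer * n" using outer_ge by simp
qed

text \<open>Outside a null set, a radius above s forces a sparse sector at the largest n with outer
  radius at most s, provided this n is admissible.\<close>

lemma explored_tail:
  "\<exists>c1>0. \<exists>c2>0. \<forall>s\<ge>1. prob {\<omega>\<in>space M. origin_radius (explored \<omega>) > ereal s} \<le> c1 * exp (- c2 * s)"
proof -
  obtain n0 :: nat where n0: "real n0 \<ge> 2 * r" using real_arch_simple by blast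
  define L where "L = real DIM('a) * 2 ^ grid"
  have L: "L > 0" by (simp add: L_def)
  \<comment> \<open>The factor \<open>exp a\<close> pays for rounding s / outer down to
    \<open>n\<close>. The second summand makes the bound at least 1 while \<open>n\<close> is below
    \<open>n0\<close>.\<close>
  define c1 where "c1 = L * exp a + exp (a * (n0 + 1))"
  define c2 where "c2 = a / outer"
  have "prob {\<omega>\<in>space M. origin_radius (explored \<omega>) > ereal s} \<le> c1 * exp (- c2 * s)" (is "prob ?X \<le> _")
    if s: "s \<ge> 1" for s
  proof -
    define n where "n = nat \<lfloor>s / outer\<rfloor>"
    have "s / outer \<ge> 0" using s outer_ge by simp
    then have n: "real n \<le> s / outer" "s / outer < real n + 1"
      unfolding n_def by linarith+
    have split: "c1 * exp (- c2 * s) = L * exp (a - a * (s / outer)) + exp (a * (n0 + 1) - a * (s / outer))"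
      by (simp add: c1_def c2_def distrib_right mult.assoc exp_add[symmetric])
    show ?thesis
    proof (cases "n0 \<le> n")
      case True
      then have n2: "real n \<ge> 2 * r" using n0 by linarith
      then have pos: "real n > 0" using r by simp
      have "AE \<omega> in M. \<omega> \<in> ?X \<longrightarrow> \<omega> \<in> sparse n"
        using AE_good AE_space
      proof eventually_elim
        case (elim \<omega>)
        have "\<omega> \<notin> ?X" if "\<omega> \<notin> sparse n"
        proof -
          have "origin_radius (explored \<omega>) \<le> ereal (outer * n)"
            by (intro explored_radius found_dense elim n2 that)
          also have "\<dots> \<le> ereal s" using n(1) outer_ge by (simp add: pos_le_divide_eq mult.commute)
          finally show ?thesis by (simp add: not_less)
        qed
        then show ?case by blast
      qed
      then have "prob ?X \<le> prob (sparse n)" by (rule finite_measure_mono_AE[OF _ sparse_sets[OF pos]])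
      also have "\<dots> \<le> L * exp (- a * n)" unfolding L_def by (rule prob_sparse[OF pos])
      also have "\<dots> \<le> L * exp (a - a * (s / outer))"
      proof -
        have "a * (s / outer) \<le> a * (real n + 1)" using n(2) a(1) by (intro mult_left_mono) auto
        then show ?thesis using L by (simp add: distrib_left)
      qed
      also have "\<dots> \<le> c1 * exp (- c2 * s)" unfolding split by simp
      finally show ?thesis .
    next
      case False
      then have "real n + 1 \<le> real n0 + 1" by simp
      then have "s / outer \<le> real n0 + 1" using n(2) by linarith
      then have "a * (s / outer) \<le> a * (real n0 + 1)" using a(1) by (intro mult_left_mono) auto
      moreover have "real (n0 + 1) = real n0 + 1" by simp
      ultimately have "a * (s / outer) \<le> a * real (n0 + 1)" by (simp only:)
      then have "1 \<le> exp (a * (n0 + 1) - a * (s / outer))" unfolding one_le_exp_iff by linarith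
      also have "\<dots> \<le> c1 * exp (- c2 * s)" unfolding split using L by simp
      finally show ?thesis using prob_le_1[of ?X] by linarith
    qed
  qed
  moreover have "c1 > 0" using L by (simp add: c1_def add_pos_pos)
  moreover have "c2 > 0" using a(1) outer_ge by (simp add: c2_def)
  ultimately show ?thesis by blast
qed

lemma explored_determined:
  assumes K: "compact K" "K \<subseteq> ball 0 r"
  shows "almost_surely_determined M \<eta> K \<Phi> explored"
  unfolding almost_surely_determined_def
proof (intro exI conjI)
  show "reconstruction points covers K \<in> measure_algebra borel \<rightarrow>\<^sub>M configuration_algebra"
    by (rule measurable_reconstruction[OF points_pos covers_pos K(1)])
  show "AE \<omega> in M. \<eta> \<omega> \<inter> hitting K =
      reconstruction points covers K (measure_restriction (\<Phi> \<omega>) (explored \<omega>))"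
    using AE_found AE_good AE_space
  proof eventually_elim
    case (elim \<omega>)
    have "found (LEAST n. found n \<omega>) \<omega>" using elim(1) by (rule LeastI_ex)
    from found_reconstruction[OF elim(3,2) this K(2)] show ?case
      using elim(1) by (simp add: explored_def)
  qed
qed

end

theorem theorem4p1:
  fixes M :: "'w measure"
    and Q :: "'a::euclidean_space measure"
    and \<gamma> :: real
    and \<eta> :: "'w \<Rightarrow> 'a set set"
    and K :: "'a set"
  assumes "DIM('a) \<ge> 2"
    and "prob_space M"
    and "\<gamma> > 0"
    and "directional_distribution Q"
    and "poisson_hyperplane_process M \<gamma> Q \<eta>"
    and "convex K" and "compact K"
  shows "\<exists>Z. stopping_set M (intersection_process \<eta>) Z \<and>
             (\<forall>\<omega>\<in>space M. Z \<omega> \<subseteq> - K) \<and>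
             almost_surely_determined M \<eta> K (intersection_process \<eta>) Z \<and>
             (\<exists>c1>0. \<exists>c2>0. \<forall>s\<ge>1.
                measure M {\<omega>\<in>space M. origin_radius (Z \<omega>) > ereal s} \<le> c1 * exp (- c2 * s))"
proof -
  interpret poisson_hyperplanes M \<gamma> Q \<eta>
    using assms by (simp add: poisson_hyperplanes_def poisson_hyperplanes_axioms_def)
  interpret Q: prob_space Q using assms(4) by (simp add: directional_distribution_def)
  obtain B where B: "finite B" "card B = DIM('a)" "span B = UNIV" "B \<subseteq> sphere 0 1"
    and supp: "\<And>b \<delta>. b \<in> B \<Longrightarrow> \<delta> > 0 \<Longrightarrow> emeasure Q {u\<in>sphere 0 1. b \<bullet> u > 1 - \<delta>} > 0"
    using support_basis[OF assms(4)] by blast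
  obtain C \<epsilon> where C: "C > 0" and \<epsilon>: "\<epsilon> > 0"
    and exch: "\<And>w. norm w = 1 \<Longrightarrow> \<exists>e\<in>B. \<forall>v. (\<forall>b\<in>B - {e}. norm (v b - b) \<le> \<epsilon>) \<longrightarrow>
      (\<forall>x. norm x \<le> C * (\<bar>x \<bullet> w\<bar> + (\<Sum>b\<in>B - {e}. \<bar>x \<bullet> v b\<bar>)))"
    using exchange_norm_bound[OF B(1,3,4)] by blast
  \<comment> \<open>The bound 1/2 keeps sector distances between n / 2 and 2 n; the other bound
    keeps the normals within \<epsilon> of \<open>b\<close>.\<close>
  define \<delta> where "\<delta> = min (1 / 2) (\<epsilon>\<^sup>2 / 6)"
  have \<delta>: "0 < \<delta>" "\<delta> \<le> 1 / 2" "6 * \<delta> \<le> \<epsilon>\<^sup>2" using \<epsilon> by (auto simp: \<delta>_def)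
  define p where "p b = \<gamma> * \<delta> * measure Q {u\<in>sphere 0 1. b \<bullet> u > 1 - \<delta>}" for b
  \<comment> \<open>A minimum of finitely many numbers, each positive because the basis vectors lie
    in the support of Q.\<close>
  define a where "a = Min (p ` B)"
  have ne: "p ` B \<noteq> {}" "finite (p ` B)" using B(1,2) by auto
  have p: "p b > 0" if "b \<in> B" for b
    using supp[OF that \<delta>(1)] assms(3) \<delta>(1) by (simp add: p_def Q.emeasure_eq_measure)
  have a: "a > 0" "a \<le> p b" if "b \<in> B" for b
    using that p ne by (auto simp: a_def)
  obtain r0 where r0: "K \<subseteq> ball 0 r0"
    using bounded_subset_ballD[OF compact_imp_bounded[OF assms(7)], of 0] by blast
  define r where "r = max 1 r0"
  have r: "r \<ge> 1" "K \<subseteq> ball 0 r" using r0 by (auto simp: r_def)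
  note K_ball = r(2)
  have "B \<noteq> {}" using ne(1) by auto
  interpret exploration M \<gamma> Q \<eta> B C \<epsilon> \<delta> r a
    by unfold_locales (use assms(1) B C exch \<epsilon> \<delta> r a \<open>B \<noteq> {}\<close> in \<open>auto simp: p_def\<close>)
  have "explored \<omega> \<subseteq> - K" for \<omega>
    using K_ball by (auto simp: explored_def region_def)
  then show ?thesis
    using explored_stopping_set explored_determined[OF assms(7) K_ball] explored_tail by blast
qed

end
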